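(* Let $m\in C^\infty(\mathbb{T}^d;\mathbb{R})$, $\kappa>0$, $\lambda(k)=(\kappa^2+4\pi^2|k|^2)^{1/2}$, let $W$ be white noise on $\mathbb{T}^d$, and let $u=\mathrm{Op}(q_m)W$ with $q_m(x,k)=\lambda(k)^{-m(x)}$ be the variable-order Matérn field with order function $m$. Then the covariance kernel of $u$ is $$C_u(x,y)=\sum_{k\in\mathbb{Z}^d}\lambda(k)^{-(m(x)+m(y))}\,e^{2\pi i k\cdot(x-y)},$$ which is positive semi-definite for every real-valued $m$, and is finite on the diagonal at $x$ (i.e. $C_u(x,x)<\infty$) if and only if $m(x)>d/2$. When $m\equiv\nu+d/2$ is constant with $\nu>0$, $C_u$ is, up to a positive multiplicative normalisation constant, the Whittle–Matérn covariance with smoothness $\nu$ on $\mathbb{T}^d$, $$k_\nu(x,y)=\sigma^2\,\frac{2^{1-\nu}}{\Gamma(\nu)}\sum_{n\in\mathbb{Z}^d}\bigl(\kappa\|x-y+n\|\bigr)^{\nu}K_\nu\bigl(\kappa\|x-y+n\|\bigr).$$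
   Context: $\mathbb{T}^d=\mathbb{R}^d/\mathbb{Z}^d$ has total mass $1$; $\hat f(k)=\int_{\mathbb{T}^d}f(x)e^{-2\pi ik\cdot x}dx$; $\mathcal{S}(\mathbb{T}^d)=C^\infty(\mathbb{T}^d)$. A real generalized random field (GeRF) $Z$ is a continuous linear map $\mathcal{S}(\mathbb{T}^d)\to L^2(\Omega,\mathcal{A},\mathbb{P})$ taking real test functions to real random variables, written $\varphi\mapsto\langle Z,\varphi\rangle$; all GeRFs have mean zero. Its covariance distribution (kernel) $C_Z\in\mathcal{S}'(\mathbb{T}^d\times\mathbb{T}^d)$ is determined by $\mathrm{Cov}(\langle Z,\varphi\rangle,\langle Z,\phi\rangle)=\langle C_Z,\varphi\otimes\bar\phi\rangle$, where $\mathrm{Cov}(X,Y)=\mathbb{E}[X\overline{Y}]$. Where the series for $C_u$ does not converge pointwise it is understood in the sense of distributions; positive semi-definiteness is likewise understood as $\langle C_u,\varphi\otimes\bar\varphi\rangle\ge0$ for all $\varphi\in\mathcal{S}(\mathbb{T}^d)$. White noise $W$ is the real GeRF with $\langle C_W,\varphi\otimes\bar\phi\rangle=\int_{\mathbb{T}^d}\varphi\bar\phi\,dx$. For $p:\mathbb{T}^d\times\mathbb{Z}^d\to\mathbb{C}$, $\mathrm{Op}(p)f(x)=\sum_{k\in\mathbb{Z}^d}p(x,k)\hat f(k)e^{2\pi ik\cdot x}$. The field $u=\mathrm{Op}(q_m)W$ is the GeRF defined by $\langle u,\varphi\rangle:=\langle W,\mathrm{Op}(q_m)^*\varphi\rangle$,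 where $\mathrm{Op}(q_m)^*$ is the $L^2$-adjoint, which maps $\mathcal{S}(\mathbb{T}^d)$ into itself. $K_\nu$ is the modified Bessel function of the second kind ($z^\nu K_\nu(z)$ is extended to $z=0$ by its limit), and $\sigma>0$. *)

theory Defs
  imports "HOL-Probability.Probability"
begin

(* A function on the torus R^d/Z^d is a Z^d-periodic function on R^d.  The definitions are stated
   for an arbitrary Euclidean space 'a and its standard integer lattice, so that T^d is the case
   'a = real^'n and T^d x T^d is the case 'a = real^'n \<times> real^'n. *)

definition int_lattice :: "'a::euclidean_space set" where
  "int_lattice = {k. \<forall>b\<in>Basis. k \<bullet> b \<in> \<int>}"

definition partial_deriv ::
  "'a::euclidean_space \<Rightarrow> ('a \<Rightarrow> 'b::real_normed_vector) \<Rightarrow> 'a \<Rightarrow> 'b" where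
  "partial_deriv b f x = vector_derivative (\<lambda>t. f (x + t *\<^sub>R b)) (at 0)"

definition iter_partial ::
  "'a::euclidean_space list \<Rightarrow> ('a \<Rightarrow> 'b::real_normed_vector) \<Rightarrow> 'a \<Rightarrow> 'b" where
  "iter_partial bs f = foldr partial_deriv bs f"

(* The smooth functions on the torus: periodic, and all iterated partial derivatives exist and are
   continuous. *)
definition torus_smooth :: "('a::euclidean_space \<Rightarrow> 'b::real_normed_vector) set" where
  "torus_smooth = {f.
     (\<forall>x. \<forall>n\<in>int_lattice. f (x + n) = f x) \<and>
     (\<forall>bs\<in>lists Basis. continuous_on UNIV (iter_partial bs f) \<and>
        (\<forall>b\<in>Basis. \<forall>x. (\<lambda>t. iter_partial bs f (x + t *\<^sub>R b)) differentiable at 0))}"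

(* Basic neighbourhoods of f in the usual Frechet topology (uniform convergence of every
   derivative). *)
definition smooth_nhd ::
  "nat \<Rightarrow> real \<Rightarrow> ('a::euclidean_space \<Rightarrow> complex) \<Rightarrow> ('a \<Rightarrow> complex) set" where
  "smooth_nhd N \<delta> f = {g \<in> torus_smooth.
     \<forall>bs\<in>lists Basis. length bs \<le> N \<longrightarrow>
       (\<forall>x. norm (iter_partial bs (\<lambda>z. g z - f z) x) < \<delta>)}"

definition torus_integral :: "('a::euclidean_space \<Rightarrow> complex) \<Rightarrow> complex" where
  "torus_integral f = (LINT x:cbox 0 One|lborel. f x)"

definition torus_inner :: "('a::euclidean_space \<Rightarrow> complex) \<Rightarrow> ('a \<Rightarrow> complex) \<Rightarrow> complex" where
  "torus_inner f g = torus_integral (\<lambda>x. f x * cnj (g x))"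

definition character :: "'a::euclidean_space \<Rightarrow> 'a \<Rightarrow> complex" where
  "character k x = exp (2 * of_real pi * \<i> * of_real (k \<bullet> x))"

definition fourier_coeff :: "('a::euclidean_space \<Rightarrow> complex) \<Rightarrow> 'a \<Rightarrow> complex" where
  "fourier_coeff f k = torus_integral (\<lambda>x. f x * character k (- x))"

definition Op ::
  "('a::euclidean_space \<Rightarrow> 'a \<Rightarrow> complex) \<Rightarrow> ('a \<Rightarrow> complex) \<Rightarrow> 'a \<Rightarrow> complex" where
  "Op p f x = (\<Sum>\<^sub>\<infinity>k\<in>int_lattice. p x k * fourier_coeff f k * character k x)"

definition L2_adjoint ::
  "(('a::euclidean_space \<Rightarrow> complex) \<Rightarrow> 'a \<Rightarrow> complex) \<Rightarrow> ('a \<Rightarrow> complex) \<Rightarrow> 'a \<Rightarrow> complex" where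
  "L2_adjoint T \<phi> = (THE \<psi>. \<psi> \<in> torus_smooth \<and>
     (\<forall>f\<in>torus_smooth. torus_inner (T f) \<phi> = torus_inner f \<psi>))"

(* Only the values on torus_smooth matter. *)
definition distribution_on_torus :: "(('a::euclidean_space \<Rightarrow> complex) \<Rightarrow> complex) \<Rightarrow> bool" where
  "distribution_on_torus C \<longleftrightarrow>
     (\<forall>f\<in>torus_smooth. \<forall>g\<in>torus_smooth. \<forall>a b.
        C (\<lambda>x. a * f x + b * g x) = a * C f + b * C g) \<and>
     (\<forall>f\<in>torus_smooth. \<forall>\<epsilon>>0. \<exists>N. \<exists>\<delta>>0. \<forall>g\<in>smooth_nhd N \<delta> f. norm (C g - C f) < \<epsilon>)"

definition tensor_cnj ::
  "('a \<Rightarrow> complex) \<Rightarrow> ('a \<Rightarrow> complex) \<Rightarrow> 'a \<times> 'a \<Rightarrow> complex" where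
  "tensor_cnj \<phi> \<psi> = (\<lambda>(x, y). \<phi> x * cnj (\<psi> y))"

definition square_integrable :: "'w measure \<Rightarrow> ('w \<Rightarrow> complex) \<Rightarrow> bool" where
  "square_integrable M X \<longleftrightarrow>
     X \<in> borel_measurable M \<and> integrable M (\<lambda>w. (norm (X w))\<^sup>2)"

definition L2_dist :: "'w measure \<Rightarrow> ('w \<Rightarrow> complex) \<Rightarrow> ('w \<Rightarrow> complex) \<Rightarrow> real" where
  "L2_dist M X Y = sqrt (LINT w|M. (norm (X w - Y w))\<^sup>2)"

(* Real, mean-zero generalized random fields; random variables are identified almost surely. *)
definition gerf ::
  "'w measure \<Rightarrow> (('a::euclidean_space \<Rightarrow> complex) \<Rightarrow> 'w \<Rightarrow> complex) \<Rightarrow> bool" where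
  "gerf M Z \<longleftrightarrow>
     (\<forall>\<phi>\<in>torus_smooth. square_integrable M (Z \<phi>)) \<and>
     (\<forall>\<phi>\<in>torus_smooth. \<forall>\<psi>\<in>torus_smooth. \<forall>a b.
        AE w in M. Z (\<lambda>x. a * \<phi> x + b * \<psi> x) w = a * Z \<phi> w + b * Z \<psi> w) \<and>
     (\<forall>\<phi>\<in>torus_smooth. \<forall>\<epsilon>>0. \<exists>N. \<exists>\<delta>>0. \<forall>\<psi>\<in>smooth_nhd N \<delta> \<phi>. L2_dist M (Z \<psi>) (Z \<phi>) < \<epsilon>) \<and>
     (\<forall>\<phi>\<in>torus_smooth. (\<forall>x. \<phi> x \<in> \<real>) \<longrightarrow> (AE w in M. Z \<phi> w \<in> \<real>)) \<and>
     (\<forall>\<phi>\<in>torus_smooth. (LINT w|M. Z \<phi> w) = 0)"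

definition covariance_kernel ::
  "'w measure \<Rightarrow> (('a::euclidean_space \<Rightarrow> complex) \<Rightarrow> 'w \<Rightarrow> complex) \<Rightarrow>
     (('a \<times> 'a \<Rightarrow> complex) \<Rightarrow> complex) \<Rightarrow> bool" where
  "covariance_kernel M Z C \<longleftrightarrow>
     distribution_on_torus C \<and>
     (\<forall>\<phi>\<in>torus_smooth. \<forall>\<psi>\<in>torus_smooth.
        (LINT w|M. Z \<phi> w * cnj (Z \<psi> w)) = C (tensor_cnj \<phi> \<psi>))"

(* Gaussianity is not part of the definition. *)
definition white_noise ::
  "'w measure \<Rightarrow> (('a::euclidean_space \<Rightarrow> complex) \<Rightarrow> 'w \<Rightarrow> complex) \<Rightarrow> bool" where
  "white_noise M W \<longleftrightarrow> gerf M W \<and>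
     (\<exists>C. covariance_kernel M W C \<and>
        (\<forall>\<phi>\<in>torus_smooth. \<forall>\<psi>\<in>torus_smooth. C (tensor_cnj \<phi> \<psi>) = torus_inner \<phi> \<psi>))"

definition Op_field ::
  "('a::euclidean_space \<Rightarrow> 'a \<Rightarrow> complex) \<Rightarrow>
     (('a \<Rightarrow> complex) \<Rightarrow> 'w \<Rightarrow> complex) \<Rightarrow> ('a \<Rightarrow> complex) \<Rightarrow> 'w \<Rightarrow> complex" where
  "Op_field p W \<phi> = W (L2_adjoint (Op p) \<phi>)"

definition positive_semidefinite ::
  "(('a::euclidean_space \<times> 'a \<Rightarrow> complex) \<Rightarrow> complex) \<Rightarrow> bool" where
  "positive_semidefinite C \<longleftrightarrow> (\<forall>\<phi>\<in>torus_smooth. C (tensor_cnj \<phi> \<phi>) \<in> \<real>\<^sub>\<ge>\<^sub>0)"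

definition freq_weight :: "real \<Rightarrow> 'a::euclidean_space \<Rightarrow> real" where
  "freq_weight \<kappa> k = sqrt (\<kappa>\<^sup>2 + 4 * pi\<^sup>2 * (norm k)\<^sup>2)"

definition matern_symbol ::
  "real \<Rightarrow> ('a::euclidean_space \<Rightarrow> real) \<Rightarrow> 'a \<Rightarrow> 'a \<Rightarrow> complex" where
  "matern_symbol \<kappa> m x k = of_real (freq_weight \<kappa> k powr (- m x))"

definition matern_term ::
  "real \<Rightarrow> ('a::euclidean_space \<Rightarrow> real) \<Rightarrow> 'a \<Rightarrow> 'a \<times> 'a \<Rightarrow> complex" where
  "matern_term \<kappa> m k = (\<lambda>(x, y).
     of_real (freq_weight \<kappa> k powr (- (m x + m y))) * character k (x - y))"

(* The modified Bessel function of the second kind at z > 0, for real order, by its standard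
   integral representation. *)
definition bessel_K :: "real \<Rightarrow> real \<Rightarrow> real" where
  "bessel_K \<nu> z = (LINT t:{0..}|lborel. exp (- z * cosh t) * cosh (\<nu> * t))"

definition matern_profile :: "real \<Rightarrow> real \<Rightarrow> real" where
  "matern_profile \<nu> z =
     (if z = 0 then Lim (at_right 0) (\<lambda>r. r powr \<nu> * bessel_K \<nu> r) else z powr \<nu> * bessel_K \<nu> z)"

definition whittle_matern ::
  "real \<Rightarrow> real \<Rightarrow> real \<Rightarrow> 'a::euclidean_space \<Rightarrow> 'a \<Rightarrow> real" where
  "whittle_matern \<sigma> \<kappa> \<nu> x y = \<sigma>\<^sup>2 * (2 powr (1 - \<nu>) / Gamma \<nu>) *
     (\<Sum>\<^sub>\<infinity>n\<in>int_lattice. matern_profile \<nu> (\<kappa> * norm (x - y + n)))"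

end

theory Submission
  imports Defs
begin

text \<open>
  All decay comes from one estimate. For a smooth order function \<open>g\<close> the integrals
  \<open>\<integral> \<lambda>(k)\<^bsup>-g(x)\<^esup> \<phi>(x) e\<^bsup>-2\<pi>ik\<cdot>x\<^esup> dx\<close> decay faster than any power of \<open>\<lambda>(k)\<close>: each integration by
  parts gains a factor \<open>\<lambda>(k)\<close> and costs only a factor \<open>1 + |ln \<lambda>(k)|\<close>. Applied on the torus it shows
  that these integrals are the Fourier coefficients of the smooth function \<open>Op(q)\<^sup>* \<phi>\<close>; applied on
  the product torus, with order function \<open>m(x) + m(y)\<close> and frequency \<open>(-k, k)\<close>, it shows that the
  series for the kernel converges absolutely as a distribution. Characters of the product torus are
  tensor products, so the Fourier expansion of smooth functions determines the kernel from its values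
  on tensors.

  The weights are treated by the subordination
  \<open>\<Gamma>(s/2) \<lambda>(k)\<^bsup>-s\<^esup> = \<integral> t\<^bsup>s/2-1\<^esup> e\<^bsup>-t\<lambda>(k)\<^sup>2\<^esup> dt\<close> and the Poisson summation formula for Gaussians. The growth
  \<open>t\<^bsup>-d/2\<^esup>\<close> of the heat trace at \<open>t = 0\<close> gives the summability threshold \<open>s > d\<close>, and transforming
  the heat kernel inside the integral gives the periodised Matern covariance, whose Bessel function
  arises from the substitution \<open>t = (z/2) e\<^sup>s\<close>.
\<close>

section \<open>The integer lattice and its unit cell\<close>

text \<open>Smoothness means only continuous directional derivatives, and the torus integral is an
  integral over a cube, so integration by parts is drawn from translation invariance of that
  integral, which is itself obtained by cutting along the lattice. The order \<open>m\<close> may be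
  small or negative, so neither the symbol nor the kernel series decays pointwise in general: all
  convergence has to come from the test function. The logarithm lost at each integration by parts is
  absorbed into half a power of the weight, which leaves a net gain of half an order per step. The
  constants are uniform in the test function and involve finitely many of its derivatives, so the
  same estimate also gives continuity of the field and of the kernel. Poisson summation is needed
  for one-dimensional Gaussians only, since Gaussians and characters factor over coordinates; the
  Gaussian Fourier transform is the characteristic function of the normal law. At s = d the
  subordinated heat trace is bounded below by a multiple of 1/t near 0, which makes the threshold
  sharp.\<close>

lemma int_lattice_add: "m \<in> int_lattice \<Longrightarrow> n \<in> int_lattice \<Longrightarrow> m + n \<in> int_lattice"
  by (auto simp: int_lattice_def inner_add_left)

lemma int_lattice_minus: "n \<in> int_lattice \<Longrightarrow> - n \<in> int_lattice"
  by (auto simp: int_lattice_def)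

lemma int_lattice_minus_iff [simp]: "- n \<in> int_lattice \<longleftrightarrow> n \<in> int_lattice"
  by (auto simp: int_lattice_def)

lemma int_lattice_0 [simp]: "0 \<in> int_lattice"
  by (auto simp: int_lattice_def)

lemma int_lattice_sum_Basis: "(\<Sum>b\<in>Basis. of_int (g b) *\<^sub>R b) \<in> int_lattice"
  by (auto simp: int_lattice_def inner_sum_left_Basis)

lemma int_lattice_Basis: "b \<in> Basis \<Longrightarrow> b \<in> int_lattice"
  by (auto simp: int_lattice_def inner_Basis)

text \<open>Identifies the lattice with integer-valued families indexed by \<open>Basis\<close>, so
  that library facts on products of countable sets, and on sums over \<open>PiE\<close>, become
  available.\<close>

lemma bij_betw_int_lattice:
  "bij_betw (\<lambda>k::'a::euclidean_space. \<lambda>b\<in>Basis. \<lfloor>k \<bullet> b\<rfloor>) int_lattice (Basis \<rightarrow>\<^sub>E UNIV)"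
proof (rule bij_betw_byWitness[where f' = "\<lambda>g. \<Sum>b\<in>Basis. of_int (g b) *\<^sub>R b"])
  show "\<forall>k::'a\<in>int_lattice. (\<Sum>b\<in>Basis. of_int ((\<lambda>b\<in>Basis. \<lfloor>k \<bullet> b\<rfloor>) b) *\<^sub>R b) = k"
  proof
    fix k :: 'a assume "k \<in> int_lattice"
    then have "k \<bullet> b = of_int \<lfloor>k \<bullet> b\<rfloor>" if "b \<in> Basis" for b
      using that by (auto simp: int_lattice_def of_int_floor_cancel)
    then have "(\<Sum>b\<in>Basis. of_int ((\<lambda>b\<in>Basis. \<lfloor>k \<bullet> b\<rfloor>) b) *\<^sub>R b) = (\<Sum>b\<in>Basis. (k \<bullet> b) *\<^sub>R b)"
      by (intro sum.cong) auto
    then show "(\<Sum>b\<in>Basis. of_int ((\<lambda>b\<in>Basis. \<lfloor>k \<bullet> b\<rfloor>) b) *\<^sub>R b) = k"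
      by (simp add: euclidean_representation)
  qed
qed (auto simp: inner_sum_left_Basis int_lattice_sum_Basis fun_eq_iff PiE_def extensional_def)

lemma countable_int_lattice [simp]: "countable (int_lattice :: 'a::euclidean_space set)"
proof -
  have "countable (Basis \<rightarrow>\<^sub>E (UNIV::int set) :: ('a \<Rightarrow> int) set)"
    by (intro countable_PiE) auto
  then show ?thesis
    by (metis bij_betw_def bij_betw_int_lattice countable_image_inj_eq)
qed

lemma infinite_int_lattice [simp]: "infinite (int_lattice :: 'a::euclidean_space set)"
proof -
  obtain b :: 'a where b: "b \<in> Basis" using nonempty_Basis by blast
  have "inj (\<lambda>n::nat. real n *\<^sub>R b)" using b by (auto simp: inj_def nonzero_Basis)
  moreover have "range (\<lambda>n::nat. real n *\<^sub>R b) \<subseteq> int_lattice"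
    using b by (auto simp: int_lattice_def inner_Basis)
  ultimately show ?thesis by (meson infinite_super range_inj_infinite)
qed

text \<open>Half-open, so that the lattice translates tile the space exactly and each point
  determines its translate (\<open>diff_in_cell_iff\<close>). It differs from the closed cube of
  \<open>torus_integral\<close> by a null set.\<close>

definition unit_cell :: "'a::euclidean_space set" where
  "unit_cell = {x. \<forall>b\<in>Basis. 0 \<le> x \<bullet> b \<and> x \<bullet> b < 1}"

definition lattice_floor :: "'a::euclidean_space \<Rightarrow> 'a" where
  "lattice_floor x = (\<Sum>b\<in>Basis. of_int \<lfloor>x \<bullet> b\<rfloor> *\<^sub>R b)"

lemma lattice_floor_in [simp]: "lattice_floor x \<in> int_lattice"
  unfolding lattice_floor_def by (rule int_lattice_sum_Basis)

lemma inner_lattice_floor: "b \<in> Basis \<Longrightarrow> lattice_floor x \<bullet> b = of_int \<lfloor>x \<bullet> b\<rfloor>"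
  by (simp add: lattice_floor_def inner_sum_left_Basis)

lemma lattice_floor_unique:
  assumes "x - n \<in> unit_cell" "n \<in> int_lattice" shows "lattice_floor x = n"
proof (rule euclidean_eqI)
  fix b :: 'a assume b: "b \<in> Basis"
  from assms b obtain j where j: "n \<bullet> b = of_int j" by (auto simp: int_lattice_def Ints_def)
  have "0 \<le> x \<bullet> b - of_int j" "x \<bullet> b - of_int j < 1"
    using assms b j by (auto simp: unit_cell_def inner_diff_left)
  then have "\<lfloor>x \<bullet> b\<rfloor> = j" by linarith
  then show "lattice_floor x \<bullet> b = n \<bullet> b" using b j by (simp add: inner_lattice_floor)
qed

lemma diff_lattice_floor_in_cell [simp]: "x - lattice_floor x \<in> unit_cell"
  by (auto simp: unit_cell_def inner_diff_left inner_lattice_floor) linarith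

lemma diff_in_cell_iff: "n \<in> int_lattice \<Longrightarrow> x - n \<in> unit_cell \<longleftrightarrow> n = lattice_floor x"
  using lattice_floor_unique by fastforce

lemma unit_cell_borel [measurable]: "unit_cell \<in> sets borel"
  unfolding unit_cell_def by measurable

lemma lattice_floor_borel [measurable]: "lattice_floor \<in> borel_measurable borel"
  unfolding lattice_floor_def by measurable

lemma nn_integral_lborel_shift:
  fixes f :: "'a::euclidean_space \<Rightarrow> ennreal"
  assumes [measurable]: "f \<in> borel_measurable borel"
  shows "(\<integral>\<^sup>+x. f (x + v) \<partial>lborel) = (\<integral>\<^sup>+x. f x \<partial>lborel)"
proof -
  have "(\<integral>\<^sup>+x. f x \<partial>lborel) = (\<integral>\<^sup>+x. f x \<partial>distr lborel borel ((+) v))"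
    by (simp add: lborel_distr_plus)
  also have "\<dots> = (\<integral>\<^sup>+x. f (v + x) \<partial>lborel)" by (subst nn_integral_distr) auto
  finally show ?thesis by (simp add: add.commute)
qed

text \<open>Each point lies in exactly one translate of the cell; inserting this partition of unity,
  Tonelli and a shift of each piece give the formula.\<close>

lemma nn_integral_unfold:
  fixes f :: "'a::euclidean_space \<Rightarrow> ennreal"
  assumes [measurable]: "f \<in> borel_measurable borel"
  shows "(\<integral>\<^sup>+x. f x \<partial>lborel) =
    (\<integral>\<^sup>+n. (\<integral>\<^sup>+x. f (x + n) * indicator unit_cell x \<partial>lborel) \<partial>count_space int_lattice)"
proof -
  have "f x = (\<integral>\<^sup>+n. f x * indicator unit_cell (x - n) \<partial>count_space int_lattice)" for x
  proof -
    have "(\<integral>\<^sup>+n. f x * indicator unit_cell (x - n) \<partial>count_space int_lattice) =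
       (\<integral>\<^sup>+n. f x * indicator {lattice_floor x} n \<partial>count_space int_lattice)"
      by (intro nn_integral_cong) (auto simp: diff_in_cell_iff indicator_def split: if_splits)
    also have "\<dots> = f x"
      by (subst nn_integral_cmult_indicator) (auto simp: emeasure_count_space)
    finally show ?thesis by simp
  qed
  then have "(\<integral>\<^sup>+x. f x \<partial>lborel) =
      (\<integral>\<^sup>+x. (\<integral>\<^sup>+n. f x * indicator unit_cell (x - n) \<partial>count_space int_lattice) \<partial>lborel)"
    by (intro nn_integral_cong)
  also have "\<dots> = (\<integral>\<^sup>+n. (\<integral>\<^sup>+x. f x * indicator unit_cell (x - n) \<partial>lborel) \<partial>count_space int_lattice)"
    by (rule nn_integral_count_space_nn_integral) auto
  also have "\<dots> = (\<integral>\<^sup>+n. (\<integral>\<^sup>+x. f (x + n) * indicator unit_cell x \<partial>lborel) \<partial>count_space int_lattice)"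
  proof (rule nn_integral_cong)
    fix n :: 'a
    show "(\<integral>\<^sup>+x. f x * indicator unit_cell (x - n) \<partial>lborel) = (\<integral>\<^sup>+x. f (x + n) * indicator unit_cell x \<partial>lborel)"
      using nn_integral_lborel_shift[of "\<lambda>x. f x * indicator unit_cell (x - n)" n] by simp
  qed
  finally show ?thesis .
qed

section \<open>The torus as a probability space with translation-invariant integral\<close>

definition torus_measure :: "'a::euclidean_space measure" where
  "torus_measure = restrict_space lborel unit_cell"

definition periodic :: "('a::euclidean_space \<Rightarrow> 'b) \<Rightarrow> bool" where
  "periodic f \<longleftrightarrow> (\<forall>x. \<forall>n\<in>int_lattice. f (x + n) = f x)"

lemma cell_null: "cbox 0 One - unit_cell \<in> null_sets (lborel :: 'a::euclidean_space measure)"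
proof -
  have "emeasure lborel (cbox 0 One - box 0 One :: 'a set) = 0"
    by (subst emeasure_Diff) (auto simp: box_subset_cbox emeasure_lborel_cbox_eq emeasure_lborel_box_eq)
  then have "cbox 0 One - box 0 One \<in> null_sets (lborel :: 'a measure)" by (intro null_setsI) auto
  moreover have "cbox 0 One - unit_cell \<subseteq> cbox 0 One - (box 0 One::'a set)"
    by (auto simp: unit_cell_def mem_box less_imp_le)
  ultimately show ?thesis using null_sets_subset by (metis Diff_eq_empty_iff borel_closed closed_cbox sets.Diff sets_lborel unit_cell_borel)
qed

lemma unit_cell_subset: "unit_cell \<subseteq> cbox 0 One"
  by (auto simp: unit_cell_def mem_box less_imp_le)

lemma AE_cell: "AE x in lborel. indicator (cbox 0 One) x = (indicator unit_cell x :: real)"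
  by (rule AE_I'[OF cell_null]) (use unit_cell_subset in \<open>auto simp: indicator_def\<close>)

lemma emeasure_unit_cell: "emeasure lborel (unit_cell :: 'a::euclidean_space set) = 1"
proof -
  have "emeasure lborel (unit_cell :: 'a set) = emeasure lborel (cbox 0 One :: 'a set)"
    by (rule emeasure_eq_AE)
      (use AE_cell in \<open>auto elim!: eventually_mono simp: indicator_def split: if_splits\<close>)
  then show ?thesis by (simp add: emeasure_lborel_cbox_eq)
qed

lemma space_torus_measure [simp]: "space torus_measure = unit_cell"
  by (simp add: torus_measure_def space_restrict_space)

lemma borel_measurable_torus_measure [measurable (raw)]:
  "f \<in> borel_measurable borel \<Longrightarrow> f \<in> borel_measurable torus_measure"
  unfolding torus_measure_def by (rule measurable_restrict_space1) auto

lemma prob_space_torus: "prob_space (torus_measure :: 'a::euclidean_space measure)"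
  by (rule prob_spaceI)
    (simp add: torus_measure_def space_restrict_space emeasure_restrict_space emeasure_unit_cell)

lemma torus_integral_eq:
  assumes [measurable]: "f \<in> borel_measurable borel"
  shows "torus_integral f = (LINT x|torus_measure. f x)"
proof -
  have "(LINT x|torus_measure. f x) = (LINT x|lborel. indicator unit_cell x *\<^sub>R f x)"
    unfolding torus_measure_def by (subst integral_restrict_space) auto
  also have "\<dots> = (LINT x|lborel. indicator (cbox 0 One) x *\<^sub>R f x)"
    by (rule integral_cong_AE) (use AE_cell in \<open>auto elim!: eventually_mono\<close>)
  finally show ?thesis by (simp add: torus_integral_def set_lebesgue_integral_def)
qed

lemma nn_integral_torus:
  "f \<in> borel_measurable borel \<Longrightarrow>
    (\<integral>\<^sup>+x. f x \<partial>torus_measure) = (\<integral>\<^sup>+x. f x * indicator unit_cell x \<partial>lborel)"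
  unfolding torus_measure_def by (subst nn_integral_restrict_space) auto

text \<open>Invariance of Haar measure: the integral of a periodic function over the shifted cell is
  cut along the lattice and the pieces are moved back, where they fill the unit cell once. The map
  \<open>\<lambda>x. x\<close> on the right only transfers \<open>torus_measure\<close> to the full
  Borel algebra, so that both sides live on the same space.\<close>

lemma distr_torus_shift:
  "distr torus_measure borel (\<lambda>x. x + v - lattice_floor (x + v)) = distr torus_measure borel (\<lambda>x::'a::euclidean_space. x)"
proof (rule measure_eqI)
  fix A :: "'a set" assume "A \<in> sets (distr torus_measure borel (\<lambda>x. x + v - lattice_floor (x + v)))"
  then have [measurable]: "A \<in> sets borel" by simp
  define g :: "'a \<Rightarrow> ennreal" where "g x = indicator A (x - lattice_floor x)" for x
  have [measurable]: "g \<in> borel_measurable borel" unfolding g_def by measurable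
  have g_per: "g (x + n) = g x" if "n \<in> int_lattice" for x n
  proof -
    have "lattice_floor (x + n) = lattice_floor x + n"
      by (rule lattice_floor_unique) (use that in \<open>auto simp: int_lattice_add\<close>)
    then show ?thesis by (simp add: g_def)
  qed
  have "(\<integral>\<^sup>+x. g (x + v) * indicator unit_cell x \<partial>lborel) = (\<integral>\<^sup>+x. g x * indicator unit_cell (x - v) \<partial>lborel)"
    using nn_integral_lborel_shift[of "\<lambda>x. g x * indicator unit_cell (x - v)" v] by simp
  also have "\<dots> = (\<integral>\<^sup>+n. (\<integral>\<^sup>+x. g (x + n) * indicator unit_cell (x + n - v) * indicator unit_cell x \<partial>lborel) \<partial>count_space int_lattice)"
    by (rule nn_integral_unfold) measurable
  also have "\<dots> = (\<integral>\<^sup>+n. (\<integral>\<^sup>+x. g x * indicator unit_cell (x + n - v) * indicator unit_cell x \<partial>lborel) \<partial>count_space int_lattice)"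
    by (intro nn_integral_cong) (simp add: g_per)
  also have "\<dots> = (\<integral>\<^sup>+x. (\<integral>\<^sup>+n. g x * indicator unit_cell (x + n - v) * indicator unit_cell x \<partial>count_space int_lattice) \<partial>lborel)"
    by (rule nn_integral_count_space_nn_integral[symmetric]) auto
  also have "\<dots> = (\<integral>\<^sup>+x. g x * indicator unit_cell x \<partial>lborel)"
  proof (rule nn_integral_cong)
    fix x :: 'a
    have "(\<integral>\<^sup>+n. g x * indicator unit_cell (x + n - v) * indicator unit_cell x \<partial>count_space int_lattice)
       = (\<integral>\<^sup>+n. g x * indicator unit_cell x * indicator {- lattice_floor (x - v)} n \<partial>count_space int_lattice)"
    proof (intro nn_integral_cong)
      fix n :: 'a assume "n \<in> space (count_space int_lattice)"
      \<comment> \<open>For fixed \<open>x\<close> exactly one lattice vector carries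
        \<open>x\<close> into the shifted cell, so the sum over \<open>n\<close> has a single
        term.\<close>
      then have "(x - v) - (- n) \<in> unit_cell \<longleftrightarrow> - n = lattice_floor (x - v)"
        by (intro diff_in_cell_iff) simp
      then have "x + n - v \<in> unit_cell \<longleftrightarrow> n = - lattice_floor (x - v)"
        by (simp add: algebra_simps) (metis minus_minus)
      then show "g x * indicator unit_cell (x + n - v) * indicator unit_cell x
          = g x * indicator unit_cell x * indicator {- lattice_floor (x - v)} n"
        by (auto simp: indicator_def)
    qed
    also have "\<dots> = g x * indicator unit_cell x"
      by (subst nn_integral_cmult_indicator) (auto simp: emeasure_count_space)
    finally show "(\<integral>\<^sup>+n. g x * indicator unit_cell (x + n - v) * indicator unit_cell x \<partial>count_space int_lattice) = g x * indicator unit_cell x" .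
  qed
  also have "\<dots> = (\<integral>\<^sup>+x. indicator A x * indicator unit_cell x \<partial>lborel)"
  proof (intro nn_integral_cong)
    fix x :: 'a
    have "lattice_floor x = 0" if "x \<in> unit_cell" by (rule lattice_floor_unique) (use that in auto)
    then show "g x * indicator unit_cell x = indicator A x * indicator unit_cell x"
      by (auto simp: g_def indicator_def)
  qed
  finally have *: "(\<integral>\<^sup>+x. g (x + v) * indicator unit_cell x \<partial>lborel) = (\<integral>\<^sup>+x. indicator A x * indicator unit_cell x \<partial>lborel)" .
  have "emeasure (distr torus_measure borel (\<lambda>x. x + v - lattice_floor (x + v))) A
     = (\<integral>\<^sup>+y. indicator A y \<partial>distr torus_measure borel (\<lambda>x. x + v - lattice_floor (x + v)))"
    by simp
  also have "\<dots> = (\<integral>\<^sup>+x. g (x + v) \<partial>torus_measure)"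
    by (subst nn_integral_distr) (auto simp: g_def)
  also have "\<dots> = (\<integral>\<^sup>+x. g (x + v) * indicator unit_cell x \<partial>lborel)" by (rule nn_integral_torus) measurable
  also have "\<dots> = (\<integral>\<^sup>+x. indicator A x \<partial>torus_measure)" unfolding * by (rule nn_integral_torus[symmetric]) measurable
  also have "\<dots> = (\<integral>\<^sup>+y. indicator A y \<partial>distr torus_measure borel (\<lambda>x. x))"
    by (subst nn_integral_distr) auto
  also have "\<dots> = emeasure (distr torus_measure borel (\<lambda>x. x)) A" by simp
  finally show "emeasure (distr torus_measure borel (\<lambda>x. x + v - lattice_floor (x + v))) A = \<dots>" .
qed simp

lemma torus_integral_shift:
  fixes f :: "'a::euclidean_space \<Rightarrow> complex"
  assumes [measurable]: "f \<in> borel_measurable borel" and "periodic f"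
  shows "torus_integral (\<lambda>x. f (x + v)) = torus_integral f"
proof -
  have "torus_integral (\<lambda>x. f (x + v)) = (LINT x|torus_measure. f (x + v))"
    by (rule torus_integral_eq) measurable
  also have "\<dots> = (LINT x|torus_measure. f (x + v - lattice_floor (x + v)))"
  proof (rule Bochner_Integration.integral_cong)
    fix x :: 'a
    show "f (x + v) = f (x + v - lattice_floor (x + v))"
      using assms(2) unfolding periodic_def
      by (metis diff_add_cancel lattice_floor_in)
  qed simp
  also have "\<dots> = (LINT x|distr torus_measure borel (\<lambda>x. x + v - lattice_floor (x + v)). f x)"
    by (subst integral_distr) auto
  also have "\<dots> = (LINT x|torus_measure. f x)"
    unfolding distr_torus_shift by (subst integral_distr) auto
  also have "\<dots> = torus_integral f" by (rule torus_integral_eq[symmetric]) measurable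
  finally show ?thesis .
qed

section \<open>Smooth functions on the torus\<close>

text \<open>A relation rather than a function: it asserts that the derivative exists, whereas
  \<open>partial_deriv\<close> has a value even where it does not. The calculus rules then come
  directly from \<open>has_vector_derivative\<close>.\<close>

definition dir_deriv ::
  "'a::euclidean_space \<Rightarrow> ('a \<Rightarrow> 'b::real_normed_vector) \<Rightarrow> ('a \<Rightarrow> 'b) \<Rightarrow> bool" where
  "dir_deriv b f f' \<longleftrightarrow> (\<forall>x. ((\<lambda>t. f (x + t *\<^sub>R b)) has_vector_derivative f' x) (at (0::real)))"

lemma dir_deriv_partial: "dir_deriv b f f' \<Longrightarrow> partial_deriv b f = f'"
  by (auto simp: dir_deriv_def partial_deriv_def fun_eq_iff vector_derivative_at)

lemma dir_derivI: "(\<And>x. (\<lambda>t. f (x + t *\<^sub>R b)) differentiable at 0) \<Longrightarrow> dir_deriv b f (partial_deriv b f)"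
  by (simp add: dir_deriv_def partial_deriv_def vector_derivative_works[symmetric])

text \<open>The definition differentiates at parameter 0 but from every base point; moving the base
  point to \<open>x + s *\<^sub>R b\<close> gives the derivative along the whole line.\<close>

lemma dir_deriv_at:
  assumes "dir_deriv b f f'"
  shows "((\<lambda>t. f (x + t *\<^sub>R b)) has_vector_derivative f' (x + s *\<^sub>R b)) (at s)"
proof -
  have "((\<lambda>t. f ((x + s *\<^sub>R b) + t *\<^sub>R b)) has_vector_derivative f' (x + s *\<^sub>R b)) (at (s - s))"
    using assms by (simp add: dir_deriv_def)
  then have "((\<lambda>t. f ((x + s *\<^sub>R b) + t *\<^sub>R b)) \<circ> (\<lambda>t. t - s) has_vector_derivative 1 *\<^sub>R f' (x + s *\<^sub>R b)) (at s)"
    by (intro vector_diff_chain_at) (auto intro!: derivative_eq_intros)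
  moreover have "(\<lambda>t. f ((x + s *\<^sub>R b) + t *\<^sub>R b)) \<circ> (\<lambda>t. t - s) = (\<lambda>t. f (x + t *\<^sub>R b))"
    by (auto simp: fun_eq_iff algebra_simps)
  ultimately show ?thesis by simp
qed

lemma dir_deriv_const: "dir_deriv b (\<lambda>x. c) (\<lambda>x. 0)"
  by (simp add: dir_deriv_def)

lemma dir_deriv_add:
  "dir_deriv b f f' \<Longrightarrow> dir_deriv b g g' \<Longrightarrow> dir_deriv b (\<lambda>x. f x + g x) (\<lambda>x. f' x + g' x)"
  by (auto simp: dir_deriv_def intro!: has_vector_derivative_add)

lemma dir_deriv_mult:
  fixes f g :: "'a::euclidean_space \<Rightarrow> complex"
  shows "dir_deriv b f f' \<Longrightarrow> dir_deriv b g g' \<Longrightarrow>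
    dir_deriv b (\<lambda>x. f x * g x) (\<lambda>x. f x * g' x + f' x * g x)"
  by (auto simp: dir_deriv_def intro!: has_vector_derivative_mult[THEN has_vector_derivative_eq_rhs])

lemma dir_deriv_of_real:
  "dir_deriv b f f' \<Longrightarrow> dir_deriv b (\<lambda>x. complex_of_real (f x)) (\<lambda>x. complex_of_real (f' x))"
  unfolding dir_deriv_def
  by (auto intro: bounded_linear.has_vector_derivative[OF bounded_linear_of_real])

lemma dir_deriv_exp:
  fixes f :: "'a::euclidean_space \<Rightarrow> complex"
  shows "dir_deriv b f f' \<Longrightarrow> dir_deriv b (\<lambda>x. exp (f x)) (\<lambda>x. f' x * exp (f x))"
  unfolding dir_deriv_def
proof
  fix x assume "\<forall>x. ((\<lambda>t. f (x + t *\<^sub>R b)) has_vector_derivative f' x) (at 0)"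
  then have "((\<lambda>t. f (x + t *\<^sub>R b)) has_vector_derivative f' x) (at 0)" by blast
  then have "(exp \<circ> (\<lambda>t. f (x + t *\<^sub>R b)) has_vector_derivative f' x * exp (f (x + 0 *\<^sub>R b))) (at 0)"
    by (rule field_vector_diff_chain_at) (rule DERIV_exp)
  then show "((\<lambda>t. exp (f (x + t *\<^sub>R b))) has_vector_derivative f' x * exp (f x)) (at 0)"
    by (simp add: o_def)
qed

lemma dir_deriv_character:
  "dir_deriv b (character k) (\<lambda>x. (2 * of_real pi * \<i> * of_real (k \<bullet> b)) * character k x)"
proof -
  have "dir_deriv b (\<lambda>x. 2 * of_real pi * \<i> * of_real (k \<bullet> x)) (\<lambda>x. 2 * of_real pi * \<i> * of_real (k \<bullet> b))"
    unfolding dir_deriv_def inner_add_right inner_scaleR_right of_real_add of_real_mult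
    by (auto intro!: derivative_eq_intros simp: has_vector_derivative_def scaleR_conv_of_real)
  from dir_deriv_exp[OF this] show ?thesis unfolding character_def .
qed

lemma periodic_partial: "periodic f \<Longrightarrow> periodic (partial_deriv b f)"
proof -
  assume f: "periodic f"
  have "f (x + n + t *\<^sub>R b) = f (x + t *\<^sub>R b)" if "n \<in> int_lattice" for x n t
    using f that unfolding periodic_def by (metis add.commute add.left_commute)
  then show ?thesis by (simp add: periodic_def partial_deriv_def)
qed

text \<open>A recursive form of finite differentiability that peels off the innermost derivative, so
  closure under sums, products and composition goes by induction on the order.
  \<open>torus_smooth\<close>, phrased with lists of directions, is the case of all orders.\<close>

fun Ck :: "nat \<Rightarrow> ('a::euclidean_space \<Rightarrow> 'b::real_normed_vector) \<Rightarrow> bool" where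
  "Ck 0 f \<longleftrightarrow> periodic f \<and> continuous_on UNIV f"
| "Ck (Suc n) f \<longleftrightarrow> periodic f \<and> continuous_on UNIV f \<and>
     (\<forall>b\<in>Basis. dir_deriv b f (partial_deriv b f) \<and> Ck n (partial_deriv b f))"

lemma Ck_base: "Ck n f \<Longrightarrow> periodic f" "Ck n f \<Longrightarrow> continuous_on UNIV f"
  by (cases n; simp)+

lemma Ck_SucI:
  assumes "periodic f" "continuous_on UNIV f"
    "\<And>b. b \<in> Basis \<Longrightarrow> dir_deriv b f (f' b)" "\<And>b. b \<in> Basis \<Longrightarrow> Ck n (f' b)"
  shows "Ck (Suc n) f"
proof -
  have "partial_deriv b f = f' b" if "b \<in> Basis" for b
    using assms(3)[OF that] by (rule dir_deriv_partial)
  then show ?thesis using assms by simp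
qed

lemma Ck_Suc: "Ck (Suc n) f \<Longrightarrow> Ck n f"
  by (induction n arbitrary: f) auto

lemma iter_partial_snoc: "iter_partial (bs @ [b]) f = iter_partial bs (partial_deriv b f)"
  by (simp add: iter_partial_def)

lemma iter_partial_simps [simp]:
  "iter_partial [] f = f" "iter_partial (b # bs) f = partial_deriv b (iter_partial bs f)"
  by (simp_all add: iter_partial_def)

lemma torus_smoothD:
  assumes "f \<in> torus_smooth"
  shows "periodic f" "continuous_on UNIV f"
    "b \<in> Basis \<Longrightarrow> dir_deriv b f (partial_deriv b f)"
    "b \<in> Basis \<Longrightarrow> partial_deriv b f \<in> torus_smooth"
proof -
  have *: "\<And>bs. bs \<in> lists Basis \<Longrightarrow> continuous_on UNIV (iter_partial bs f) \<and>
        (\<forall>b\<in>Basis. \<forall>x. (\<lambda>t. iter_partial bs f (x + t *\<^sub>R b)) differentiable at 0)"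
    and p: "periodic f"
    using assms by (auto simp: torus_smooth_def periodic_def)
  show "periodic f" by fact
  show "continuous_on UNIV f" "b \<in> Basis \<Longrightarrow> dir_deriv b f (partial_deriv b f)"
    using *[of "[]"] by (auto intro!: dir_derivI)
  show "partial_deriv b f \<in> torus_smooth" if "b \<in> Basis"
    unfolding torus_smooth_def
  proof (intro CollectI conjI)
    show "\<forall>x. \<forall>n\<in>int_lattice. partial_deriv b f (x + n) = partial_deriv b f x"
      using periodic_partial[OF p] by (simp add: periodic_def)
    show "\<forall>bs\<in>lists Basis. continuous_on UNIV (iter_partial bs (partial_deriv b f)) \<and>
        (\<forall>ba\<in>Basis. \<forall>x. (\<lambda>t. iter_partial bs (partial_deriv b f) (x + t *\<^sub>R ba)) differentiable at 0)"
    proof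
      fix bs :: "'a list" assume "bs \<in> lists Basis"
      with that have "bs @ [b] \<in> lists Basis" by auto
      from *[OF this] show "continuous_on UNIV (iter_partial bs (partial_deriv b f)) \<and>
        (\<forall>ba\<in>Basis. \<forall>x. (\<lambda>t. iter_partial bs (partial_deriv b f) (x + t *\<^sub>R ba)) differentiable at 0)"
        by (simp add: iter_partial_snoc)
    qed
  qed
qed

text \<open>In \<open>iter_partial\<close> the last direction of the list is applied to
  \<open>f\<close> first, which is why the converse is proved by induction from the end of the
  list.\<close>

lemma torus_smooth_iff: "f \<in> torus_smooth \<longleftrightarrow> (\<forall>n. Ck n f)"
proof safe
  fix n assume "f \<in> torus_smooth"
  then show "Ck n f"
    by (induction n arbitrary: f) (auto dest: torus_smoothD)
next
  assume *: "\<forall>n. Ck n f"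
  have "continuous_on UNIV (iter_partial bs f) \<and>
        (\<forall>b\<in>Basis. \<forall>x. (\<lambda>t. iter_partial bs f (x + t *\<^sub>R b)) differentiable at 0)"
    if "bs \<in> lists Basis" for bs
    using that *
  proof (induction bs arbitrary: f rule: rev_induct)
    case Nil
    then have "Ck (Suc 0) f" by blast
    then have "continuous_on UNIV f" "\<And>b. b \<in> Basis \<Longrightarrow> dir_deriv b f (partial_deriv b f)" by auto
    then show ?case
      unfolding dir_deriv_def iter_partial_simps by (blast intro: differentiableI_vector)
  next
    case (snoc b bs)
    then have "b \<in> Basis" "bs \<in> lists Basis" by auto
    moreover have "\<forall>n. Ck n (partial_deriv b f)"
      using snoc.prems \<open>b \<in> Basis\<close> by (meson Ck.simps(2))
    ultimately show ?case using snoc.IH by (simp add: iter_partial_snoc)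
  qed
  moreover have "periodic f" using * Ck_base by blast
  ultimately show "f \<in> torus_smooth" by (auto simp: torus_smooth_def periodic_def)
qed

lemma Ck_add: "Ck n f \<Longrightarrow> Ck n g \<Longrightarrow> Ck n (\<lambda>x. f x + g x)"
proof (induction n arbitrary: f g)
  case (Suc n)
  show ?case
    by (rule Ck_SucI[where f' = "\<lambda>b x. partial_deriv b f x + partial_deriv b g x"])
      (use Suc in \<open>auto intro!: dir_deriv_add continuous_intros simp: periodic_def\<close>)
qed (auto intro!: continuous_intros simp: periodic_def)

lemma Ck_mult:
  fixes f g :: "'a::euclidean_space \<Rightarrow> complex"
  shows "Ck n f \<Longrightarrow> Ck n g \<Longrightarrow> Ck n (\<lambda>x. f x * g x)"
proof (induction n arbitrary: f g)
  case (Suc n)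
  have "Ck n f" "Ck n g" using Suc.prems Ck_Suc by blast+
  then show ?case
    by (intro Ck_SucI[where f' = "\<lambda>b x. f x * partial_deriv b g x + partial_deriv b f x * g x"])
      (use Suc in \<open>auto intro!: dir_deriv_mult Ck_add continuous_intros simp: periodic_def\<close>)
qed (auto intro!: continuous_intros simp: periodic_def)

lemma Ck_const: "Ck n (\<lambda>x. c)"
proof (induction n arbitrary: c)
  case (Suc n)
  show ?case by (rule Ck_SucI[where f' = "\<lambda>b x. 0"]) (auto simp: periodic_def dir_deriv_const Suc)
qed (auto simp: periodic_def)

lemma Ck_of_real: "Ck n f \<Longrightarrow> Ck n (\<lambda>x. complex_of_real (f x))"
proof (induction n arbitrary: f)
  case (Suc n)
  show ?case
    by (rule Ck_SucI[where f' = "\<lambda>b x. of_real (partial_deriv b f x)"])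
      (use Suc in \<open>auto intro!: dir_deriv_of_real continuous_intros simp: periodic_def\<close>)
qed (auto intro!: continuous_intros simp: periodic_def)

lemma dir_deriv_linear:
  assumes "linear p" "dir_deriv (p b) f f'"
  shows "dir_deriv b (\<lambda>z. f (p z)) (\<lambda>z. f' (p z))"
  using assms by (simp add: dir_deriv_def linear_add linear_scale)

lemma dir_deriv_zero: "dir_deriv 0 f (\<lambda>z. 0)"
  by (auto simp: dir_deriv_def)

lemma int_lattice_Pair [simp]: "(a, b) \<in> int_lattice \<longleftrightarrow> a \<in> int_lattice \<and> b \<in> int_lattice"
  by (auto simp: int_lattice_def Basis_prod_def ball_Un)

text \<open>Meant for the projections \<open>fst\<close> and \<open>snd\<close> of the product
  torus, which send each basis vector to a basis vector or to 0; a direction sent to 0 contributes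
  derivative 0.\<close>

lemma Ck_linear:
  fixes p :: "'a::euclidean_space \<Rightarrow> 'b::euclidean_space"
  assumes p: "linear p" "\<And>n. n \<in> int_lattice \<Longrightarrow> p n \<in> int_lattice" "\<And>b. b \<in> Basis \<Longrightarrow> p b \<in> insert 0 Basis"
  shows "Ck n f \<Longrightarrow> Ck n (\<lambda>z. f (p z))"
proof (induction n arbitrary: f)
  have pc: "continuous_on UNIV (\<lambda>z. f (p z))" if "continuous_on UNIV f" for f :: "'b \<Rightarrow> 'c"
    by (rule continuous_on_compose2[OF that linear_continuous_on]) (use p in \<open>auto simp: linear_conv_bounded_linear\<close>)
  have pp: "periodic (\<lambda>z. f (p z))" if "periodic f" for f :: "'b \<Rightarrow> 'c"
    using that p by (simp add: periodic_def linear_add)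
  {
    case 0
    then show ?case using pc pp by simp
  next
    case (Suc n)
    let ?f' = "\<lambda>b z. if p b = 0 then 0 else partial_deriv (p b) f (p z)"
    have "dir_deriv b (\<lambda>z. f (p z)) (?f' b) \<and> Ck n (?f' b)" if b: "b \<in> Basis" for b
    proof (cases "p b = 0")
      case True
      then show ?thesis using dir_deriv_linear[OF p(1), of b f "\<lambda>_. 0"] by (simp add: dir_deriv_zero Ck_const)
    next
      case False
      then have "p b \<in> Basis" using p(3)[OF b] by simp
      then show ?thesis using Suc False by (simp add: dir_deriv_linear[OF p(1)])
    qed
    then show ?case using Suc.prems by (intro Ck_SucI[where f' = ?f'] pc pp) auto
  }
qed

section \<open>Characters and the algebra of smooth functions\<close>

lemma character_add: "character k (x + y) = character k x * character k y"
  by (simp add: character_def inner_add_right algebra_simps exp_add)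

lemma character_add_left: "character (j + k) x = character j x * character k x"
  by (simp add: character_def inner_add_left algebra_simps exp_add)

lemma character_zero [simp]: "character 0 x = 1" "character k 0 = 1"
  by (simp_all add: character_def)

lemma character_minus: "character k (- x) = cnj (character k x)"
  by (simp add: character_def exp_cnj)

lemma character_minus_left: "character (- k) x = cnj (character k x)"
  by (simp add: character_def exp_cnj)

lemma norm_character [simp]: "norm (character k x) = 1"
  by (simp add: character_def norm_exp_eq_Re)

lemma int_lattice_inner: "m \<in> int_lattice \<Longrightarrow> n \<in> int_lattice \<Longrightarrow> m \<bullet> n \<in> \<int>"
  by (subst euclidean_inner) (auto simp: int_lattice_def)

lemma character_lattice:
  assumes "k \<in> int_lattice" "n \<in> int_lattice" shows "character k n = 1"
proof -
  obtain j where "k \<bullet> n = of_int j" using int_lattice_inner[OF assms] by (auto simp: Ints_def)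
  then have "character k n = exp (2 * of_int j * of_real pi * \<i>)" by (simp add: character_def algebra_simps)
  then show ?thesis using exp_integer_2pi[of "of_int j"] by (simp add: mult_ac)
qed

lemma periodic_character: "k \<in> int_lattice \<Longrightarrow> periodic (character k)"
  by (simp add: periodic_def character_add character_lattice)

lemma continuous_character [continuous_intros]:
  "continuous_on S f \<Longrightarrow> continuous_on S (\<lambda>x. character k (f x))"
  unfolding character_def by (intro continuous_intros)

lemma character_borel [measurable]: "character k \<in> borel_measurable borel"
  by (rule borel_measurable_continuous_onI) (rule continuous_character, rule continuous_on_id)

lemma Ck_character:
  assumes "k \<in> int_lattice" shows "Ck n (character k)"
proof (induction n)
  case 0
  then show ?case using continuous_character[OF continuous_on_id, of UNIV k] assms
    by (simp add: periodic_character)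
next
  case (Suc n)
  show ?case
    by (rule Ck_SucI[OF _ _ dir_deriv_character])
      (use Suc continuous_character[OF continuous_on_id, of UNIV k] assms
        in \<open>auto simp: periodic_character intro!: Ck_mult Ck_const\<close>)
qed

lemma torus_smooth_const: "(\<lambda>x. c) \<in> torus_smooth"
  by (simp add: torus_smooth_iff Ck_const)

lemma torus_smooth_add: "f \<in> torus_smooth \<Longrightarrow> g \<in> torus_smooth \<Longrightarrow> (\<lambda>x. f x + g x) \<in> torus_smooth"
  by (simp add: torus_smooth_iff Ck_add)

lemma torus_smooth_mult:
  fixes f g :: "'a::euclidean_space \<Rightarrow> complex"
  shows "f \<in> torus_smooth \<Longrightarrow> g \<in> torus_smooth \<Longrightarrow> (\<lambda>x. f x * g x) \<in> torus_smooth"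
  by (simp add: torus_smooth_iff Ck_mult)

lemma torus_smooth_character: "k \<in> int_lattice \<Longrightarrow> character k \<in> torus_smooth"
  by (simp add: torus_smooth_iff Ck_character)

lemma torus_smooth_of_real: "f \<in> torus_smooth \<Longrightarrow> (\<lambda>x. complex_of_real (f x)) \<in> torus_smooth"
  by (simp add: torus_smooth_iff Ck_of_real)

lemma torus_smooth_lincomb:
  fixes f g :: "'a::euclidean_space \<Rightarrow> complex"
  shows "f \<in> torus_smooth \<Longrightarrow> g \<in> torus_smooth \<Longrightarrow> (\<lambda>x. a * f x + b * g x) \<in> torus_smooth"
  by (intro torus_smooth_add torus_smooth_mult torus_smooth_const)

lemma torus_smooth_diff:
  fixes f g :: "'a::euclidean_space \<Rightarrow> complex"
  shows "f \<in> torus_smooth \<Longrightarrow> g \<in> torus_smooth \<Longrightarrow> (\<lambda>x. f x - g x) \<in> torus_smooth"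
  using torus_smooth_lincomb[of f g 1 "-1"] by simp

lemma torus_smooth_sum:
  fixes f :: "'i \<Rightarrow> 'a::euclidean_space \<Rightarrow> complex"
  shows "(\<And>i. i \<in> A \<Longrightarrow> f i \<in> torus_smooth) \<Longrightarrow> (\<lambda>x. \<Sum>i\<in>A. f i x) \<in> torus_smooth"
  by (induction A rule: infinite_finite_induct) (auto intro!: torus_smooth_const torus_smooth_add)

lemma torus_smooth_fst: "f \<in> torus_smooth \<Longrightarrow> (\<lambda>z. f (fst z)) \<in> torus_smooth"
  unfolding torus_smooth_iff
  by (intro allI, rule Ck_linear[OF linear_fst]) (auto simp: Basis_prod_def)

lemma torus_smooth_snd: "f \<in> torus_smooth \<Longrightarrow> (\<lambda>z. f (snd z)) \<in> torus_smooth"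
  unfolding torus_smooth_iff
  by (intro allI, rule Ck_linear[OF linear_snd]) (auto simp: Basis_prod_def)

text \<open>The seminorms behind \<open>smooth_nhd\<close>, written recursively so that the Leibniz
  rule can be iterated; \<open>deriv_bound_iff\<close> translates back to lists of directions. One
  constant serves for all orders up to \<open>n\<close>.\<close>

fun deriv_bound :: "nat \<Rightarrow> real \<Rightarrow> ('a::euclidean_space \<Rightarrow> complex) \<Rightarrow> bool" where
  "deriv_bound 0 B f \<longleftrightarrow> (\<forall>x. norm (f x) \<le> B)"
| "deriv_bound (Suc n) B f \<longleftrightarrow> (\<forall>x. norm (f x) \<le> B) \<and> (\<forall>b\<in>Basis. deriv_bound n B (partial_deriv b f))"

lemma deriv_bound_norm: "deriv_bound n B f \<Longrightarrow> norm (f x) \<le> B"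
  by (cases n) auto

lemma deriv_bound_nonneg: "deriv_bound n B f \<Longrightarrow> 0 \<le> B"
  using deriv_bound_norm norm_ge_zero order_trans by blast

lemma deriv_bound_mono: "deriv_bound n B f \<Longrightarrow> B \<le> C \<Longrightarrow> deriv_bound n C f"
  by (induction n arbitrary: f) (auto intro: order_trans)

lemma deriv_bound_Suc: "deriv_bound (Suc n) B f \<Longrightarrow> deriv_bound n B f"
  by (induction n arbitrary: f) auto

lemma deriv_bound_add:
  "Ck n f \<Longrightarrow> Ck n g \<Longrightarrow> deriv_bound n A f \<Longrightarrow> deriv_bound n B g \<Longrightarrow> deriv_bound n (A + B) (\<lambda>x. f x + g x)"
proof (induction n arbitrary: f g)
  case (Suc n)
  have "norm (f x + g x) \<le> A + B" for x
    using Suc.prems by (intro norm_triangle_mono) auto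
  moreover have "partial_deriv b (\<lambda>x. f x + g x) = (\<lambda>x. partial_deriv b f x + partial_deriv b g x)" if "b \<in> Basis" for b
    using Suc.prems that by (intro dir_deriv_partial dir_deriv_add) auto
  ultimately show ?case using Suc by auto
qed (auto intro: norm_triangle_mono)

text \<open>Each differentiation turns a product into a sum of two products, whence the factor
  \<open>2 ^ n\<close>.\<close>

lemma deriv_bound_mult:
  fixes f g :: "'a::euclidean_space \<Rightarrow> complex"
  shows "Ck n f \<Longrightarrow> Ck n g \<Longrightarrow> deriv_bound n A f \<Longrightarrow> deriv_bound n B g \<Longrightarrow>
    deriv_bound n (2 ^ n * (A * B)) (\<lambda>x. f x * g x)"
proof (induction n arbitrary: f g)
  case 0
  then show ?case by (auto simp: norm_mult intro!: mult_mono intro: order_trans[OF norm_ge_zero])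
next
  case (Suc n)
  have AB: "0 \<le> A" "0 \<le> B" using Suc.prems deriv_bound_nonneg by blast+
  have "norm (f x * g x) \<le> A * B" for x
    using Suc.prems AB by (auto simp: norm_mult intro!: mult_mono)
  moreover have "A * B \<le> 2 ^ Suc n * (A * B)" using AB mult_right_mono[of 1 "2 ^ Suc n" "A * B"] by (simp add: one_le_power del: power_Suc)
  ultimately have "norm (f x * g x) \<le> 2 ^ Suc n * (A * B)" for x by (meson order_trans)
  moreover have "deriv_bound n (2 ^ Suc n * (A * B)) (partial_deriv b (\<lambda>x. f x * g x))" if b: "b \<in> Basis" for b
  proof -
    have "partial_deriv b (\<lambda>x. f x * g x) = (\<lambda>x. f x * partial_deriv b g x + partial_deriv b f x * g x)"
      using Suc.prems b by (intro dir_deriv_partial dir_deriv_mult) auto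
    moreover have "deriv_bound n (2 ^ n * (A * B) + 2 ^ n * (A * B)) (\<lambda>x. f x * partial_deriv b g x + partial_deriv b f x * g x)"
      using Suc.prems b Ck_Suc[OF Suc.prems(1)] Ck_Suc[OF Suc.prems(2)]
        deriv_bound_Suc[OF Suc.prems(3)] deriv_bound_Suc[OF Suc.prems(4)]
      by (intro deriv_bound_add Suc.IH Ck_mult) auto
    moreover have "2 ^ n * (A * B) + 2 ^ n * (A * B) = 2 ^ Suc n * (A * B)" by simp
    ultimately show ?thesis by metis
  qed
  ultimately show ?case by simp
qed

text \<open>All values are already taken on the compact cube.\<close>

lemma periodic_bounded:
  fixes f :: "'a::euclidean_space \<Rightarrow> 'b::real_normed_vector"
  assumes "periodic f" "continuous_on UNIV f"
  shows "\<exists>B\<ge>0. \<forall>x. norm (f x) \<le> B"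
proof -
  have "bounded (f ` cbox 0 One)"
    using assms(2) by (meson compact_cbox compact_continuous_image compact_imp_bounded continuous_on_subset subset_UNIV)
  then obtain B where B: "\<And>x. x \<in> cbox 0 One \<Longrightarrow> norm (f x) \<le> B" by (auto simp: bounded_iff)
  have "norm (f x) \<le> B" for x
  proof -
    have "f ((x - lattice_floor x) + lattice_floor x) = f (x - lattice_floor x)"
      using assms(1) unfolding periodic_def by (meson lattice_floor_in)
    moreover have "x - lattice_floor x \<in> cbox 0 One"
      using unit_cell_subset diff_lattice_floor_in_cell by blast
    ultimately show ?thesis using B by fastforce
  qed
  then show ?thesis by (metis norm_ge_zero order_trans)
qed

lemma deriv_bound_exists: "Ck n f \<Longrightarrow> \<exists>B. deriv_bound n B f"
proof (induction n arbitrary: f)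
  case 0
  then show ?case using periodic_bounded[of f] by auto
next
  case (Suc n)
  obtain B0 where B0: "\<forall>x. norm (f x) \<le> B0" using periodic_bounded[of f] Suc.prems by auto
  have "\<forall>b\<in>Basis. \<exists>B. deriv_bound n B (partial_deriv b f)" using Suc by auto
  then obtain B where B: "\<And>b. b \<in> Basis \<Longrightarrow> deriv_bound n (B b) (partial_deriv b f)" by metis
  have nn: "b \<in> Basis \<Longrightarrow> 0 \<le> B b" for b using B deriv_bound_nonneg by blast
  have "b \<in> Basis \<Longrightarrow> B b \<le> (\<Sum>b\<in>Basis. B b)" for b by (rule member_le_sum) (auto simp: nn)
  then have "b \<in> Basis \<Longrightarrow> deriv_bound n (max B0 (\<Sum>b\<in>Basis. B b)) (partial_deriv b f)" for b
    by (meson B deriv_bound_mono max.coboundedI2)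
  with B0 show ?case by (auto intro!: exI[of _ "max B0 (\<Sum>b\<in>Basis. B b)"] le_max_iff_disj[THEN iffD2])
qed

lemma deriv_bound_iff:
  "deriv_bound n B f \<longleftrightarrow> (\<forall>bs\<in>lists Basis. length bs \<le> n \<longrightarrow> (\<forall>x. norm (iter_partial bs f x) \<le> B))"
proof (induction n arbitrary: f)
  case (Suc n)
  show ?case (is "_ \<longleftrightarrow> ?R")
  proof
    assume L: "deriv_bound (Suc n) B f"
    show ?R
    proof (intro ballI impI)
      fix bs :: "'a list" assume bs: "bs \<in> lists Basis" "length bs \<le> Suc n"
      show "\<forall>x. norm (iter_partial bs f x) \<le> B"
      proof (cases bs rule: rev_exhaust)
        case (snoc cs c)
        then show ?thesis using L bs Suc by (simp add: iter_partial_snoc)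
      qed (use L in simp)
    qed
  next
    assume R: ?R
    have "deriv_bound n B (partial_deriv b f)" if "b \<in> Basis" for b
      unfolding Suc
    proof (intro ballI impI)
      fix bs :: "'a list" assume "bs \<in> lists Basis" "length bs \<le> n"
      then show "\<forall>x. norm (iter_partial bs (partial_deriv b f) x) \<le> B"
        using R[rule_format, of "bs @ [b]"] that by (simp add: iter_partial_snoc)
    qed
    with R[rule_format, of "[]"] show "deriv_bound (Suc n) B f" by simp
  qed
qed simp

section \<open>Decay of oscillatory integrals\<close>

lemma abs_summable_nat_into:
  fixes f :: "'i \<Rightarrow> 'b::banach"
  assumes "countable A" "infinite A" "(\<lambda>i. norm (f i)) summable_on A"
  shows "summable (\<lambda>n. norm (f (from_nat_into A n)))"
    and "infsum f A = (\<Sum>n. f (from_nat_into A n))"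
proof -
  have bij: "bij_betw (from_nat_into A) UNIV A" by (rule bij_betw_from_nat_into) fact+
  have "(\<lambda>n. norm (f (from_nat_into A n))) summable_on UNIV"
    using summable_on_reindex_bij_betw[OF bij, of "\<lambda>i. norm (f i)"] assms(3) by simp
  then show *: "summable (\<lambda>n. norm (f (from_nat_into A n)))" by (rule summable_on_imp_summable)
  have "infsum f A = infsum (\<lambda>n. f (from_nat_into A n)) UNIV"
    by (rule infsum_reindex_bij_betw[OF bij, symmetric])
  also have "\<dots> = (\<Sum>n. f (from_nat_into A n))"
    by (rule infsumI, rule norm_summable_imp_has_sum[OF *], rule summable_sums, rule summable_norm_cancel[OF *])
  finally show "infsum f A = (\<Sum>n. f (from_nat_into A n))" .
qed

text \<open>Fubini for an unordered countable sum under summable L1 norms. Pointwise summability is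
  asked at every point, so that the unordered sum agrees everywhere with the enumerated
  series.\<close>

lemma has_sum_integral:
  fixes f :: "'i \<Rightarrow> 'a \<Rightarrow> 'b::{banach, second_countable_topology}"
  assumes A: "countable A" "infinite A"
    and int: "\<And>i. i \<in> A \<Longrightarrow> integrable M (f i)"
    and pt: "\<And>x. x \<in> space M \<Longrightarrow> (\<lambda>i. norm (f i x)) summable_on A"
    and sm: "(\<lambda>i. \<integral>x. norm (f i x) \<partial>M) summable_on A"
  shows "((\<lambda>i. integral\<^sup>L M (f i)) has_sum (\<integral>x. (\<Sum>\<^sub>\<infinity>i\<in>A. f i x) \<partial>M)) A"
    and "integrable M (\<lambda>x. \<Sum>\<^sub>\<infinity>i\<in>A. f i x)"
    and "(\<lambda>i. norm (integral\<^sup>L M (f i))) summable_on A"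
proof -
  let ?e = "from_nat_into A"
  have bij: "bij_betw ?e UNIV A" by (rule bij_betw_from_nat_into) fact+
  have e: "?e n \<in> A" for n using A by (meson bij bij_betwE iso_tuple_UNIV_I)
  have int': "\<And>n. integrable M (f (?e n))" using int e by blast
  have pt': "AE x in M. summable (\<lambda>n. norm (f (?e n) x))"
    by (rule AE_I2, rule abs_summable_nat_into(1)[OF A pt])
  have sm': "summable (\<lambda>n. \<integral>x. norm (f (?e n) x) \<partial>M)"
  proof -
    have "(\<lambda>n. \<integral>x. norm (f (?e n) x) \<partial>M) summable_on UNIV"
      using summable_on_reindex_bij_betw[OF bij, of "\<lambda>i. \<integral>x. norm (f i x) \<partial>M"] sm by simp
    then show ?thesis by (rule summable_on_imp_summable)
  qed
  have eq: "(\<integral>x. (\<Sum>\<^sub>\<infinity>i\<in>A. f i x) \<partial>M) = (\<integral>x. (\<Sum>n. f (?e n) x) \<partial>M)"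
    by (intro Bochner_Integration.integral_cong refl abs_summable_nat_into(2)[OF A pt])
  have "(\<lambda>n. integral\<^sup>L M (f (?e n))) sums (\<integral>x. (\<Sum>n. f (?e n) x) \<partial>M)"
    by (rule sums_integral[OF int' pt' sm'])
  moreover have sn: "summable (\<lambda>n. norm (integral\<^sup>L M (f (?e n))))"
    by (rule summable_comparison_test[OF _ sm']) (auto intro!: exI[of _ 0] integral_norm_bound)
  ultimately have "((\<lambda>n. integral\<^sup>L M (f (?e n))) has_sum (\<integral>x. (\<Sum>n. f (?e n) x) \<partial>M)) UNIV"
    by (intro norm_summable_imp_has_sum)
  then show "((\<lambda>i. integral\<^sup>L M (f i)) has_sum (\<integral>x. (\<Sum>\<^sub>\<infinity>i\<in>A. f i x) \<partial>M)) A"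
    unfolding eq using has_sum_reindex_bij_betw[OF bij, of "\<lambda>i. integral\<^sup>L M (f i)"] by simp
  have "integrable M (\<lambda>x. \<Sum>n. f (?e n) x)" by (rule integrable_suminf[OF int' pt' sm'])
  then show "integrable M (\<lambda>x. \<Sum>\<^sub>\<infinity>i\<in>A. f i x)"
    by (rule Bochner_Integration.integrable_cong[THEN iffD1, rotated 2])
      (auto intro!: abs_summable_nat_into(2)[OF A pt, symmetric])
  have "(\<lambda>n. norm (integral\<^sup>L M (f (?e n)))) summable_on UNIV"
    using sn by (intro summable_nonneg_imp_summable_on) auto
  then show "(\<lambda>i. norm (integral\<^sup>L M (f i))) summable_on A"
    using summable_on_reindex_bij_betw[OF bij, of "\<lambda>i. norm (integral\<^sup>L M (f i))"] by simp
qed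

lemma borel_measurable_infsum:
  fixes f :: "'i \<Rightarrow> 'a \<Rightarrow> 'b::{banach, second_countable_topology}"
  assumes A: "countable A" "infinite A"
    and "\<And>i. i \<in> A \<Longrightarrow> f i \<in> borel_measurable M"
    and pt: "\<And>x. x \<in> space M \<Longrightarrow> (\<lambda>i. norm (f i x)) summable_on A"
  shows "(\<lambda>x. \<Sum>\<^sub>\<infinity>i\<in>A. f i x) \<in> borel_measurable M"
proof -
  have "from_nat_into A n \<in> A" for n using A by (simp add: from_nat_into infinite_imp_nonempty)
  then have [measurable]: "\<And>n. f (from_nat_into A n) \<in> borel_measurable M" using assms(3) by blast
  have "(\<lambda>x. \<Sum>n. f (from_nat_into A n) x) \<in> borel_measurable M" by measurable
  then show ?thesis
    by (rule measurable_cong[THEN iffD1, rotated]) (auto intro!: abs_summable_nat_into(2)[OF A pt, symmetric])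
qed

section \<open>Integration by parts on the torus\<close>

lemma periodic_mult: "periodic f \<Longrightarrow> periodic g \<Longrightarrow> periodic (\<lambda>x. f x * g x)"
  by (simp add: periodic_def)

lemma continuous_borel: "continuous_on UNIV f \<Longrightarrow> f \<in> borel_measurable borel"
  by (rule borel_measurable_continuous_onI)

lemma integrable_torus_bounded:
  fixes f :: "'a::euclidean_space \<Rightarrow> 'b::{banach, second_countable_topology}"
  assumes [measurable]: "f \<in> borel_measurable borel" and "\<And>x. x \<in> unit_cell \<Longrightarrow> norm (f x) \<le> B"
  shows "integrable torus_measure f"
proof -
  interpret prob_space "torus_measure :: 'a measure" by (rule prob_space_torus)
  show ?thesis by (rule integrable_const_bound[where B = B]) (use assms in auto)
qed

lemma integrable_torus:
  fixes f :: "'a::euclidean_space \<Rightarrow> 'b::{banach, second_countable_topology}"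
  assumes "periodic f" "continuous_on UNIV f"
  shows "integrable torus_measure f"
  using periodic_bounded[OF assms] continuous_borel[OF assms(2)] by (auto intro: integrable_torus_bounded)

lemma norm_torus_integral_le:
  fixes f :: "'a::euclidean_space \<Rightarrow> complex"
  assumes [measurable]: "f \<in> borel_measurable borel" and "\<And>x. x \<in> unit_cell \<Longrightarrow> norm (f x) \<le> B"
  shows "norm (torus_integral f) \<le> B"
proof -
  interpret prob_space "torus_measure :: 'a measure" by (rule prob_space_torus)
  have "norm (torus_integral f) \<le> (LINT x|torus_measure. norm (f x))"
    by (simp add: torus_integral_eq)
  also have "\<dots> \<le> (LINT x|(torus_measure :: 'a measure). B)"
    by (rule integral_mono) (use assms in \<open>auto intro!: integrable_norm integrable_torus_bounded[of f B]\<close>)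
  also have "\<dots> = B" using prob_space by simp
  finally show ?thesis .
qed

lemma torus_integral_add:
  assumes "periodic f" "continuous_on UNIV f" "periodic g" "continuous_on UNIV g"
  shows "torus_integral (\<lambda>x. f x + g x) = torus_integral f + torus_integral g"
  using assms integrable_torus[of f] integrable_torus[of g]
  by (simp add: torus_integral_eq continuous_borel continuous_intros)

lemma torus_integral_cmult:
  assumes "continuous_on UNIV f"
  shows "torus_integral (\<lambda>x. c * f x) = c * torus_integral f"
  using assms continuous_borel[OF assms] by (simp add: torus_integral_eq)

text \<open>By translation invariance every difference quotient of \<open>F\<close> has integral 0;
  the quotients are uniformly bounded and converge to \<open>F'\<close>, so dominated convergence
  applies.\<close>

lemma torus_integral_partial_zero:
  fixes F F' :: "'a::euclidean_space \<Rightarrow> complex"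
  assumes d: "dir_deriv b F F'" and F: "periodic F" "continuous_on UNIV F"
    and F': "periodic F'" "continuous_on UNIV F'"
  shows "torus_integral F' = 0"
proof -
  interpret prob_space "torus_measure :: 'a measure" by (rule prob_space_torus)
  have [measurable]: "F \<in> borel_measurable borel" "F' \<in> borel_measurable borel"
    using F F' continuous_borel by blast+
  obtain B where B: "B \<ge> 0" "\<And>x. norm (F' x) \<le> B" using periodic_bounded[OF F'] by blast
  define h where "h n = 1 / real (Suc n)" for n
  have h0: "h n > 0" for n by (simp add: h_def)
  have hlim: "h \<longlonglongrightarrow> 0" unfolding h_def by (rule LIMSEQ_Suc[OF lim_1_over_n])
  define u where "u n x = (F (x + h n *\<^sub>R b) - F x) /\<^sub>R h n" for n x
  have [measurable]: "u n \<in> borel_measurable borel" for n unfolding u_def by measurable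
  have bd: "norm (u n x) \<le> B" for n x
  proof -
    \<comment> \<open>The mean value inequality turns the bound on \<open>F'\<close> into the
      dominating constant for the difference quotients.\<close>
    have "norm (F (x + h n *\<^sub>R b) - F (x + 0 *\<^sub>R b)) \<le> B * norm (h n - 0)"
    proof (rule differentiable_bound[where S = UNIV and f' = "\<lambda>s t. t *\<^sub>R F' (x + s *\<^sub>R b)"])
      fix s :: real
      show "((\<lambda>t. F (x + t *\<^sub>R b)) has_derivative (\<lambda>t. t *\<^sub>R F' (x + s *\<^sub>R b))) (at s within UNIV)"
        using dir_deriv_at[OF d, of x s] by (simp add: has_vector_derivative_def)
      show "onorm (\<lambda>t. t *\<^sub>R F' (x + s *\<^sub>R b)) \<le> B"
        by (rule onorm_le) (use B in \<open>simp add: mult.commute[of B] mult_left_mono\<close>)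
    qed auto
    then have "norm (F (x + h n *\<^sub>R b) - F x) / h n \<le> B" using h0[of n] by (simp add: pos_divide_le_eq)
    then show ?thesis using h0[of n] by (simp add: u_def divide_inverse_commute)
  qed
  have lim: "(\<lambda>n. u n x) \<longlonglongrightarrow> F' x" for x
  proof -
    have "((\<lambda>t. (F (x + t *\<^sub>R b) - F x) /\<^sub>R t) \<longlongrightarrow> F' x) (at 0)"
    proof (rule Lim_null[THEN iffD2], rule tendsto_norm_zero_iff[THEN iffD1])
      have "((\<lambda>t. norm (F (x + t *\<^sub>R b) - F x - t *\<^sub>R F' x) / norm t) \<longlongrightarrow> 0) (at 0)"
        using d[unfolded dir_deriv_def, rule_format, of x]
        by (simp add: has_vector_derivative_def has_derivative_at)
      then show "((\<lambda>t. norm ((F (x + t *\<^sub>R b) - F x) /\<^sub>R t - F' x)) \<longlongrightarrow> 0) (at 0)"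
      proof (rule Lim_transform_eventually)
        have "norm (F (x + t *\<^sub>R b) - F x - t *\<^sub>R F' x) / norm t = norm ((F (x + t *\<^sub>R b) - F x) /\<^sub>R t - F' x)"
          if "t \<noteq> 0" for t
        proof -
          have "(F (x + t *\<^sub>R b) - F x) /\<^sub>R t - F' x = (F (x + t *\<^sub>R b) - F x - t *\<^sub>R F' x) /\<^sub>R t"
            using that by (simp add: scaleR_diff_right)
          then show ?thesis by (simp add: divide_inverse_commute)
        qed
        then show "\<forall>\<^sub>F t in at 0. norm (F (x + t *\<^sub>R b) - F x - t *\<^sub>R F' x) / norm t = norm ((F (x + t *\<^sub>R b) - F x) /\<^sub>R t - F' x)"
          by (auto simp: eventually_at intro!: exI[of _ 1])
      qed
    qed
    then show ?thesis unfolding u_def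
      by (rule filterlim_compose) (use hlim h0 in \<open>auto simp: filterlim_at eventually_sequentially intro!: less_imp_neq[symmetric]\<close>)
  qed
  have "(\<lambda>n. LINT x|torus_measure. u n x) \<longlonglongrightarrow> (LINT x|torus_measure. F' x)"
    by (rule integral_dominated_convergence[where w = "\<lambda>_. B"]) (use bd lim in auto)
  moreover have "(LINT x|torus_measure. u n x) = 0" for n
  proof -
    have p: "periodic (\<lambda>x. F (x + h n *\<^sub>R b))"
      using F(1) by (simp add: periodic_def add.assoc add.commute[of _ "h n *\<^sub>R b"]) (simp add: add.assoc[symmetric])
    have c: "continuous_on UNIV (\<lambda>x. F (x + h n *\<^sub>R b))"
      by (intro continuous_on_compose2[OF F(2)] continuous_intros) auto
    have "(LINT x|torus_measure. F (x + h n *\<^sub>R b)) = (LINT x|torus_measure. F x)"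
      using torus_integral_shift[OF _ F(1), of "h n *\<^sub>R b"] by (simp add: torus_integral_eq)
    then show ?thesis unfolding u_def
      using integrable_torus[OF F] integrable_torus[OF p c] by simp
  qed
  ultimately have "(LINT x|torus_measure. F' x) = 0" by (simp add: LIMSEQ_const_iff)
  then show ?thesis by (simp add: torus_integral_eq)
qed

text \<open>With \<open>c = ln (freq_weight \<kappa> k)\<close> the exponential is the weight to the
  power \<open>- g x\<close>. The parameter \<open>c\<close> is kept separate from \<open>k\<close>
  because the induction needs bounds uniform in both.\<close>

definition osc_coeff ::
  "('a::euclidean_space \<Rightarrow> complex) \<Rightarrow> real \<Rightarrow> 'a \<Rightarrow> ('a \<Rightarrow> complex) \<Rightarrow> complex" where
  "osc_coeff g c k \<phi> = torus_integral (\<lambda>x. exp (- (of_real c * g x)) * \<phi> x * cnj (character k x))"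

text \<open>The integral of the derivative of exponential times \<open>\<phi>\<close> times
  conjugate character vanishes. Differentiating the exponential produces the factor
  \<open>c\<close>, the only loss. The conjugate is written as the character of \<open>- k\<close>
  so that its derivative formula applies.\<close>

lemma osc_coeff_by_parts:
  assumes k: "k \<in> int_lattice" and b: "b \<in> Basis" and g: "Ck (Suc 0) g" and \<phi>: "Ck (Suc 0) \<phi>"
  shows "2 * of_real pi * \<i> * of_real (k \<bullet> b) * osc_coeff g c k \<phi> =
    osc_coeff g c k (\<lambda>x. partial_deriv b \<phi> x + (- of_real c * partial_deriv b g x) * \<phi> x)"
proof -
  let ?E = "\<lambda>x. exp (- (of_real c * g x))" and ?K = "\<lambda>x. character (- k) x"
    and ?w = "2 * of_real pi * \<i> * of_real (k \<bullet> b) :: complex"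
  let ?D = "\<lambda>x. partial_deriv b \<phi> x + (- of_real c * partial_deriv b g x) * \<phi> x"
  have dE: "dir_deriv b ?E (\<lambda>x. (- of_real c * partial_deriv b g x) * ?E x)"
    using dir_deriv_exp[OF dir_deriv_mult[OF dir_deriv_const, of b g "partial_deriv b g" "- of_real c"]] g b by simp
  have d: "dir_deriv b (\<lambda>x. (?E x * \<phi> x) * ?K x)
     (\<lambda>x. (?E x * \<phi> x) * (2 * of_real pi * \<i> * of_real (- k \<bullet> b) * ?K x) +
       (?E x * partial_deriv b \<phi> x + (- of_real c * partial_deriv b g x) * ?E x * \<phi> x) * ?K x)"
    by (rule dir_deriv_mult[OF dir_deriv_mult[OF dE] dir_deriv_character]) (use \<phi> b in simp)
  have per: "periodic g" "periodic \<phi>" "periodic (partial_deriv b g)" "periodic (partial_deriv b \<phi>)" "periodic ?K"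
    and cont: "continuous_on UNIV g" "continuous_on UNIV \<phi>" "continuous_on UNIV (partial_deriv b g)"
      "continuous_on UNIV (partial_deriv b \<phi>)"
    using g \<phi> b k by (auto intro: periodic_character)
  have 1: "periodic (\<lambda>x. (- ?w) * (?E x * \<phi> x * ?K x))" "periodic (\<lambda>x. ?E x * \<phi> x * ?K x)" "periodic (\<lambda>x. ?E x * ?D x * ?K x)"
    "continuous_on UNIV (\<lambda>x. (- ?w) * (?E x * \<phi> x * ?K x))" "continuous_on UNIV (\<lambda>x. ?E x * \<phi> x * ?K x)"
    "continuous_on UNIV (\<lambda>x. ?E x * ?D x * ?K x)"
    using per cont by (auto simp: periodic_def intro!: continuous_intros)
  have eq: "(\<lambda>x. (?E x * \<phi> x) * (2 * of_real pi * \<i> * of_real (- k \<bullet> b) * ?K x) +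
       (?E x * partial_deriv b \<phi> x + (- of_real c * partial_deriv b g x) * ?E x * \<phi> x) * ?K x)
     = (\<lambda>x. (- ?w) * (?E x * \<phi> x * ?K x) + ?E x * ?D x * ?K x)"
    by (auto simp: fun_eq_iff algebra_simps)
  have "0 = torus_integral (\<lambda>x. (- ?w) * (?E x * \<phi> x * ?K x) + ?E x * ?D x * ?K x)"
  proof (rule torus_integral_partial_zero[OF d[unfolded eq], symmetric])
    show "periodic (\<lambda>x. - ?w * (?E x * \<phi> x * ?K x) + ?E x * ?D x * ?K x)"
      using 1(1,3) by (simp add: periodic_def)
    show "continuous_on UNIV (\<lambda>x. - ?w * (?E x * \<phi> x * ?K x) + ?E x * ?D x * ?K x)"
      using 1(4,6) by (rule continuous_on_add)
  qed (use 1 in auto)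
  also have "\<dots> = - ?w * torus_integral (\<lambda>x. ?E x * \<phi> x * ?K x) + torus_integral (\<lambda>x. ?E x * ?D x * ?K x)"
    using 1 by (simp only: torus_integral_add torus_integral_cmult)
  finally show ?thesis by (simp add: osc_coeff_def character_minus_left)
qed

lemma deriv_bound_const: "norm c \<le> B \<Longrightarrow> deriv_bound n B (\<lambda>x::'a::euclidean_space. c)"
proof (induction n arbitrary: c)
  case (Suc n)
  have "partial_deriv b (\<lambda>x. c) = (\<lambda>x. 0)" for b :: 'a by (rule dir_deriv_partial[OF dir_deriv_const])
  then show ?case using Suc order_trans[OF norm_ge_zero Suc.prems] by simp
qed simp

lemma norm_exp_le:
  fixes z :: complex
  assumes "norm z \<le> G" shows "norm (exp (- (of_real c * z))) \<le> exp (\<bar>c\<bar> * G)"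
proof -
  have "norm (exp (- (of_real c * z))) \<le> exp (norm (- (of_real c * z)))" by (rule norm_exp)
  also have "\<dots> \<le> exp (\<bar>c\<bar> * G)" using assms by (simp add: norm_mult mult_left_mono)
  finally show ?thesis .
qed

lemma osc_coeff_bound:
  assumes "Ck 0 \<phi>" "Ck 0 g" "\<And>x. norm (g x) \<le> G" "\<And>x. norm (\<phi> x) \<le> P"
  shows "norm (osc_coeff g c k \<phi>) \<le> exp (\<bar>c\<bar> * G) * P"
proof -
  have "norm (exp (- (of_real c * g x)) * \<phi> x * cnj (character k x)) \<le> exp (\<bar>c\<bar> * G) * P" for x
    unfolding norm_mult complex_mod_cnj norm_character mult_1_right
    using norm_exp_le[OF assms(3)] assms(4) by (intro mult_mono) auto
  then show ?thesis
    unfolding osc_coeff_def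
    by (intro norm_torus_integral_le continuous_borel continuous_intros) (use assms in auto)
qed

text \<open>Iterates the integration by parts in one fixed direction. The new amplitude is again
  smooth, so the induction hypothesis applies to it, with seminorm enlarged by a multiple of
  \<open>1 + \<bar>c\<bar>\<close>. The constant must not depend on the test function, its bound,
  \<open>c\<close>, the frequency or the direction.\<close>

lemma osc_coeff_decay_aux:
  assumes g: "g \<in> torus_smooth" "\<And>x. norm (g x) \<le> G"
  shows "\<exists>C\<ge>0. \<forall>\<phi> P c. \<forall>k\<in>int_lattice. \<forall>b\<in>Basis. \<phi> \<in> torus_smooth \<longrightarrow> deriv_bound N P \<phi> \<longrightarrow>
    \<bar>2 * pi * (k \<bullet> b)\<bar> ^ N * norm (osc_coeff g c k \<phi>) \<le> C * (1 + \<bar>c\<bar>) ^ N * (exp (\<bar>c\<bar> * G) * P)"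
proof (induction N)
  case 0
  show ?case
    by (rule exI[of _ 1]) (use g in \<open>auto simp: torus_smoothD intro!: osc_coeff_bound\<close>)
next
  case (Suc N)
  then obtain C where C: "C \<ge> 0" "\<And>\<phi> P c k b. k \<in> int_lattice \<Longrightarrow> b \<in> Basis \<Longrightarrow> \<phi> \<in> torus_smooth \<Longrightarrow> deriv_bound N P \<phi> \<Longrightarrow>
    \<bar>2 * pi * (k \<bullet> b)\<bar> ^ N * norm (osc_coeff g c k \<phi>) \<le> C * (1 + \<bar>c\<bar>) ^ N * (exp (\<bar>c\<bar> * G) * P)" by blast
  obtain Q where Q: "deriv_bound (Suc N) Q g" using deriv_bound_exists g(1) torus_smooth_iff by blast
  have Q0: "Q \<ge> 0" using Q deriv_bound_nonneg by blast
  \<comment> \<open>The two factors \<open>2 ^ N\<close> come from two uses of the Leibniz bound: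
    for the constant times the derivative of \<open>g\<close>, and for that product times
    \<open>\<phi>\<close>.\<close>
  let ?C = "C * (1 + 2 ^ N * (2 ^ N * Q))"
  show ?case
  proof (rule exI[of _ ?C], intro conjI allI ballI impI)
    show "?C \<ge> 0" using C Q0 by simp
    fix \<phi> :: "'a \<Rightarrow> complex" and P c :: real and k b :: 'a
    assume k: "k \<in> int_lattice" and b: "b \<in> Basis" and \<phi>: "\<phi> \<in> torus_smooth" and P: "deriv_bound (Suc N) P \<phi>"
    let ?D = "\<lambda>x. partial_deriv b \<phi> x + (- of_real c * partial_deriv b g x) * \<phi> x"
    have P0: "P \<ge> 0" using P deriv_bound_nonneg by blast
    have D: "?D \<in> torus_smooth"
      using \<phi> g b by (intro torus_smooth_add torus_smooth_mult torus_smooth_const torus_smoothD(4))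
    have "deriv_bound N (P + 2 ^ N * ((2 ^ N * (\<bar>c\<bar> * Q)) * P)) ?D"
      using P Q b \<phi> g deriv_bound_Suc[OF P] torus_smoothD(4)[OF g(1) b] torus_smoothD(4)[OF \<phi> b]
      by (intro deriv_bound_add deriv_bound_mult deriv_bound_const Ck_mult Ck_const)
        (auto simp: torus_smooth_iff simp del: Ck.simps)
    moreover have "P + 2 ^ N * ((2 ^ N * (\<bar>c\<bar> * Q)) * P) \<le> (1 + 2 ^ N * (2 ^ N * Q)) * (1 + \<bar>c\<bar>) * P"
    proof -
      have "0 \<le> \<bar>c\<bar> * P + 2 ^ N * (2 ^ N * Q) * P" using P0 Q0 by simp
      then show ?thesis by (simp add: algebra_simps)
    qed
    ultimately have D': "deriv_bound N ((1 + 2 ^ N * (2 ^ N * Q)) * (1 + \<bar>c\<bar>) * P) ?D" by (rule deriv_bound_mono)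
    have "\<bar>2 * pi * (k \<bullet> b)\<bar> * norm (osc_coeff g c k \<phi>) = norm (2 * of_real pi * \<i> * of_real (k \<bullet> b) * osc_coeff g c k \<phi>)"
      by (simp add: norm_mult abs_mult)
    also have "\<dots> = norm (osc_coeff g c k ?D)"
      using g \<phi> k b by (subst osc_coeff_by_parts) (auto simp: torus_smooth_iff simp del: Ck.simps)
    finally have "\<bar>2 * pi * (k \<bullet> b)\<bar> ^ Suc N * norm (osc_coeff g c k \<phi>) = \<bar>2 * pi * (k \<bullet> b)\<bar> ^ N * norm (osc_coeff g c k ?D)"
      by (simp add: mult_ac)
    also have "\<dots> \<le> C * (1 + \<bar>c\<bar>) ^ N * (exp (\<bar>c\<bar> * G) * ((1 + 2 ^ N * (2 ^ N * Q)) * (1 + \<bar>c\<bar>) * P))"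
      by (rule C(2)[OF k b D D'])
    also have "\<dots> = ?C * (1 + \<bar>c\<bar>) ^ Suc N * (exp (\<bar>c\<bar> * G) * P)" by (simp add: mult_ac)
    finally show "\<bar>2 * pi * (k \<bullet> b)\<bar> ^ Suc N * norm (osc_coeff g c k \<phi>) \<le> ?C * (1 + \<bar>c\<bar>) ^ Suc N * (exp (\<bar>c\<bar> * G) * P)" .
  qed
qed

section \<open>Comparing the frequency weight with coordinates and logarithms\<close>

lemma freq_weight_ge: "\<kappa> > 0 \<Longrightarrow> freq_weight \<kappa> k \<ge> \<kappa>"
  unfolding freq_weight_def by (rule real_le_rsqrt) simp

lemma freq_weight_pos: "\<kappa> > 0 \<Longrightarrow> freq_weight \<kappa> k > 0"
  using freq_weight_ge[of \<kappa> k] by linarith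

lemma freq_weight_minus [simp]: "freq_weight \<kappa> (- k) = freq_weight \<kappa> k"
  by (simp add: freq_weight_def)

lemma freq_weight_le_sum:
  fixes k :: "'a::euclidean_space"
  assumes "\<kappa> > 0" shows "freq_weight \<kappa> k \<le> \<kappa> + (\<Sum>b\<in>Basis. \<bar>2 * pi * (k \<bullet> b)\<bar>)"
proof -
  have "freq_weight \<kappa> k \<le> \<kappa> + 2 * pi * norm k"
    unfolding freq_weight_def
    by (rule real_le_lsqrt) (use assms in \<open>auto simp: power2_eq_square algebra_simps\<close>)
  also have "norm k \<le> (\<Sum>b\<in>Basis. \<bar>k \<bullet> b\<bar>)" by (rule norm_le_l1)
  then have "\<kappa> + 2 * pi * norm k \<le> \<kappa> + (\<Sum>b\<in>Basis. \<bar>2 * pi * (k \<bullet> b)\<bar>)"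
    by (simp add: abs_mult sum_distrib_left[symmetric])
  finally show ?thesis .
qed

text \<open>Pigeonhole: the weight is at most a sum of one constant and DIM('a) coordinate terms, so
  one of these 1 + DIM('a) terms carries at least the average. It selects the direction of
  integration by parts, or shows that the weight is bounded.\<close>

lemma freq_weight_cases:
  fixes k :: "'a::euclidean_space" and \<kappa> :: real
  assumes "\<kappa> > 0"
  obtains "freq_weight \<kappa> k \<le> (1 + DIM('a)) * \<kappa>"
  | b where "b \<in> Basis" "freq_weight \<kappa> k \<le> (1 + DIM('a)) * \<bar>2 * pi * (k \<bullet> b)\<bar>"
proof (rule ccontr)
  let ?L = "freq_weight \<kappa> k" and ?D = "1 + real DIM('a)"
  assume "\<not> thesis"
  with that have "\<not> ?L \<le> ?D * \<kappa>" "\<And>b. b \<in> Basis \<Longrightarrow> \<not> ?L \<le> ?D * \<bar>2 * pi * (k \<bullet> b)\<bar>" by force+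
  moreover have "x < ?L / ?D \<longleftrightarrow> \<not> ?L \<le> ?D * x" for x
    using pos_less_divide_eq[of ?D x ?L] by (simp add: not_le mult.commute)
  ultimately have *: "\<kappa> < ?L / ?D" "\<And>b. b \<in> Basis \<Longrightarrow> \<bar>2 * pi * (k \<bullet> b)\<bar> < ?L / ?D"
    by blast+
  have "?L \<le> \<kappa> + (\<Sum>b\<in>Basis. \<bar>2 * pi * (k \<bullet> b)\<bar>)" by (rule freq_weight_le_sum[OF assms])
  also have "\<dots> < ?L / ?D + (\<Sum>b\<in>(Basis :: 'a set). ?L / ?D)"
    by (intro add_less_le_mono sum_mono *(1) less_imp_le *(2))
  also have "\<dots> = ?D * (?L / ?D)" by (simp only: sum_constant distrib_right mult_1_left)
  also have "\<dots> = ?L" by (rule nonzero_mult_div_cancel_left[OF _, of ?D ?L, unfolded times_divide_eq_right[symmetric]]) linarith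
  finally show False by simp
qed

text \<open>For \<open>L < 1\<close> the left side is 1/L, and \<open>L \<ge> \<kappa>\<close>
  bounds it by a multiple of \<open>L\<close>. Thus powers of \<open>exp \<bar>ln L\<bar>\<close>
  become powers of the weight even when \<kappa> is less than 1.\<close>

lemma exp_abs_ln_le:
  fixes \<kappa> L :: real
  assumes "\<kappa> > 0" "L \<ge> \<kappa>" shows "exp \<bar>ln L\<bar> \<le> max 1 (1 / \<kappa>\<^sup>2) * L"
proof (cases "L \<ge> 1")
  case True
  then have "exp \<bar>ln L\<bar> = L" by simp
  then show ?thesis using True by (simp add: max_def mult_right_le_one_le)
next
  case False
  then have L: "0 < L" "L < 1" using assms by auto
  have "\<bar>ln L\<bar> = - ln L" using L by simp
  then have "exp \<bar>ln L\<bar> = 1 / L" using L by (simp add: exp_minus inverse_eq_divide)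
  also have "\<dots> \<le> 1 / \<kappa>\<^sup>2 * L"
  proof -
    have "\<kappa>\<^sup>2 \<le> L\<^sup>2" using assms by (intro power_mono) auto
    then show ?thesis using L assms by (simp add: field_simps power2_eq_square)
  qed
  also have "\<dots> \<le> max 1 (1 / \<kappa>\<^sup>2) * L" using L by (intro mult_right_mono) auto
  finally show ?thesis .
qed

text \<open>The factor \<open>(1 + |ln \<lambda>|)\<^sup>N\<close> is at most a constant times \<open>\<lambda>\<^bsup>N/2\<^esup>\<close>.\<close>

lemma osc_coeff_decay:
  fixes g :: "'b::euclidean_space \<Rightarrow> complex" and s \<kappa> :: real
  assumes g: "g \<in> torus_smooth" and \<kappa>: "\<kappa> > 0"
  obtains N C where "C \<ge> 0"
    "\<And>\<phi> P (k::'a::euclidean_space) K. \<phi> \<in> torus_smooth \<Longrightarrow> deriv_bound N P \<phi> \<Longrightarrow> K \<in> int_lattice \<Longrightarrow>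
      (\<And>b. b \<in> Basis \<Longrightarrow> \<exists>b'\<in>Basis. \<bar>k \<bullet> b\<bar> = \<bar>K \<bullet> b'\<bar>) \<Longrightarrow>
      norm (osc_coeff g (ln (freq_weight \<kappa> k)) K \<phi>) \<le> C * P * freq_weight \<kappa> k powr (- s)"
proof -
  obtain G where G: "G \<ge> 0" "\<And>x. norm (g x) \<le> G" using periodic_bounded[of g] torus_smoothD[OF g] by blast
  \<comment> \<open>\<open>N\<close> integrations gain the power \<open>N\<close> and lose
    \<open>N / 2\<close> to the logarithms and \<open>G\<close> to the size of the symbol; the net
    gain has to reach \<open>s\<close>.\<close>
  define N where "N = nat \<lceil>2 * (G + \<bar>s\<bar>)\<rceil>"
  have N: "real N / 2 \<ge> G + s"
  proof -
    have "2 * (G + \<bar>s\<bar>) \<le> real N" unfolding N_def by (rule real_nat_ceiling_ge)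
    then show ?thesis by argo
  qed
  obtain C where C: "C \<ge> 0" "\<And>\<phi> P c k b. k \<in> int_lattice \<Longrightarrow> b \<in> Basis \<Longrightarrow> \<phi> \<in> torus_smooth \<Longrightarrow> deriv_bound N P \<phi> \<Longrightarrow>
    \<bar>2 * pi * (k \<bullet> b)\<bar> ^ N * norm (osc_coeff g c k \<phi>) \<le> C * (1 + \<bar>c\<bar>) ^ N * (exp (\<bar>c\<bar> * G) * P)"
    using osc_coeff_decay_aux[OF g G(2), of N] by metis
  define D where "D = 1 + real DIM('a)"
  define E where "E = max 1 (1 / \<kappa>\<^sup>2)"
  define a where "a = real N / 2 + G"
  have E1: "E \<ge> 1" by (simp add: E_def)
  have D1: "D \<ge> 1" by (simp add: D_def)
  \<comment> \<open>The summand with \<open>\<kappa> ^ N\<close> serves the bounded weights, the one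
    with \<open>C\<close> the weights dominated by a coordinate.\<close>
  define A where "A = D ^ N * (\<kappa> ^ N + C)"
  have A0: "A \<ge> 0" using C \<kappa> D1 by (simp add: A_def)
  define B where "B = A * 2 ^ N * E powr a * \<kappa> powr (- (real N / 2 - G - s))"
  show ?thesis
  proof
    show "B \<ge> 0" using A0 by (simp add: B_def)
    fix \<phi> :: "'b \<Rightarrow> complex" and P :: real and k :: 'a and K :: 'b
    assume \<phi>: "\<phi> \<in> torus_smooth" and P: "deriv_bound N P \<phi>" and K: "K \<in> int_lattice"
      and kK: "\<And>b. b \<in> Basis \<Longrightarrow> \<exists>b'\<in>Basis. \<bar>k \<bullet> b\<bar> = \<bar>K \<bullet> b'\<bar>"
    define L where "L = freq_weight \<kappa> k"
    define c where "c = ln L"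
    define w where "w = norm (osc_coeff g c K \<phi>)"
    define R where "R = (1 + \<bar>c\<bar>) ^ N * (exp (\<bar>c\<bar> * G) * P)"
    have L: "L > 0" "L \<ge> \<kappa>" using \<kappa> by (simp_all add: L_def freq_weight_pos freq_weight_ge)
    have P0: "P \<ge> 0" using P deriv_bound_nonneg by blast
    have w0: "w \<ge> 0" by (simp add: w_def)
    have R0: "R \<ge> 0" using P0 by (simp add: R_def)
    have wR: "w \<le> R"
    proof -
      have "w \<le> exp (\<bar>c\<bar> * G) * P"
        unfolding w_def by (rule osc_coeff_bound) (use g \<phi> G P in \<open>auto simp: torus_smoothD deriv_bound_norm\<close>)
      also have "\<dots> = 1 * (exp (\<bar>c\<bar> * G) * P)" by simp
      also have "\<dots> \<le> R" unfolding R_def using P0 by (intro mult_right_mono one_le_power) auto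
      finally show ?thesis .
    qed
    have "L ^ N * w \<le> A * R"
    proof (rule freq_weight_cases[OF \<kappa>, of k])
      assume "freq_weight \<kappa> k \<le> real (1 + DIM('a)) * \<kappa>"
      then have "L \<le> D * \<kappa>" by (simp add: L_def D_def)
      then have "L ^ N \<le> (D * \<kappa>) ^ N" using L by (intro power_mono) auto
      then have "L ^ N * w \<le> (D * \<kappa>) ^ N * R" using wR w0 D1 \<kappa> by (intro mult_mono) auto
      also have "\<dots> \<le> A * R"
        unfolding A_def using C(1) R0 D1 \<kappa> by (intro mult_right_mono) (auto simp: power_mult_distrib algebra_simps)
      finally show ?thesis .
    next
      fix b :: 'a assume b: "b \<in> Basis" "freq_weight \<kappa> k \<le> real (1 + DIM('a)) * \<bar>2 * pi * (k \<bullet> b)\<bar>"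
      \<comment> \<open>The frequency \<open>k\<close> sets the weight, but the oscillation is that
        of \<open>K\<close>, which may live on another torus, as \<open>(- k, k)\<close> does. It
        suffices that each coordinate of \<open>k\<close> occurs up to sign among those of
        \<open>K\<close>.\<close>
      obtain b' where b': "b' \<in> Basis" "\<bar>k \<bullet> b\<bar> = \<bar>K \<bullet> b'\<bar>" using kK b by blast
      have "L \<le> D * \<bar>2 * pi * (K \<bullet> b')\<bar>" using b b' by (simp add: L_def D_def abs_mult)
      then have "L ^ N \<le> (D * \<bar>2 * pi * (K \<bullet> b')\<bar>) ^ N" using L by (intro power_mono) auto
      then have "L ^ N * w \<le> (D * \<bar>2 * pi * (K \<bullet> b')\<bar>) ^ N * w" using w0 by (rule mult_right_mono)
      also have "\<dots> = D ^ N * (\<bar>2 * pi * (K \<bullet> b')\<bar> ^ N * w)" by (simp add: power_mult_distrib mult_ac)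
      also have "\<dots> \<le> D ^ N * (C * (1 + \<bar>c\<bar>) ^ N * (exp (\<bar>c\<bar> * G) * P))"
        unfolding w_def using D1 by (intro mult_left_mono C(2) K b' \<phi> P) auto
      also have "\<dots> = D ^ N * C * R" by (simp add: R_def mult_ac)
      also have "\<dots> \<le> A * R" unfolding A_def using C(1) R0 D1 \<kappa> by (intro mult_right_mono) (auto simp: algebra_simps)
      finally show ?thesis .
    qed
    also have "R \<le> 2 ^ N * (E * L) powr a * P"
    proof -
      \<comment> \<open>Halving the exponent is what keeps the logarithmic loss at
        \<open>N / 2\<close>, below the gain \<open>N\<close>.\<close>
      have "1 + \<bar>c\<bar> \<le> 2 * exp (\<bar>c\<bar> / 2)" using exp_ge_add_one_self[of "\<bar>c\<bar> / 2"] by linarith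
      then have "(1 + \<bar>c\<bar>) ^ N \<le> (2 * exp (\<bar>c\<bar> / 2)) ^ N" by (intro power_mono) auto
      also have "\<dots> = 2 ^ N * exp (real N * (\<bar>c\<bar> / 2))" by (simp only: power_mult_distrib exp_of_nat_mult)
      finally have "(1 + \<bar>c\<bar>) ^ N * exp (\<bar>c\<bar> * G) \<le> 2 ^ N * exp (real N * (\<bar>c\<bar> / 2)) * exp (\<bar>c\<bar> * G)"
        by (rule mult_right_mono) simp
      also have "\<dots> = 2 ^ N * exp (\<bar>c\<bar>) powr a"
        by (simp add: a_def powr_def exp_add[symmetric] algebra_simps)
      also have "\<dots> \<le> 2 ^ N * (E * L) powr a"
        using exp_abs_ln_le[OF \<kappa> L(2)] G by (intro mult_left_mono powr_mono2) (auto simp: a_def E_def c_def)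
      finally show ?thesis unfolding R_def using P0 by (simp add: mult.assoc[symmetric] mult_right_mono)
    qed
    finally have "L ^ N * w \<le> A * (2 ^ N * (E * L) powr a * P)" using A0 by (simp add: mult_left_mono)
    then have "w \<le> A * (2 ^ N * (E * L) powr a * P) / L ^ N" using L by (simp add: field_simps)
    also have "\<dots> = A * 2 ^ N * E powr a * P * (L powr a / L powr real N)"
      using L E1 by (simp add: powr_mult powr_realpow)
    \<comment> \<open>The surplus decay beyond \<open>s\<close> has a nonpositive exponent and
      \<open>L \<ge> \<kappa>\<close>, so it is at most the same power of \<kappa>.\<close>
    also have "L powr a / L powr real N = L powr (- (real N / 2 - G - s)) * L powr (- s)"
      using L by (simp add: powr_diff[symmetric] powr_add[symmetric] a_def)
    also have "\<dots> \<le> \<kappa> powr (- (real N / 2 - G - s)) * L powr (- s)"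
      using L \<kappa> N by (intro mult_right_mono powr_mono2') auto
    finally have "w \<le> A * 2 ^ N * E powr a * P * (\<kappa> powr (- (real N / 2 - G - s)) * L powr (- s))"
      using A0 P0 E1 by (simp add: mult_left_mono)
    then show "norm (osc_coeff g (ln (freq_weight \<kappa> k)) K \<phi>) \<le> B * P * freq_weight \<kappa> k powr (- s)"
      by (simp add: w_def c_def L_def B_def mult_ac)
  qed
qed

section \<open>Fourier series of continuous functions\<close>

lemma continuous_on_infsum:
  fixes f :: "'i \<Rightarrow> 'a::topological_space \<Rightarrow> 'b::banach"
  assumes A: "countable A" "infinite A"
    and f: "\<And>i. i \<in> A \<Longrightarrow> continuous_on S (f i)"
    and bd: "\<And>i x. i \<in> A \<Longrightarrow> x \<in> S \<Longrightarrow> norm (f i x) \<le> c i"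
    and c: "c summable_on A"
  shows "continuous_on S (\<lambda>x. \<Sum>\<^sub>\<infinity>i\<in>A. f i x)"
proof -
  let ?e = "from_nat_into A"
  have bij: "bij_betw ?e UNIV A" by (rule bij_betw_from_nat_into) fact+
  have e: "?e n \<in> A" for n using A by (meson bij bij_betwE iso_tuple_UNIV_I)
  have pt: "(\<lambda>i. norm (f i x)) summable_on A" if "x \<in> S" for x
    by (rule summable_on_comparison_test[OF c]) (use bd that in auto)
  have "(\<lambda>n. c (?e n)) summable_on UNIV"
    using summable_on_reindex_bij_betw[OF bij, of c] c by simp
  then have c': "summable (\<lambda>n. c (?e n))" by (rule summable_on_imp_summable)
  have "uniform_limit S (\<lambda>n x. \<Sum>i<n. f (?e i) x) (\<lambda>x. \<Sum>i. f (?e i) x) sequentially"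
    by (rule Weierstrass_m_test[OF _ c']) (use bd e in auto)
  then have "continuous_on S (\<lambda>x. \<Sum>i. f (?e i) x)"
    by (rule uniform_limit_theorem[rotated]) (auto intro!: always_eventually continuous_on_sum f e)
  then show ?thesis
    by (rule continuous_on_cong[THEN iffD1, OF refl, rotated]) (rule abs_summable_nat_into(2)[OF A pt, symmetric])
qed

lemma torus_integral_infsum:
  fixes f :: "'i \<Rightarrow> 'a::euclidean_space \<Rightarrow> complex"
  assumes A: "countable A" "infinite A"
    and f: "\<And>i. i \<in> A \<Longrightarrow> f i \<in> borel_measurable borel"
    and bd: "\<And>i x. i \<in> A \<Longrightarrow> norm (f i x) \<le> c i"
    and c: "c summable_on A"
  shows "((\<lambda>i. torus_integral (f i)) has_sum torus_integral (\<lambda>x. \<Sum>\<^sub>\<infinity>i\<in>A. f i x)) A"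
proof -
  interpret prob_space "torus_measure :: 'a measure" by (rule prob_space_torus)
  have pt: "(\<lambda>i. norm (f i x)) summable_on A" for x
    by (rule summable_on_comparison_test[OF c]) (use bd in auto)
  have int: "integrable torus_measure (f i)" if "i \<in> A" for i
    using integrable_torus_bounded[OF f[OF that]] bd[OF that] by blast
  have "(\<lambda>i. (LINT x|torus_measure. norm (f i x))) summable_on A"
  proof (rule summable_on_comparison_test[OF c])
    fix i assume i: "i \<in> A"
    have "(LINT x|torus_measure. norm (f i x)) \<le> (\<integral>x. c i \<partial>(torus_measure :: 'a measure))"
      by (rule integral_mono) (use int[OF i] bd[OF i] in auto)
    then show "(LINT x|torus_measure. norm (f i x)) \<le> c i" using prob_space by simp
  qed simp
  note * = has_sum_integral(1)[OF A int pt this]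
  have "(\<lambda>x. \<Sum>\<^sub>\<infinity>i\<in>A. f i x) \<in> borel_measurable borel"
    by (rule borel_measurable_infsum[OF A f pt])
  then have "torus_integral (\<lambda>x. \<Sum>\<^sub>\<infinity>i\<in>A. f i x) = (LINT x|torus_measure. (\<Sum>\<^sub>\<infinity>i\<in>A. f i x))"
    by (rule torus_integral_eq)
  with * show ?thesis by (subst has_sum_cong[where g = "\<lambda>i. (LINT x|torus_measure. f i x)"]) (auto simp: torus_integral_eq f)
qed

section \<open>Density of trigonometric polynomials and uniqueness of Fourier coefficients\<close>

inductive trig_poly :: "('a::euclidean_space \<Rightarrow> complex) \<Rightarrow> bool" where
  trig_char: "k \<in> int_lattice \<Longrightarrow> trig_poly (\<lambda>x. c * character k x)"
| trig_add: "trig_poly f \<Longrightarrow> trig_poly g \<Longrightarrow> trig_poly (\<lambda>x. f x + g x)"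

lemma trig_poly_mult_char: "trig_poly f \<Longrightarrow> k \<in> int_lattice \<Longrightarrow> trig_poly (\<lambda>x. f x * (c * character k x))"
proof (induction rule: trig_poly.induct)
  case (trig_char j d)
  then have "trig_poly (\<lambda>x. (d * c) * character (j + k) x)" by (intro trig_poly.trig_char int_lattice_add)
  then show ?case by (simp add: character_add_left mult_ac)
next
  case (trig_add f g)
  then show ?case using trig_poly.trig_add by (simp add: distrib_right)
qed

lemma trig_poly_mult: "trig_poly g \<Longrightarrow> trig_poly f \<Longrightarrow> trig_poly (\<lambda>x. f x * g x)"
proof (induction rule: trig_poly.induct)
  case (trig_add f' g')
  then show ?case using trig_poly.trig_add by (simp add: distrib_left)
qed (rule trig_poly_mult_char)

lemma trig_poly_const: "trig_poly (\<lambda>x. c)"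
  using trig_char[of 0 c] by simp

lemma trig_poly_continuous: "trig_poly f \<Longrightarrow> continuous_on UNIV f"
  by (induction rule: trig_poly.induct) (auto intro!: continuous_intros)

lemma trig_poly_periodic: "trig_poly f \<Longrightarrow> periodic f"
  by (induction rule: trig_poly.induct) (auto simp: periodic_def periodic_character[unfolded periodic_def])

lemma trig_poly_cos: "b \<in> Basis \<Longrightarrow> trig_poly (\<lambda>x. of_real (cos (2 * pi * (x \<bullet> b))))"
proof -
  assume b: "b \<in> Basis"
  have "trig_poly (\<lambda>x. (1/2) * character b x + (1/2) * character (- b) x)"
    using b by (intro trig_add trig_char) (auto simp: int_lattice_Basis)
  moreover have "(1/2) * character b x + (1/2) * character (- b) x = of_real (cos (2 * pi * (x \<bullet> b)))" for x
    by (simp add: character_def cos_of_real[symmetric] cos_exp_eq inner_commute mult_ac add_divide_distrib)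
  ultimately show ?thesis by simp
qed

lemma trig_poly_sin: "b \<in> Basis \<Longrightarrow> trig_poly (\<lambda>x. of_real (sin (2 * pi * (x \<bullet> b))))"
proof -
  assume b: "b \<in> Basis"
  have "trig_poly (\<lambda>x. (1/(2*\<i>)) * character b x + (-1/(2*\<i>)) * character (- b) x)"
    using b by (intro trig_add trig_char) (auto simp: int_lattice_Basis)
  moreover have "(1/(2*\<i>)) * character b x + (-1/(2*\<i>)) * character (- b) x = of_real (sin (2 * pi * (x \<bullet> b)))" for x
    by (simp add: character_def sin_of_real[symmetric] sin_exp_eq inner_commute mult_ac diff_divide_distrib)
  ultimately show ?thesis by simp
qed

text \<open>The standard embedding of the torus into a product of circles, with all cosines stored
  in one vector and all sines in another. It makes the torus a compact subset of a Euclidean space,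
  with fibres the lattice cosets.\<close>

definition circle_embedding :: "'a::euclidean_space \<Rightarrow> 'a \<times> 'a" where
  "circle_embedding x =
    (\<Sum>b\<in>Basis. cos (2 * pi * (x \<bullet> b)) *\<^sub>R b, \<Sum>b\<in>Basis. sin (2 * pi * (x \<bullet> b)) *\<^sub>R b)"

lemma circle_embedding_inner:
  "b \<in> Basis \<Longrightarrow> fst (circle_embedding x) \<bullet> b = cos (2 * pi * (x \<bullet> b))"
  "b \<in> Basis \<Longrightarrow> snd (circle_embedding x) \<bullet> b = sin (2 * pi * (x \<bullet> b))"
  by (simp_all add: circle_embedding_def inner_sum_left_Basis)

lemma circle_embedding_continuous: "continuous_on S circle_embedding"
  unfolding circle_embedding_def by (intro continuous_intros)

lemma circle_embedding_eq_iff: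
  "circle_embedding x = circle_embedding y \<longleftrightarrow> x - y \<in> int_lattice" for x y :: "'a::euclidean_space"
proof -
  have "circle_embedding x = circle_embedding y \<longleftrightarrow>
      (\<forall>b\<in>Basis. sin (2 * pi * (x \<bullet> b)) = sin (2 * pi * (y \<bullet> b)) \<and> cos (2 * pi * (x \<bullet> b)) = cos (2 * pi * (y \<bullet> b)))"
    by (auto simp: prod_eq_iff euclidean_eq_iff[where 'a = 'a] circle_embedding_inner)
  also have "\<dots> \<longleftrightarrow> (\<forall>b\<in>Basis. \<exists>n::int. 2 * pi * (x \<bullet> b) = 2 * pi * (y \<bullet> b) + 2 * pi * n)"
    by (simp only: sin_cos_eq_iff)
  also have "\<dots> \<longleftrightarrow> (\<forall>b\<in>Basis. \<exists>n::int. x \<bullet> b - y \<bullet> b = n)"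
  proof -
    have "2 * pi * (x \<bullet> b) = 2 * pi * (y \<bullet> b) + 2 * pi * of_int n \<longleftrightarrow> x \<bullet> b - y \<bullet> b = of_int n" for b n
    proof -
      have "2 * pi * (y \<bullet> b) + 2 * pi * of_int n = 2 * pi * (y \<bullet> b + of_int n)" by (simp add: distrib_left)
      then show ?thesis by auto
    qed
    then show ?thesis by simp
  qed
  also have "\<dots> \<longleftrightarrow> x - y \<in> int_lattice"
    by (auto simp: int_lattice_def inner_diff_left Ints_def image_iff)
  finally show ?thesis .
qed

lemma periodic_eq: "periodic f \<Longrightarrow> x - y \<in> int_lattice \<Longrightarrow> f x = f y"
  unfolding periodic_def by (metis add_diff_cancel_left' diff_add_cancel add.commute)

text \<open>Stone--Weierstrass on the image of the torus under the embedding into a product of circles.\<close>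

lemma trig_poly_dense:
  fixes h :: "'a::euclidean_space \<Rightarrow> real"
  assumes h: "periodic h" "continuous_on UNIV h" and e: "e > 0"
  shows "\<exists>g. trig_poly (\<lambda>x. complex_of_real (g x)) \<and> (\<forall>x. \<bar>h x - g x\<bar> < e)"
proof -
  let ?E = "circle_embedding :: 'a \<Rightarrow> 'a \<times> 'a"
  let ?C = "cbox 0 One :: 'a set"
  have E_floor: "?E x = ?E (x - lattice_floor x)" for x
    by (simp add: circle_embedding_eq_iff)
  have cell: "x - lattice_floor x \<in> ?C" for x :: 'a
    using unit_cell_subset diff_lattice_floor_in_cell by blast
  have range: "range ?E = ?E ` ?C"
  proof
    show "range ?E \<subseteq> ?E ` ?C"
      using E_floor cell by blast
  qed auto
  \<comment> \<open>\<open>h\<close> descends to the image: the choice of preimage is immaterial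
    because fibres are lattice cosets and \<open>h\<close> is periodic.\<close>
  define G where "G z = h (SOME x. ?E x = z)" for z
  have G: "G (?E x) = h x" for x
  proof -
    have "?E (SOME y. ?E y = ?E x) = ?E x" by (rule someI[of _ x]) simp
    then show ?thesis unfolding G_def using periodic_eq[OF h(1)] circle_embedding_eq_iff by blast
  qed
  have comp: "compact (?E ` ?C)" by (intro compact_continuous_image circle_embedding_continuous compact_cbox)
  have "continuous_on (?E ` ?C) G"
  \<comment> \<open>The embedding restricted to the compact cube is a closed map, hence a quotient
    map, and continuity passes from \<open>h\<close> to \<open>G\<close>.\<close>
  proof (subst continuous_on_closed_vimage, use comp compact_imp_closed in blast, intro allI impI)
    fix B :: "real set" assume B: "closed B"
    have "G -` B \<inter> ?E ` ?C = ?E ` (?C \<inter> h -` B)" by (auto simp: G)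
    moreover have "closed (?C \<inter> h -` B)"
      using continuous_closed_preimage[of ?C h B] h(2) B continuous_on_subset by blast
    then have "compact (?C \<inter> h -` B)" by (simp add: compact_Int_closed compact_eq_bounded_closed bounded_Int)
    ultimately show "closed (G -` B \<inter> ?E ` ?C)"
      by (simp add: compact_continuous_image circle_embedding_continuous compact_imp_closed)
  qed
  \<comment> \<open>The algebra consists of the continuous functions whose pullback to the torus is
    a trigonometric polynomial; cosine and sine coordinates separate points.\<close>
  then have "\<exists>g. (continuous_on (?E ` ?C) g \<and> trig_poly (\<lambda>x. complex_of_real (g (?E x)))) \<and>
      (\<forall>z \<in> ?E ` ?C. \<bar>G z - g z\<bar> < e)"
  proof (intro Stone_Weierstrass_HOL[OF comp] e, goal_cases)
    case (1 c)
    then show ?case by (simp add: trig_poly_const)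
  next
    case (3 f g)
    then show ?case by (auto intro!: continuous_intros trig_add)
  next
    case (4 f g)
    then show ?case by (auto intro!: continuous_intros trig_poly_mult)
  next
    case (5 x y)
    then consider b where "b \<in> Basis" "fst x \<bullet> b \<noteq> fst y \<bullet> b" | b where "b \<in> Basis" "snd x \<bullet> b \<noteq> snd y \<bullet> b"
      by (auto simp: prod_eq_iff euclidean_eq_iff[where 'a = 'a])
    then show ?case
    proof cases
      case 1
      then show ?thesis
        by (intro exI[of _ "\<lambda>z. fst z \<bullet> b"])
          (auto intro!: continuous_intros simp: circle_embedding_inner trig_poly_cos)
    next
      case 2
      then show ?thesis
        by (intro exI[of _ "\<lambda>z. snd z \<bullet> b"])
          (auto intro!: continuous_intros simp: circle_embedding_inner trig_poly_sin)
    qed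
  qed auto
  then obtain g where "trig_poly (\<lambda>x. complex_of_real (g (?E x)))" "\<And>z. z \<in> range ?E \<Longrightarrow> \<bar>G z - g z\<bar> < e"
    unfolding range by blast
  then show ?thesis using G by (intro exI[of _ "\<lambda>x. g (?E x)"]) (metis rangeI)
qed

lemma torus_integral_nonneg_zero:
  fixes f :: "'a::euclidean_space \<Rightarrow> real"
  assumes f: "periodic f" "continuous_on UNIV f" "\<And>x. f x \<ge> 0"
    and 0: "torus_integral (\<lambda>x. of_real (f x)) = 0"
  shows "f x = 0"
proof -
  have c: "continuous_on (cbox 0 One) f" using f(2) continuous_on_subset by blast
  have "set_integrable lborel (cbox 0 One) f"
    unfolding set_integrable_def by (rule borel_integrable_compact[OF compact_cbox c])
  then have "(LINT x:cbox 0 One|lborel. f x) = integral (cbox 0 One) f"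
    by (rule set_borel_integral_eq_integral)
  moreover have "torus_integral (\<lambda>x. of_real (f x)) = of_real (LINT x:cbox 0 One|lborel. f x)"
    unfolding torus_integral_def by (rule set_integral_complex_of_real)
  ultimately have "integral (cbox 0 One) f = 0" using 0 by simp
  then have z: "\<forall>x\<in>cbox 0 One. f x = 0"
    by (subst (asm) integral_cbox_eq_0_iff[OF c]) (use f(3) in \<open>auto simp: box_ne_empty\<close>)
  have "f x = f (x - lattice_floor x)" using f(1) by (rule periodic_eq) simp
  then show ?thesis using z unit_cell_subset diff_lattice_floor_in_cell by (metis subsetD)
qed

lemma fourier_coeff_alt: "fourier_coeff f k = torus_integral (\<lambda>x. f x * cnj (character k x))"
  by (simp add: fourier_coeff_def character_minus)

text \<open>Such an \<open>f\<close> is orthogonal to every trigonometric polynomial, and these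
  approximate its conjugate uniformly, so the integral of its squared modulus vanishes.\<close>

lemma fourier_coeff_eq_0:
  fixes f :: "'a::euclidean_space \<Rightarrow> complex"
  assumes f: "periodic f" "continuous_on UNIV f"
    and 0: "\<And>k. k \<in> int_lattice \<Longrightarrow> fourier_coeff f k = 0"
  shows "f x = 0"
proof -
  have tp0: "torus_integral (\<lambda>x. f x * p x) = 0" if "trig_poly p" for p
    using that
  proof (induction rule: trig_poly.induct)
    case (trig_char k c)
    have "torus_integral (\<lambda>x. f x * (c * character k x)) = torus_integral (\<lambda>x. c * (f x * cnj (character (- k) x)))"
      by (simp add: character_minus_left mult_ac)
    also have "\<dots> = c * fourier_coeff f (- k)"
      unfolding fourier_coeff_alt by (intro torus_integral_cmult continuous_intros f)
    finally show ?case using trig_char 0 by simp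
  next
    case (trig_add p q)
    have "torus_integral (\<lambda>x. f x * p x + f x * q x) = torus_integral (\<lambda>x. f x * p x) + torus_integral (\<lambda>x. f x * q x)"
      using trig_add.hyps f trig_poly_continuous trig_poly_periodic
      by (intro torus_integral_add) (auto intro!: periodic_mult continuous_intros)
    then show ?case using trig_add.IH by (simp add: distrib_left)
  qed
  obtain B where B: "B \<ge> 0" "\<And>x. norm (f x) \<le> B" using periodic_bounded[OF f] by blast
  have "norm (torus_integral (\<lambda>x. f x * cnj (f x))) \<le> e" if "e > 0" for e
  proof -
    \<comment> \<open>Real and imaginary part each contribute \<open>d\<close>, so the error is at
      most \<open>B * (2 * d)\<close>; \<open>B + 1\<close> keeps the denominator positive when
      \<open>B = 0\<close>.\<close>
    define d where "d = e / (2 * (B + 1))"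
    have d: "d > 0" using that B by (simp add: d_def)
    have fr: "periodic (\<lambda>x. Re (f x))" "continuous_on UNIV (\<lambda>x. Re (f x))"
      "periodic (\<lambda>x. Im (f x))" "continuous_on UNIV (\<lambda>x. Im (f x))"
      using f by (auto simp: periodic_def intro!: continuous_intros)
    obtain p where p: "trig_poly (\<lambda>x. complex_of_real (p x))" "\<And>x. \<bar>Re (f x) - p x\<bar> < d"
      using trig_poly_dense[OF fr(1,2) d] by blast
    obtain q where q: "trig_poly (\<lambda>x. complex_of_real (q x))" "\<And>x. \<bar>Im (f x) - q x\<bar> < d"
      using trig_poly_dense[OF fr(3,4) d] by blast
    define r where "r x = complex_of_real (p x) + of_real (q x) * - \<i>" for x
    have r: "trig_poly r"
      unfolding r_def by (intro trig_add p(1) trig_poly_mult q(1) trig_poly_const)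
    have rp: "periodic r" "continuous_on UNIV r" using r trig_poly_periodic trig_poly_continuous by blast+
    have rb: "norm (cnj (f x) - r x) \<le> 2 * d" for x
    proof -
      have "norm (cnj (f x) - r x) \<le> \<bar>Re (cnj (f x) - r x)\<bar> + \<bar>Im (cnj (f x) - r x)\<bar>" by (rule cmod_le)
      then show ?thesis using p(2)[of x] q(2)[of x] by (simp add: r_def)
    qed
    have "torus_integral (\<lambda>x. f x * cnj (f x)) = torus_integral (\<lambda>x. f x * (cnj (f x) - r x) + f x * r x)"
      by (simp add: algebra_simps)
    also have "\<dots> = torus_integral (\<lambda>x. f x * (cnj (f x) - r x)) + torus_integral (\<lambda>x. f x * r x)"
      using f rp by (intro torus_integral_add) (auto simp: periodic_def intro!: continuous_intros)
    also have "\<dots> = torus_integral (\<lambda>x. f x * (cnj (f x) - r x))" using tp0[OF r] by simp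
    also have "norm \<dots> \<le> B * (2 * d)"
      using f rp B rb
      by (intro norm_torus_integral_le continuous_borel continuous_intros) (auto simp: norm_mult intro!: mult_mono)
    also have "\<dots> \<le> e" using that B by (simp add: d_def field_simps)
    finally show ?thesis .
  qed
  then have "torus_integral (\<lambda>x. f x * cnj (f x)) = 0" by (metis dense_ge norm_le_zero_iff)
  then have "torus_integral (\<lambda>x. of_real ((norm (f x))\<^sup>2)) = 0" by (simp only: complex_norm_square)
  then have "(norm (f x))\<^sup>2 = 0"
    by (rule torus_integral_nonneg_zero[rotated 3]) (use f in \<open>auto simp: periodic_def intro!: continuous_intros\<close>)
  then show ?thesis by simp
qed

section \<open>Orthogonality and absolutely convergent Fourier series\<close>

lemma torus_integral_const: "torus_integral (\<lambda>x::'a::euclidean_space. c) = c"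
proof -
  interpret prob_space "torus_measure :: 'a measure" by (rule prob_space_torus)
  show ?thesis using prob_space by (simp add: torus_integral_eq)
qed

lemma torus_integral_character:
  assumes "k \<in> int_lattice"
  shows "torus_integral (character k) = (if k = 0 then 1 else 0)"
proof (cases "k = 0")
  case True
  then have "character k = (\<lambda>x. 1)" by auto
  then show ?thesis using torus_integral_const[of 1] True by simp
next
  case False
  then obtain b where b: "b \<in> Basis" "k \<bullet> b \<noteq> 0" using euclidean_all_zero_iff by blast
  let ?w = "2 * of_real pi * \<i> * of_real (k \<bullet> b) :: complex"
  have "torus_integral (\<lambda>x. ?w * character k x) = 0"
    by (rule torus_integral_partial_zero[OF dir_deriv_character])
      (use periodic_character[OF assms] in \<open>auto simp: periodic_def intro!: continuous_intros\<close>)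
  then have "?w * torus_integral (character k) = 0"
    using torus_integral_cmult[OF continuous_character[OF continuous_on_id], of ?w k] by simp
  then show ?thesis using b False by simp
qed

definition fourier_series :: "('a::euclidean_space \<Rightarrow> complex) \<Rightarrow> 'a \<Rightarrow> complex" where
  "fourier_series a x = (\<Sum>\<^sub>\<infinity>k\<in>int_lattice. a k * character k x)"

lemma fourier_series_continuous:
  assumes "(\<lambda>k. norm (a k)) summable_on int_lattice"
  shows "continuous_on S (fourier_series a)"
  unfolding fourier_series_def[abs_def]
  by (rule continuous_on_infsum[OF _ _ _ _ assms]) (auto simp: norm_mult intro!: continuous_intros)

lemma fourier_series_periodic: "periodic (fourier_series a)"
  unfolding fourier_series_def periodic_def
  by (intro allI ballI infsum_cong) (simp add: periodic_character[unfolded periodic_def])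

text \<open>Termwise integration with majorant \<open>norm (a k)\<close> times the supremum of
  \<open>g\<close>. It yields both the coefficients of a series and the Parseval identity used for
  the adjoint.\<close>

lemma fourier_series_integral:
  assumes a: "(\<lambda>k. norm (a k)) summable_on int_lattice" and g: "periodic g" "continuous_on UNIV g"
  shows "((\<lambda>k. a k * torus_integral (\<lambda>x. character k x * g x)) has_sum
    torus_integral (\<lambda>x. fourier_series a x * g x)) int_lattice"
proof -
  obtain B where B: "B \<ge> 0" "\<And>x. norm (g x) \<le> B" using periodic_bounded[OF g] by blast
  have "((\<lambda>k. torus_integral (\<lambda>x. a k * (character k x * g x))) has_sum
      torus_integral (\<lambda>x. \<Sum>\<^sub>\<infinity>k\<in>int_lattice. a k * (character k x * g x))) int_lattice"
    by (rule torus_integral_infsum[where c = "\<lambda>k. norm (a k) * B"])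
      (use B g in \<open>auto simp: norm_mult intro!: mult_left_mono continuous_borel continuous_intros summable_on_cmult_left a\<close>)
  moreover have "(\<Sum>\<^sub>\<infinity>k\<in>int_lattice. a k * (character k x * g x)) = fourier_series a x * g x" for x
    unfolding fourier_series_def mult.assoc[symmetric]
    by (rule infsum_cmult_left')
  moreover have "torus_integral (\<lambda>x. a k * (character k x * g x)) = a k * torus_integral (\<lambda>x. character k x * g x)" for k
    using g by (intro torus_integral_cmult continuous_intros)
  ultimately show ?thesis by simp
qed

lemma fourier_coeff_series:
  assumes a: "(\<lambda>k. norm (a k)) summable_on int_lattice" and k: "k \<in> int_lattice"
  shows "fourier_coeff (fourier_series a) k = a k"
proof -
  have "((\<lambda>j. a j * torus_integral (\<lambda>x. character j x * character (- k) x)) has_sum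
      torus_integral (\<lambda>x. fourier_series a x * character (- k) x)) int_lattice"
    using k by (intro fourier_series_integral a periodic_character continuous_intros) auto
  moreover have "a j * torus_integral (\<lambda>x. character j x * character (- k) x) = (if j = k then a k else 0)"
    if "j \<in> int_lattice" for j
    using torus_integral_character[of "j - k"] int_lattice_add[of j "- k"] that k
    by (simp add: character_add_left[symmetric])
  ultimately have "((\<lambda>j. if j = k then a k else 0) has_sum torus_integral (\<lambda>x. fourier_series a x * character (- k) x)) int_lattice"
    by (subst (asm) has_sum_cong) auto
  moreover have "((\<lambda>j. if j = k then a k else 0) has_sum a k) int_lattice"
    using k has_sum_finite_neutralI[of "{k}" int_lattice "\<lambda>j. if j = k then a k else 0" "a k"] by auto
  ultimately have "torus_integral (\<lambda>x. fourier_series a x * character (- k) x) = a k"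
    using has_sum_unique by blast
  then show ?thesis by (simp add: fourier_coeff_alt character_minus_left)
qed

lemma fourier_coeff_diff:
  assumes "periodic f" "continuous_on UNIV f" "periodic g" "continuous_on UNIV g" "k \<in> int_lattice"
  shows "fourier_coeff (\<lambda>x. f x - g x) k = fourier_coeff f k - fourier_coeff g k"
proof -
  have pk: "periodic (\<lambda>x. cnj (character k x))"
    using periodic_character[OF assms(5)] by (simp add: periodic_def)
  have "torus_integral (\<lambda>x. f x * cnj (character k x) + (- 1) * (g x * cnj (character k x)))
     = torus_integral (\<lambda>x. f x * cnj (character k x)) + torus_integral (\<lambda>x. (- 1) * (g x * cnj (character k x)))"
    using assms pk by (intro torus_integral_add) (auto simp: periodic_def intro!: continuous_intros)
  also have "torus_integral (\<lambda>x. (- 1) * (g x * cnj (character k x))) = (- 1) * torus_integral (\<lambda>x. g x * cnj (character k x))"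
    using assms by (intro torus_integral_cmult continuous_intros)
  finally show ?thesis by (simp add: fourier_coeff_alt algebra_simps)
qed

text \<open>The series is continuous and has the same coefficients as \<open>f\<close>, so the
  difference vanishes by uniqueness.\<close>

lemma fourier_inversion:
  assumes f: "periodic f" "continuous_on UNIV f"
    and s: "(\<lambda>k. norm (fourier_coeff f k)) summable_on int_lattice"
  shows "f x = fourier_series (fourier_coeff f) x"
proof -
  have "f x - fourier_series (fourier_coeff f) x = 0"
    by (rule fourier_coeff_eq_0)
      (use f fourier_series_periodic[of "fourier_coeff f"] fourier_series_continuous[OF s, of UNIV] in
       \<open>auto simp: periodic_def fourier_coeff_diff fourier_coeff_series[OF s] intro!: continuous_intros\<close>)
  then show ?thesis by simp
qed

section \<open>The heat kernel\<close>

lemma summable_on_finite_sums_bound: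
  fixes f :: "'i \<Rightarrow> real"
  assumes "\<And>i. i \<in> A \<Longrightarrow> f i \<ge> 0" "\<And>F. finite F \<Longrightarrow> F \<subseteq> A \<Longrightarrow> sum f F \<le> B"
  shows "f summable_on A"
  by (rule nonneg_bdd_above_summable_on) (use assms in \<open>auto intro!: bdd_aboveI[of _ B]\<close>)

text \<open>The unfolding half of Poisson summation: \<open>f\<close> is split into its restrictions
  to the cells, only one of which is nonzero at any point. The summability of the cell norms is
  recorded so that the sum may later be moved inside the cell integral.\<close>

lemma integral_unfold:
  fixes f :: "'a::euclidean_space \<Rightarrow> complex"
  assumes f: "integrable lborel f"
  shows "((\<lambda>n. \<integral>x. f (x + n) \<partial>torus_measure) has_sum (\<integral>x. f x \<partial>lborel)) int_lattice"
    and "(\<lambda>n. \<integral>x. norm (f (x + n)) \<partial>torus_measure) summable_on int_lattice"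
    and "integrable torus_measure (\<lambda>x. f (x + n))"
proof -
  have [measurable]: "f \<in> borel_measurable borel" using f by auto
  define F where "F n x = indicator unit_cell (x - n) *\<^sub>R f x" for n x
  have [measurable]: "F n \<in> borel_measurable borel" for n unfolding F_def by measurable
  have intF: "integrable lborel (F n)" for n
    unfolding F_def by (rule Bochner_Integration.integrable_bound[OF f]) (auto simp: indicator_def)
  have cell: "(\<integral>x. g (x + n) \<partial>torus_measure) = (\<integral>x. indicator unit_cell (x - n) *\<^sub>R g x \<partial>lborel)"
    if [measurable]: "g \<in> borel_measurable borel" for n and g :: "'a \<Rightarrow> 'b::{banach, second_countable_topology}"
  proof -
    have "(\<integral>x. g (x + n) \<partial>torus_measure) = (\<integral>x. indicator unit_cell x *\<^sub>R g (x + n) \<partial>lborel)"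
      unfolding torus_measure_def by (subst integral_restrict_space) auto
    also have "\<dots> = (\<integral>x. indicator unit_cell (x - n) *\<^sub>R g x \<partial>distr lborel borel ((+) n))"
      by (subst integral_distr) (auto simp: add.commute)
    finally show ?thesis by (simp add: lborel_distr_plus)
  qed
  have pt: "F n x = (if n = lattice_floor x then f x else 0)" if "n \<in> int_lattice" for n x
    using diff_in_cell_iff[OF that, of x] by (auto simp: F_def)
  have hs: "((\<lambda>n. F n x) has_sum f x) int_lattice" and hsn: "((\<lambda>n. norm (F n x)) has_sum norm (f x)) int_lattice" for x
    by (rule has_sum_finite_neutralI[of "{lattice_floor x}"]; simp add: pt)+
  have bound: "(\<Sum>n\<in>A. \<integral>x. norm (F n x) \<partial>lborel) \<le> (\<integral>x. norm (f x) \<partial>lborel)"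
    if "finite A" "A \<subseteq> int_lattice" for A
  proof -
    have "(\<Sum>n\<in>A. \<integral>x. norm (F n x) \<partial>lborel) = (\<integral>x. (\<Sum>n\<in>A. norm (F n x)) \<partial>lborel)"
      using intF by (subst Bochner_Integration.integral_sum) auto
    also have "\<dots> \<le> (\<integral>x. norm (f x) \<partial>lborel)"
    proof (rule integral_mono)
      show "(\<Sum>n\<in>A. norm (F n x)) \<le> norm (f x)" for x
        by (rule has_sum_mono_neutral[OF has_sum_finite[OF that(1)] hsn]) (use that in auto)
    qed (use intF f in auto)
    finally show ?thesis .
  qed
  have sm: "(\<lambda>n. \<integral>x. norm (F n x) \<partial>lborel) summable_on int_lattice"
    by (rule summable_on_finite_sums_bound[OF _ bound]) auto
  have "((\<lambda>n. \<integral>x. F n x \<partial>lborel) has_sum (\<integral>x. (\<Sum>\<^sub>\<infinity>n\<in>int_lattice. F n x) \<partial>lborel)) int_lattice"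
    by (rule has_sum_integral) (use intF sm hsn in \<open>auto intro: has_sum_imp_summable\<close>)
  then show "((\<lambda>n. \<integral>x. f (x + n) \<partial>torus_measure) has_sum (\<integral>x. f x \<partial>lborel)) int_lattice"
    using infsumI[OF hs] by (simp add: cell F_def)
  have "(\<integral>x. norm (F n x) \<partial>lborel) = (\<integral>x. norm (f (x + n)) \<partial>torus_measure)" for n
    by (subst cell[of "\<lambda>x. norm (f x)"]) (auto simp: F_def indicator_def intro!: Bochner_Integration.integral_cong)
  then show "(\<lambda>n. \<integral>x. norm (f (x + n)) \<partial>torus_measure) summable_on int_lattice" using sm by simp
  have "integrable (distr lborel borel ((+) (- n))) (\<lambda>x. f (x + n))"
    by (subst integrable_distr_eq) (auto simp: f)
  then have "integrable lborel (\<lambda>x. f (x + n))" by (simp add: lborel_distr_plus)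
  then show "integrable torus_measure (\<lambda>x. f (x + n))"
    unfolding torus_measure_def by (subst integrable_restrict_space) (auto intro: integrable_mult_indicator)
qed

section \<open>Poisson summation for Gaussians, in one dimension and then in all\<close>

lemma int_lattice_diff: "m \<in> int_lattice \<Longrightarrow> n \<in> int_lattice \<Longrightarrow> m - n \<in> int_lattice"
  using int_lattice_add[of m "- n"] by simp

lemma int_lattice_real: "(int_lattice :: real set) = range of_int"
  by (auto simp: int_lattice_def Ints_def)

lemma bij_betw_of_int_real: "bij_betw of_int UNIV (int_lattice :: real set)"
  by (auto simp: bij_betw_def inj_def int_lattice_real)

lemma summable_exp_abs_int:
  assumes "c > 0" shows "(\<lambda>n::int. exp (- c * \<bar>real_of_int n\<bar>)) summable_on UNIV"
proof -
  have geo: "summable (\<lambda>n. exp (- c) ^ n)" using assms by (intro summable_geometric) auto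
  have e: "exp (- (c * real n)) = exp (- c) ^ n" for n
    by (simp add: exp_of_nat_mult[symmetric] mult.commute)
  have 1: "(\<lambda>n::int. exp (- c * \<bar>real_of_int n\<bar>)) summable_on (int ` UNIV)"
    by (subst summable_on_reindex) (use geo in \<open>auto simp: o_def e intro!: summable_nonneg_imp_summable_on\<close>)
  have 2: "(\<lambda>n::int. exp (- c * \<bar>real_of_int n\<bar>)) summable_on ((\<lambda>n. - int n) ` UNIV)"
    by (subst summable_on_reindex) (use geo in \<open>auto simp: o_def e inj_def intro!: summable_nonneg_imp_summable_on\<close>)
  have "(UNIV :: int set) = int ` UNIV \<union> (\<lambda>n. - int n) ` UNIV"
    using int_cases2 by (metis (mono_tags, lifting) UNIV_eq_I UnCI rangeI)
  then show ?thesis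
    using summable_on_union[OF 1 2] by metis
qed

lemma summable_gaussian_lattice:
  assumes "c > 0" shows "(\<lambda>n::real. exp (- c * n\<^sup>2)) summable_on int_lattice"
proof -
  have "(\<lambda>n::int. exp (- c * (real_of_int n)\<^sup>2)) summable_on UNIV"
  proof (rule summable_on_comparison_test[OF summable_exp_abs_int[OF assms]])
    fix n :: int
    have "\<bar>n\<bar> * 1 \<le> \<bar>n\<bar> * \<bar>n\<bar>"
      using mult_left_mono[of 1 "\<bar>n\<bar>" "\<bar>n\<bar>"] by (cases "n = 0") auto
    then have "\<bar>n\<bar> \<le> n\<^sup>2" by (simp add: power2_eq_square)
    then have "\<bar>real_of_int n\<bar> \<le> (real_of_int n)\<^sup>2" by (metis of_int_abs of_int_le_iff of_int_power)
    then show "exp (- c * (real_of_int n)\<^sup>2) \<le> exp (- c * \<bar>real_of_int n\<bar>)" using assms by simp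
  qed simp
  then show ?thesis using summable_on_reindex_bij_betw[OF bij_betw_of_int_real, of "\<lambda>n. exp (- c * n\<^sup>2)"] by simp
qed

text \<open>A Gaussian majorant in \<open>n\<close> that is uniform for \<open>x\<close> in a
  bounded set, from (x + n)^2 >= n^2/2 - x^2.\<close>

lemma gaussian_shift_le:
  fixes x n c :: real
  assumes "c > 0" "\<bar>x\<bar> \<le> R"
  shows "exp (- c * (x + n)\<^sup>2) \<le> exp (c * R\<^sup>2) * exp (- (c / 2) * n\<^sup>2)"
proof -
  have "(x + n)\<^sup>2 - n\<^sup>2 / 2 + x\<^sup>2 = (n + 2 * x)\<^sup>2 / 2" by (simp add: power2_eq_square field_simps)
  then have "(x + n)\<^sup>2 \<ge> n\<^sup>2 / 2 - x\<^sup>2" by (smt (verit) zero_le_power2 divide_nonneg_pos)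
  moreover have "x\<^sup>2 \<le> R\<^sup>2" using assms by (metis abs_ge_zero power2_abs power_mono)
  ultimately have "c * (x + n)\<^sup>2 \<ge> c * (n\<^sup>2 / 2 - R\<^sup>2)" using assms by (intro mult_left_mono) auto
  then show ?thesis by (simp add: exp_add[symmetric] algebra_simps)
qed

text \<open>The substitution x = sqrt(2t) y turns the integral into the characteristic function of
  the standard normal law.\<close>

lemma gaussian_fourier:
  assumes t: "t > 0"
  shows "integrable lborel (\<lambda>x. complex_of_real (exp (- x\<^sup>2 / (4 * t))) * cnj (character k x))"
    and "(\<integral>x. complex_of_real (exp (- x\<^sup>2 / (4 * t))) * cnj (character k x) \<partial>lborel) =
      of_real (sqrt (4 * pi * t) * exp (- 4 * pi\<^sup>2 * k\<^sup>2 * t))"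
proof -
  define s where "s = - (2 * pi * k * sqrt (2 * t))"
  let ?f = "\<lambda>x. complex_of_real (exp (- x\<^sup>2 / (4 * t))) * cnj (character k x)"
  have s0: "sqrt (2 * t) \<noteq> 0" using t by simp
  interpret real_distribution std_normal_distribution by (rule real_dist_normal_dist)
  have "integrable std_normal_distribution (\<lambda>x. iexp (s * x))"
    by (rule integrable_const_bound[where B = 1]) auto
  then have i: "integrable lborel (\<lambda>x. std_normal_density x *\<^sub>R iexp (s * x))"
    by (subst (asm) integrable_density) auto
  have eq: "?f (0 + sqrt (2 * t) * x) = sqrt (2 * pi) *\<^sub>R (std_normal_density x *\<^sub>R iexp (s * x))" for x
  proof -
    have "(sqrt (2 * t) * x)\<^sup>2 / (4 * t) = x\<^sup>2 / 2" using t by (simp add: power_mult_distrib)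
    moreover have "cnj (character k (sqrt (2 * t) * x)) = iexp (s * x)"
      by (simp add: character_def exp_cnj s_def mult_ac)
    ultimately show ?thesis
      by (simp add: std_normal_density_def scaleR_conv_of_real)
  qed
  have "integrable lborel (\<lambda>x. ?f (0 + sqrt (2 * t) * x))" unfolding eq using i by (intro integrable_scaleR_right)
  then show "integrable lborel ?f" using lborel_integrable_real_affine_iff[OF s0] by blast
  have "(\<integral>x. ?f x \<partial>lborel) = \<bar>sqrt (2 * t)\<bar> *\<^sub>R (\<integral>x. ?f (0 + sqrt (2 * t) * x) \<partial>lborel)"
    by (rule lborel_integral_real_affine[OF s0])
  also have "\<dots> = (\<bar>sqrt (2 * t)\<bar> * sqrt (2 * pi)) *\<^sub>R (\<integral>x. std_normal_density x *\<^sub>R iexp (s * x) \<partial>lborel)"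
    unfolding eq integral_scaleR_right by simp
  also have "(\<integral>x. std_normal_density x *\<^sub>R iexp (s * x) \<partial>lborel) = char std_normal_distribution s"
    unfolding char_def by (subst integral_density) auto
  also have "\<dots> = of_real (exp (- 4 * pi\<^sup>2 * k\<^sup>2 * t))"
  proof -
    have "s\<^sup>2 / 2 = 4 * pi\<^sup>2 * k\<^sup>2 * t" using t by (simp add: s_def power_mult_distrib)
    then show ?thesis by (simp add: char_std_normal_distribution)
  qed
  also have "\<bar>sqrt (2 * t)\<bar> * sqrt (2 * pi) = sqrt (4 * pi * t)"
    using t by (simp add: real_sqrt_mult[symmetric] mult_ac)
  finally show "(\<integral>x. ?f x \<partial>lborel) = of_real (sqrt (4 * pi * t) * exp (- 4 * pi\<^sup>2 * k\<^sup>2 * t))"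
    by (simp add: scaleR_conv_of_real)
qed

text \<open>Jacobi's identity: the periodised Gaussian is continuous and periodic, unfolding
  identifies its Fourier coefficients with the Gaussian transform at lattice points, and these are
  summable, so inversion applies.\<close>

lemma theta_transform:
  fixes x t :: real
  assumes t: "t > 0"
  shows "(\<Sum>\<^sub>\<infinity>n\<in>int_lattice. complex_of_real (exp (- (x + n)\<^sup>2 / (4 * t)))) =
    of_real (sqrt (4 * pi * t)) * (\<Sum>\<^sub>\<infinity>k\<in>int_lattice. of_real (exp (- 4 * pi\<^sup>2 * k\<^sup>2 * t)) * character k x)"
    and "(\<lambda>n. exp (- (x + n)\<^sup>2 / (4 * t))) summable_on int_lattice"
    and "(\<lambda>k::real. exp (- 4 * pi\<^sup>2 * k\<^sup>2 * t)) summable_on int_lattice"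
proof -
  let ?g = "\<lambda>n x. complex_of_real (exp (- (x + n)\<^sup>2 / (4 * t)))"
  define g where "g x = (\<Sum>\<^sub>\<infinity>n\<in>int_lattice. ?g n x)" for x
  let ?c = "1 / (4 * t)"
  have c: "?c > 0" using t by simp
  have bd: "norm (?g n x) \<le> exp (?c * R\<^sup>2) * exp (- (?c / 2) * n\<^sup>2)" if "\<bar>x\<bar> \<le> R" for n x R
    using gaussian_shift_le[OF c that, of n] by simp
  have sm: "(\<lambda>n. exp (?c * R\<^sup>2) * exp (- (?c / 2) * n\<^sup>2)) summable_on (int_lattice :: real set)" for R
    using c by (intro summable_on_cmult_right summable_gaussian_lattice) auto
  have pt: "(\<lambda>n. norm (?g n x)) summable_on int_lattice" for x
    by (rule summable_on_comparison_test[OF sm[of "\<bar>x\<bar>"]]) (use bd[of x "\<bar>x\<bar>"] in auto)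
  then show "(\<lambda>n. exp (- (x + n)\<^sup>2 / (4 * t))) summable_on int_lattice" by simp
  show ks: "(\<lambda>k::real. exp (- 4 * pi\<^sup>2 * k\<^sup>2 * t)) summable_on int_lattice"
    using summable_gaussian_lattice[of "4 * pi\<^sup>2 * t"] t by (simp add: mult_ac)
  \<comment> \<open>The majorant depends on the radius, so continuity is first obtained on
    balls.\<close>
  have "continuous_on (ball 0 R) g" for R
    unfolding g_def
    by (rule continuous_on_infsum[OF _ _ _ _ sm[of R]]) (use bd[of _ R] t in \<open>auto intro!: continuous_intros\<close>)
  then have "isCont g x" for x
    by (rule continuous_on_interior[of "ball 0 (\<bar>x\<bar> + 1)"]) auto
  then have g_cont: "continuous_on UNIV g" by (simp add: continuous_at_imp_continuous_on)
  have g_per: "periodic g"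
    unfolding periodic_def g_def
  proof (intro allI ballI)
    fix x m :: real assume m: "m \<in> int_lattice"
    have "bij_betw ((+) m) int_lattice int_lattice"
      by (rule bij_betw_byWitness[where f' = "(+) (- m)"]) (use m in \<open>auto simp: int_lattice_add int_lattice_diff\<close>)
    from infsum_reindex_bij_betw[OF this, of "\<lambda>n. ?g n x"]
    show "(\<Sum>\<^sub>\<infinity>n\<in>int_lattice. ?g n (x + m)) = (\<Sum>\<^sub>\<infinity>n\<in>int_lattice. ?g n x)"
      by (simp add: add.assoc)
  qed
  have coeff: "fourier_coeff g k = of_real (sqrt (4 * pi * t) * exp (- 4 * pi\<^sup>2 * k\<^sup>2 * t))"
    if k: "k \<in> int_lattice" for k
  proof -
    define f where "f x = complex_of_real (exp (- x\<^sup>2 / (4 * t))) * cnj (character k x)" for x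
    have f: "integrable lborel f" unfolding f_def by (rule gaussian_fourier[OF t])
    \<comment> \<open>Lattice shifts do not change the character, so periodising \<open>f\<close>
      gives \<open>g\<close> times the conjugate character.\<close>
    have fn: "f (x + n) = ?g n x * cnj (character k x)" if "n \<in> int_lattice" for x n
      using periodic_character[OF k] that by (simp add: f_def periodic_def)
    have nf: "(\<lambda>n. norm (f (x + n))) summable_on int_lattice" for x
      using pt[of x] by (rule summable_on_cong[THEN iffD1, rotated]) (simp add: fn norm_mult)
    have "((\<lambda>n. \<integral>x. f (x + n) \<partial>torus_measure) has_sum
        (\<integral>x. (\<Sum>\<^sub>\<infinity>n\<in>int_lattice. f (x + n)) \<partial>torus_measure)) int_lattice"
      by (rule has_sum_integral) (use integral_unfold(2,3)[OF f] nf in auto)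
    with integral_unfold(1)[OF f] have "(\<integral>x. (\<Sum>\<^sub>\<infinity>n\<in>int_lattice. f (x + n)) \<partial>torus_measure) = (\<integral>x. f x \<partial>lborel)"
      using has_sum_unique by blast
    moreover have "(\<Sum>\<^sub>\<infinity>n\<in>int_lattice. f (x + n)) = g x * cnj (character k x)" for x
    proof -
      have "(\<Sum>\<^sub>\<infinity>n\<in>int_lattice. f (x + n)) = (\<Sum>\<^sub>\<infinity>n\<in>int_lattice. ?g n x * cnj (character k x))"
        by (intro infsum_cong) (simp add: fn)
      then show ?thesis by (simp only: g_def infsum_cmult_left')
    qed
    ultimately have "(\<integral>x. g x * cnj (character k x) \<partial>torus_measure) = (\<integral>x. f x \<partial>lborel)" by simp
    moreover have "fourier_coeff g k = (\<integral>x. g x * cnj (character k x) \<partial>torus_measure)"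
      unfolding fourier_coeff_alt by (intro torus_integral_eq continuous_borel continuous_intros g_cont)
    ultimately show ?thesis unfolding f_def by (simp only: gaussian_fourier[OF t])
  qed
  have "(\<lambda>k. norm (fourier_coeff g k)) summable_on int_lattice"
  proof (rule summable_on_cong[THEN iffD1])
    show "(\<lambda>k::real. sqrt (4 * pi * t) * exp (- 4 * pi\<^sup>2 * k\<^sup>2 * t)) summable_on int_lattice"
      by (intro summable_on_cmult_right ks)
  qed (use t in \<open>simp add: coeff norm_mult\<close>)
  then have "g x = fourier_series (fourier_coeff g) x"
    by (intro fourier_inversion g_per g_cont)
  also have "\<dots> = (\<Sum>\<^sub>\<infinity>k\<in>int_lattice. of_real (sqrt (4 * pi * t)) * (of_real (exp (- 4 * pi\<^sup>2 * k\<^sup>2 * t)) * character k x))"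
    unfolding fourier_series_def by (intro infsum_cong) (simp add: coeff)
  also have "\<dots> = of_real (sqrt (4 * pi * t)) * (\<Sum>\<^sub>\<infinity>k\<in>int_lattice. of_real (exp (- 4 * pi\<^sup>2 * k\<^sup>2 * t)) * character k x)"
    by (rule infsum_cmult_right')
  finally show "(\<Sum>\<^sub>\<infinity>n\<in>int_lattice. ?g n x) = \<dots>" by (simp only: g_def)
qed

text \<open>A lattice sum of products over coordinates is a product of one-dimensional sums; this
  carries Poisson summation to all dimensions.\<close>

lemma infsum_lattice_prod:
  fixes f :: "'a::euclidean_space \<Rightarrow> real \<Rightarrow> complex"
  assumes f: "\<And>b. b \<in> Basis \<Longrightarrow> (\<lambda>j. norm (f b j)) summable_on int_lattice"
  shows "(\<lambda>k::'a. norm (\<Prod>b\<in>Basis. f b (k \<bullet> b))) summable_on int_lattice"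
    and "(\<Sum>\<^sub>\<infinity>k\<in>int_lattice. \<Prod>b\<in>Basis. f b (k \<bullet> b)) = (\<Prod>b\<in>Basis. \<Sum>\<^sub>\<infinity>j\<in>int_lattice. f b j)"
proof -
  let ?f = "\<lambda>b j. f b (real_of_int j)"
  let ?h = "\<lambda>k::'a. \<lambda>b\<in>Basis. \<lfloor>k \<bullet> b\<rfloor>"
  have f': "(\<lambda>j. norm (?f b j)) summable_on UNIV" if "b \<in> Basis" for b
    using summable_on_reindex_bij_betw[OF bij_betw_of_int_real, of "\<lambda>j. norm (f b j)"] f[OF that] by simp
  have eq: "(\<Prod>b\<in>Basis. ?f b (?h k b)) = (\<Prod>b\<in>Basis. f b (k \<bullet> b))" if "k \<in> int_lattice" for k
    using that by (intro prod.cong) (auto simp: int_lattice_def of_int_floor_cancel)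
  have "Infinite_Set_Sum.abs_summable_on (\<lambda>g. \<Prod>b\<in>Basis. ?f b (g b)) (Basis \<rightarrow>\<^sub>E UNIV)"
    by (rule abs_summable_on_prod_PiE) (use f' in \<open>auto simp: abs_summable_equivalent[symmetric]\<close>)
  then have "(\<lambda>g. norm (\<Prod>b\<in>Basis. ?f b (g b))) summable_on (Basis \<rightarrow>\<^sub>E UNIV)"
    by (simp add: abs_summable_equivalent[symmetric])
  then have "(\<lambda>k. norm (\<Prod>b\<in>Basis. ?f b (?h k b))) summable_on int_lattice"
    using summable_on_reindex_bij_betw[OF bij_betw_int_lattice, of "\<lambda>g. norm (\<Prod>b\<in>Basis. ?f b (g b))"] by blast
  then show "(\<lambda>k::'a. norm (\<Prod>b\<in>Basis. f b (k \<bullet> b))) summable_on int_lattice"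
    by (rule summable_on_cong[THEN iffD1, rotated]) (simp only: eq)
  have "(\<Sum>\<^sub>\<infinity>k\<in>int_lattice. \<Prod>b\<in>Basis. f b (k \<bullet> b)) = (\<Sum>\<^sub>\<infinity>k\<in>int_lattice. \<Prod>b\<in>Basis. ?f b (?h k b))"
    by (intro infsum_cong) (simp only: eq)
  also have "\<dots> = (\<Sum>\<^sub>\<infinity>g\<in>Basis \<rightarrow>\<^sub>E UNIV. \<Prod>b\<in>Basis. ?f b (g b))"
    by (rule infsum_reindex_bij_betw[OF bij_betw_int_lattice, of "\<lambda>g. \<Prod>b\<in>Basis. ?f b (g b)"])
  also have "\<dots> = (\<Prod>b\<in>Basis. \<Sum>\<^sub>\<infinity>j\<in>UNIV. ?f b j)"
    using f' by (intro infsum_prod_PiE_abs) auto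
  also have "\<dots> = (\<Prod>b\<in>Basis. \<Sum>\<^sub>\<infinity>j\<in>int_lattice. f b j)"
    by (intro prod.cong refl infsum_reindex_bij_betw[OF bij_betw_of_int_real])
  finally show "(\<Sum>\<^sub>\<infinity>k\<in>int_lattice. \<Prod>b\<in>Basis. f b (k \<bullet> b)) = (\<Prod>b\<in>Basis. \<Sum>\<^sub>\<infinity>j\<in>int_lattice. f b j)" .
qed

lemma norm_sq_Basis: "(norm (x::'a::euclidean_space))\<^sup>2 = (\<Sum>b\<in>Basis. (x \<bullet> b)\<^sup>2)"
  by (simp only: power2_norm_eq_inner euclidean_inner[of x x]) (simp add: power2_eq_square)

text \<open>The product of the one-dimensional identities: the prefactors sqrt(4 pi t) multiply to
  the power DIM('a)/2. The two sides are the spatial and the spectral form of the heat kernel at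
  time \<open>t\<close>, up to that power.\<close>

lemma heat_transform:
  fixes x :: "'a::euclidean_space" and t :: real
  assumes t: "t > 0"
  shows "(\<lambda>n. exp (- (norm (x + n))\<^sup>2 / (4 * t))) summable_on int_lattice"
    and "(\<lambda>k::'a. exp (- 4 * pi\<^sup>2 * (norm k)\<^sup>2 * t)) summable_on int_lattice"
    and "complex_of_real (\<Sum>\<^sub>\<infinity>n\<in>int_lattice. exp (- (norm (x + n))\<^sup>2 / (4 * t))) =
      of_real ((4 * pi * t) powr (DIM('a) / 2)) *
      (\<Sum>\<^sub>\<infinity>k\<in>int_lattice. of_real (exp (- 4 * pi\<^sup>2 * (norm k)\<^sup>2 * t)) * character k x)"
proof -
  let ?u = "\<lambda>b j. complex_of_real (exp (- (x \<bullet> b + j)\<^sup>2 / (4 * t)))"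
  let ?v = "\<lambda>b j. complex_of_real (exp (- 4 * pi\<^sup>2 * j\<^sup>2 * t)) * character j (x \<bullet> b)"
  have u: "(\<lambda>j. norm (?u b j)) summable_on int_lattice" for b
    using theta_transform(2)[OF t, of "x \<bullet> b"] by simp
  have v: "(\<lambda>j. norm (?v b j)) summable_on int_lattice" for b
    using theta_transform(3)[OF t] by (simp add: norm_mult)
  have pu: "(\<Prod>b\<in>Basis. ?u b (n \<bullet> b)) = of_real (exp (- (norm (x + n))\<^sup>2 / (4 * t)))" for n
    by (simp add: norm_sq_Basis exp_sum[symmetric] of_real_prod[symmetric] sum_divide_distrib sum_negf inner_add_left del: of_real_prod)
  have pv: "(\<Prod>b\<in>Basis. ?v b (k \<bullet> b)) = of_real (exp (- 4 * pi\<^sup>2 * (norm k)\<^sup>2 * t)) * character k x" for k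
  proof -
    have "complex_of_real (k \<bullet> x) = (\<Sum>b\<in>Basis. of_real (k \<bullet> b) * of_real (x \<bullet> b))"
      by (subst euclidean_inner) simp
    then have "(\<Prod>b\<in>Basis. character (k \<bullet> b) (x \<bullet> b)) = character k x"
      by (simp add: character_def exp_sum[symmetric] sum_distrib_left[symmetric])
    moreover have "(\<Prod>b\<in>Basis. exp (- 4 * pi\<^sup>2 * (k \<bullet> b)\<^sup>2 * t)) = exp (- 4 * pi\<^sup>2 * (norm k)\<^sup>2 * t)"
      by (simp add: norm_sq_Basis exp_sum[symmetric] sum_negf sum_distrib_left[symmetric] sum_distrib_right[symmetric])
    ultimately show ?thesis by (simp only: prod.distrib of_real_prod[symmetric])
  qed
  show su: "(\<lambda>n. exp (- (norm (x + n))\<^sup>2 / (4 * t))) summable_on int_lattice"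
    using infsum_lattice_prod(1)[of ?u, OF u] unfolding pu by simp
  show "(\<lambda>k::'a. exp (- 4 * pi\<^sup>2 * (norm k)\<^sup>2 * t)) summable_on int_lattice"
    using infsum_lattice_prod(1)[of ?v, OF v] unfolding pv by (simp add: norm_mult)
  have "complex_of_real (\<Sum>\<^sub>\<infinity>n\<in>int_lattice. exp (- (norm (x + n))\<^sup>2 / (4 * t)))
      = (\<Sum>\<^sub>\<infinity>n\<in>int_lattice. of_real (exp (- (norm (x + n))\<^sup>2 / (4 * t))))"
    by (rule infsumI[symmetric]) (use has_sum_of_real[OF has_sum_infsum[OF su]] in simp)
  also have "\<dots> = (\<Prod>b\<in>Basis. \<Sum>\<^sub>\<infinity>j\<in>int_lattice. ?u b j)"
    using infsum_lattice_prod(2)[of ?u, OF u] unfolding pu .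
  also have "\<dots> = (\<Prod>b\<in>(Basis :: 'a set). of_real (sqrt (4 * pi * t))) * (\<Prod>b\<in>Basis. \<Sum>\<^sub>\<infinity>j\<in>int_lattice. ?v b j)"
    by (simp only: theta_transform(1)[OF t] prod.distrib)
  also have "(\<Prod>b\<in>(Basis :: 'a set). complex_of_real (sqrt (4 * pi * t))) = of_real ((4 * pi * t) powr (DIM('a) / 2))"
    using t by (simp add: powr_half_sqrt[symmetric] of_real_power[symmetric] powr_realpow[symmetric] powr_powr del: of_real_power)
  also have "(\<Prod>b\<in>Basis. \<Sum>\<^sub>\<infinity>j\<in>int_lattice. ?v b j) = (\<Sum>\<^sub>\<infinity>k\<in>int_lattice. of_real (exp (- 4 * pi\<^sup>2 * (norm k)\<^sup>2 * t)) * character k x)"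
    using infsum_lattice_prod(2)[of ?v, OF v] unfolding pv by simp
  finally show "complex_of_real (\<Sum>\<^sub>\<infinity>n\<in>int_lattice. exp (- (norm (x + n))\<^sup>2 / (4 * t))) =
      of_real ((4 * pi * t) powr (DIM('a) / 2)) *
      (\<Sum>\<^sub>\<infinity>k\<in>int_lattice. of_real (exp (- 4 * pi\<^sup>2 * (norm k)\<^sup>2 * t)) * character k x)" .
qed

section \<open>Summability of the frequency weights\<close>

lemma has_bochner_integral_le:
  fixes f g :: "'a \<Rightarrow> real"
  assumes "has_bochner_integral M f a" "has_bochner_integral M g b" "\<And>x. f x \<le> g x"
  shows "a \<le> b"
  using assms integral_mono[of M f g] by (simp add: has_bochner_integral_iff)

text \<open>Euler's integral rescaled by \<open>a\<close>. The indicator of the open half-line lets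
  later integrands with 1/t in the exponent share the same shape.\<close>

lemma gamma_kernel:
  fixes p a :: real
  assumes p: "p > 0" and a: "a > 0"
  shows "has_bochner_integral lborel (\<lambda>t. indicator {0<..} t * (t powr (p - 1) * exp (- (a * t)))) (Gamma p * a powr (- p))"
proof -
  have "has_bochner_integral lborel (\<lambda>t. indicator {0..} t * t powr (p - 1) / exp t) (Gamma p)"
    by (rule has_bochner_integral_nn_integral)
      (use p Gamma_conv_nn_integral_real[OF p] Gamma_real_pos[OF p] in auto)
  then have "has_bochner_integral lborel (\<lambda>t. indicator {0..} (0 + a * t) * (0 + a * t) powr (p - 1) / exp (0 + a * t)) (Gamma p /\<^sub>R \<bar>a\<bar>)"
    using a by (subst (asm) lborel_has_bochner_integral_real_affine_iff[where c = a and t = 0]) auto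
  then have "has_bochner_integral lborel (\<lambda>t. indicator {0..} (a * t) * (a * t) powr (p - 1) / exp (a * t) * a powr (1 - p)) (Gamma p /\<^sub>R \<bar>a\<bar> * a powr (1 - p))"
    by (intro has_bochner_integral_mult_left) simp
  moreover have "indicator {0..} (a * t) * (a * t) powr (p - 1) / exp (a * t) * a powr (1 - p) =
      (indicator {0<..} t * (t powr (p - 1) * exp (- (a * t))) :: real)" for t
  proof (cases "t > 0")
    case True
    then have "(a * t) powr (p - 1) * a powr (1 - p) = t powr (p - 1)"
      using a by (simp add: powr_mult powr_add[symmetric])
    then show ?thesis using True a by (simp add: exp_minus field_simps)
  qed (use a in \<open>auto simp: indicator_def zero_le_mult_iff\<close>)
  moreover have "Gamma p /\<^sub>R \<bar>a\<bar> * a powr (1 - p) = Gamma p * a powr (- p)"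
    using a by (simp add: powr_diff powr_minus field_simps)
  ultimately show ?thesis by (simp only:)
qed

lemma freq_weight_sq: "(freq_weight \<kappa> k)\<^sup>2 = \<kappa>\<^sup>2 + 4 * pi\<^sup>2 * (norm k)\<^sup>2"
  by (simp add: freq_weight_def)

lemma exp_freq_weight:
  "exp (- ((freq_weight \<kappa> k)\<^sup>2 * t)) = exp (- (\<kappa>\<^sup>2 * t)) * exp (- 4 * pi\<^sup>2 * (norm k)\<^sup>2 * t)"
  by (simp add: freq_weight_sq exp_add[symmetric] algebra_simps)

lemma weight_powr_integral:
  fixes \<kappa> s :: real
  assumes \<kappa>: "\<kappa> > 0" and s: "s > 0"
  shows "has_bochner_integral lborel
    (\<lambda>t. indicator {0<..} t * (t powr (s / 2 - 1) * exp (- ((freq_weight \<kappa> k)\<^sup>2 * t))))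
    (Gamma (s / 2) * freq_weight \<kappa> k powr (- s))"
proof -
  have L: "freq_weight \<kappa> k > 0" by (rule freq_weight_pos[OF \<kappa>])
  then have "((freq_weight \<kappa> k)\<^sup>2) powr (- (s / 2)) = freq_weight \<kappa> k powr (- s)"
    using powr_powr[of "freq_weight \<kappa> k" 2 "- (s / 2)"] by simp
  then show ?thesis using gamma_kernel[of "s / 2" "(freq_weight \<kappa> k)\<^sup>2"] s L by simp
qed

text \<open>For \<open>t \<le> 1\<close> the Gaussian side is increasing in \<open>t\<close>, so the
  transform leaves only the power prefactor; for \<open>t \<ge> 1\<close> the spectral side is
  decreasing. The bound is stated for finite partial sums, to be integrated in \<open>t\<close>
  before any interchange.\<close>

lemma heat_trace_le:
  obtains C where "C \<ge> 0" "\<And>t F. t > 0 \<Longrightarrow> finite F \<Longrightarrow> F \<subseteq> (int_lattice :: 'a::euclidean_space set) \<Longrightarrow>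
    (\<Sum>k\<in>F. exp (- 4 * pi\<^sup>2 * (norm k)\<^sup>2 * t)) \<le> C * (1 + t powr (- (DIM('a) / 2)))"
proof -
  define \<Theta> where "\<Theta> t = (\<Sum>\<^sub>\<infinity>k\<in>(int_lattice :: 'a set). exp (- 4 * pi\<^sup>2 * (norm k)\<^sup>2 * t))" for t :: real
  define \<Psi> where "\<Psi> t = (\<Sum>\<^sub>\<infinity>n\<in>(int_lattice :: 'a set). exp (- (norm (0 + n))\<^sup>2 / (4 * t)))" for t :: real
  have eq: "\<Psi> t = (4 * pi * t) powr (DIM('a) / 2) * \<Theta> t" if "t > 0" for t
  proof -
    have "complex_of_real (\<Psi> t) = of_real ((4 * pi * t) powr (DIM('a) / 2)) *
      (\<Sum>\<^sub>\<infinity>k\<in>(int_lattice :: 'a set). of_real (exp (- 4 * pi\<^sup>2 * (norm k)\<^sup>2 * t)))"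
      using heat_transform(3)[OF that, of "0 :: 'a"] by (simp add: \<Psi>_def)
    also have "(\<Sum>\<^sub>\<infinity>k\<in>(int_lattice :: 'a set). complex_of_real (exp (- 4 * pi\<^sup>2 * (norm k)\<^sup>2 * t))) = of_real (\<Theta> t)"
      unfolding \<Theta>_def by (rule infsumI, rule has_sum_of_real, rule has_sum_infsum, rule heat_transform(2)[OF that])
    finally show ?thesis by (simp only: of_real_mult[symmetric] of_real_eq_iff)
  qed
  have \<Psi>_mono: "\<Psi> t \<le> \<Psi> 1" if "0 < t" "t \<le> 1" for t
    unfolding \<Psi>_def
  proof (rule infsum_mono)
    fix n :: 'a
    show "exp (- (norm (0 + n))\<^sup>2 / (4 * t)) \<le> exp (- (norm (0 + n))\<^sup>2 / (4 * 1))"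
      using that by (simp add: divide_simps mult_left_le)
  qed (use heat_transform(1)[OF that(1), of "0 :: 'a"] heat_transform(1)[of 1 "0 :: 'a"] in auto)
  have \<Theta>_mono: "\<Theta> t \<le> \<Theta> 1" if "1 \<le> t" for t
    unfolding \<Theta>_def
  proof (rule infsum_mono)
    fix k :: 'a
    have "(norm k)\<^sup>2 * 1 \<le> (norm k)\<^sup>2 * t" using that by (intro mult_left_mono) auto
    then show "exp (- 4 * pi\<^sup>2 * (norm k)\<^sup>2 * t) \<le> exp (- 4 * pi\<^sup>2 * (norm k)\<^sup>2 * 1)" by simp
  qed (rule heat_transform(2), use that in simp)+
  have \<Theta>0: "\<Theta> 1 \<ge> 0" and \<Psi>0: "\<Psi> 1 \<ge> 0" unfolding \<Theta>_def \<Psi>_def by (intro infsum_nonneg; simp)+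
  have le: "\<Theta> t \<le> (\<Theta> 1 + \<Psi> 1) * (1 + t powr (- (DIM('a) / 2)))" if "t > 0" for t
  proof (cases "t \<le> 1")
    case True
    have "\<Theta> t = (4 * pi * t) powr (- (DIM('a) / 2)) * \<Psi> t"
      using that by (simp add: eq powr_minus)
    also have "\<dots> \<le> t powr (- (DIM('a) / 2)) * \<Psi> 1"
    proof (rule mult_mono)
      \<comment> \<open>The exponent is negative and 4 pi exceeds 1.\<close>
      show "(4 * pi * t) powr (- (DIM('a) / 2)) \<le> t powr (- (DIM('a) / 2))"
        using that pi_gt3 by (intro powr_mono2') auto
    qed (use \<Psi>_mono[OF that True] \<Psi>0 in \<open>auto simp: \<Psi>_def intro!: infsum_nonneg\<close>)
    also have "\<dots> \<le> (\<Theta> 1 + \<Psi> 1) * (1 + t powr (- (DIM('a) / 2)))"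
      using \<Theta>0 \<Psi>0 by (simp add: algebra_simps)
    finally show ?thesis .
  next
    case False
    then have "\<Theta> t \<le> \<Theta> 1" by (intro \<Theta>_mono) simp
    also have "\<dots> \<le> (\<Theta> 1 + \<Psi> 1) * (1 + t powr (- (DIM('a) / 2)))"
      using \<Theta>0 \<Psi>0 by (simp add: algebra_simps)
    finally show ?thesis .
  qed
  show ?thesis
  proof
    fix t :: real and F :: "'a set" assume *: "t > 0" "finite F" "F \<subseteq> int_lattice"
    have "(\<Sum>k\<in>F. exp (- 4 * pi\<^sup>2 * (norm k)\<^sup>2 * t)) \<le> \<Theta> t"
      unfolding \<Theta>_def by (rule finite_sum_le_infsum[OF heat_transform(2)]) (use * in auto)
    also note le[OF *(1)]
    finally show "(\<Sum>k\<in>F. exp (- 4 * pi\<^sup>2 * (norm k)\<^sup>2 * t)) \<le> (\<Theta> 1 + \<Psi> 1) * (1 + t powr (- (DIM('a) / 2)))" .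
  qed (use \<Theta>0 \<Psi>0 in simp)
qed

text \<open>Partial sums of the weights are integrals of partial heat traces against a gamma
  density; the bound \<open>heat_trace_le\<close> makes them uniformly bounded.\<close>

lemma weight_summable:
  fixes \<kappa> s :: real
  assumes \<kappa>: "\<kappa> > 0" and s: "s > real DIM('a::euclidean_space)"
  shows "(\<lambda>k::'a. freq_weight \<kappa> k powr (- s)) summable_on int_lattice"
proof -
  obtain C where C: "C \<ge> 0" "\<And>t F. t > 0 \<Longrightarrow> finite F \<Longrightarrow> F \<subseteq> (int_lattice :: 'a set) \<Longrightarrow>
    (\<Sum>k\<in>F. exp (- 4 * pi\<^sup>2 * (norm k)\<^sup>2 * t)) \<le> C * (1 + t powr (- (DIM('a) / 2)))"
    using heat_trace_le[where 'a = 'a] by blast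
  have s0: "s > 0" using s by (meson of_nat_0_le_iff order_le_less_trans)
  define g where "g p t = indicator {0<..} t * (t powr (p - 1) * exp (- (\<kappa>\<^sup>2 * t)))" for p t :: real
  \<comment> \<open>Two gamma integrals: the constant part of the trace bound gives parameter
    \<open>s / 2\<close>, the singular part gives \<open>(s - DIM('a)) / 2\<close>, which is
    positive exactly above the threshold.\<close>
  define B where "B = C * (Gamma (s / 2) * (\<kappa>\<^sup>2) powr (- (s / 2)) + Gamma ((s - DIM('a)) / 2) * (\<kappa>\<^sup>2) powr (- ((s - DIM('a)) / 2)))"
  have hB: "has_bochner_integral lborel (\<lambda>t. C * (g (s / 2) t + g ((s - DIM('a)) / 2) t)) B"
    unfolding B_def g_def
    by (intro has_bochner_integral_mult_right has_bochner_integral_add gamma_kernel) (use s s0 \<kappa> in auto)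
  have G: "Gamma (s / 2) > 0" using s0 by (simp add: Gamma_real_pos)
  have "(\<lambda>k::'a. Gamma (s / 2) * freq_weight \<kappa> k powr (- s)) summable_on int_lattice"
  proof (rule summable_on_finite_sums_bound)
    fix F :: "'a set" assume F: "finite F" "F \<subseteq> int_lattice"
    let ?f = "\<lambda>k t. indicator {0<..} t * (t powr (s / 2 - 1) * exp (- ((freq_weight \<kappa> k)\<^sup>2 * t)))"
    have "has_bochner_integral lborel (\<lambda>t. \<Sum>k\<in>F. ?f k t) (\<Sum>k\<in>F. Gamma (s / 2) * freq_weight \<kappa> k powr (- s))"
      by (intro has_bochner_integral_sum weight_powr_integral \<kappa> s0)
    moreover have "(\<Sum>k\<in>F. ?f k t) \<le> C * (g (s / 2) t + g ((s - DIM('a)) / 2) t)" for t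
    proof (cases "t > 0")
      case True
      have "(\<Sum>k\<in>F. ?f k t) = t powr (s / 2 - 1) * exp (- (\<kappa>\<^sup>2 * t)) * (\<Sum>k\<in>F. exp (- 4 * pi\<^sup>2 * (norm k)\<^sup>2 * t))"
        using True by (simp only: exp_freq_weight sum_distrib_left) (simp add: mult_ac)
      also have "\<dots> \<le> t powr (s / 2 - 1) * exp (- (\<kappa>\<^sup>2 * t)) * (C * (1 + t powr (- (DIM('a) / 2))))"
        by (intro mult_left_mono C(2) True F) auto
      also have "\<dots> = C * (g (s / 2) t + g ((s - DIM('a)) / 2) t)"
      proof -
        have "t powr (s / 2 - 1) * t powr (- (DIM('a) / 2)) = t powr ((s - DIM('a)) / 2 - 1)"
          unfolding powr_add[symmetric] by (rule arg_cong) (simp add: diff_divide_distrib)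
        then show ?thesis using True by (simp add: g_def algebra_simps)
      qed
      finally show ?thesis .
    qed (simp add: g_def)
    ultimately show "(\<Sum>k\<in>F. Gamma (s / 2) * freq_weight \<kappa> k powr (- s)) \<le> B"
      by (rule has_bochner_integral_le[OF _ hB])
  qed (use G in auto)
  then have "(\<lambda>k::'a. inverse (Gamma (s / 2)) * (Gamma (s / 2) * freq_weight \<kappa> k powr (- s))) summable_on int_lattice"
    by (rule summable_on_cmult_right)
  then show ?thesis using G by (simp add: mult.assoc[symmetric])
qed

lemma not_integrable_inverse: "\<not> set_integrable lborel {0<..1} (\<lambda>t::real. 1 / t)"
proof
  assume "set_integrable lborel {0<..1} (\<lambda>t::real. 1 / t)"
  then have int: "(\<lambda>t::real. 1 / t) integrable_on {0<..1}" by (rule set_borel_integral_eq_integral)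
  have "- ln e \<le> integral {0<..1} (\<lambda>t. 1 / t)" if "0 < e" "e < 1" for e :: real
  proof -
    have h: "((\<lambda>t. 1 / t) has_integral (ln 1 - ln e)) {e..1}"
      by (rule fundamental_theorem_of_calculus)
        (use that in \<open>auto simp: has_real_derivative_iff_has_vector_derivative[symmetric] intro!: derivative_eq_intros\<close>)
    have "integral {e..1} (\<lambda>t. 1 / t) \<le> integral {0<..1} (\<lambda>t. 1 / t)"
      by (rule integral_subset_le) (use that int h in \<open>auto intro: has_integral_integrable\<close>)
    then show ?thesis using h by (simp add: integral_unique)
  qed
  note * = this
  let ?I = "integral {0<..1} (\<lambda>t. 1 / t) :: real"
  have "0 < \<bar>?I\<bar> + 1" by linarith
  \<comment> \<open>The lower limit is chosen so that the logarithm overshoots the supposed value of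
    the integral.\<close>
  then have "\<bar>?I\<bar> + 1 \<le> ?I" using *[of "exp (- (\<bar>?I\<bar> + 1))"] by simp
  then show False using abs_ge_self[of ?I] by linarith
qed

text \<open>Summability would make the subordinated heat trace integrable. At \<open>s = d\<close>,
  however, the Gaussian side is at least 1, so the trace is at least (4 pi t)^(-d/2), and the
  integrand dominates a multiple of 1/t on the unit interval.\<close>

lemma not_weight_summable_DIM:
  fixes \<kappa> :: real
  assumes \<kappa>: "\<kappa> > 0"
  shows "\<not> (\<lambda>k::'a::euclidean_space. freq_weight \<kappa> k powr (- real DIM('a))) summable_on int_lattice"
proof
  assume sm: "(\<lambda>k::'a. freq_weight \<kappa> k powr (- real DIM('a))) summable_on int_lattice"
  define s where "s = real DIM('a)"
  have s0: "s > 0" by (simp add: s_def)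
  let ?f = "\<lambda>(k::'a) t. indicator {0<..} t * (t powr (s / 2 - 1) * exp (- ((freq_weight \<kappa> k)\<^sup>2 * t))) :: real"
  note hb = weight_powr_integral[OF \<kappa> s0]
  have f0: "?f k t \<ge> 0" for k t by simp
  have eq: "?f k t = indicator {0<..} t * (t powr (s / 2 - 1) * exp (- (\<kappa>\<^sup>2 * t))) * exp (- 4 * pi\<^sup>2 * (norm k)\<^sup>2 * t)" for k t
    by (simp only: exp_freq_weight mult.assoc)
  have pt: "(\<lambda>k. ?f k t) summable_on int_lattice" for t
  proof (cases "t > 0")
    case True
    show ?thesis unfolding eq by (intro summable_on_cmult_right heat_transform(2) True)
  qed simp
  have nrm: "norm (?f k t) = ?f k t" for k t using f0 by simp
  have "integrable lborel (\<lambda>t. \<Sum>\<^sub>\<infinity>k\<in>int_lattice. ?f k t)"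
  proof (rule has_sum_integral(2))
    have "(\<integral>t. norm (?f k t) \<partial>lborel) = Gamma (s / 2) * freq_weight \<kappa> k powr (- s)" for k
      unfolding nrm by (rule has_bochner_integral_integral_eq[OF hb])
    then show "(\<lambda>k. \<integral>t. norm (?f k t) \<partial>lborel) summable_on int_lattice"
      using summable_on_cmult_right[OF sm, of "Gamma (s / 2)"] by (simp only: s_def)
    show "integrable lborel (?f k)" for k using hb[of k] unfolding has_bochner_integral_iff by blast
    show "(\<lambda>k. norm (?f k t)) summable_on int_lattice" for t unfolding nrm by (rule pt)
  qed auto
  \<comment> \<open>The constant is chosen to make the integrand at least 1/t on the unit interval:
    it cancels (4 pi)^(-d/2) and the smallest value of the exponential there.\<close>
  then have "integrable lborel (\<lambda>t. ((4 * pi) powr (s / 2) * exp (\<kappa>\<^sup>2)) * (\<Sum>\<^sub>\<infinity>k\<in>int_lattice. ?f k t))" (is "integrable _ ?g")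
    by (rule integrable_mult_right)
  note int_g = this
  have "set_integrable lborel {0<..1} (\<lambda>t::real. 1 / t)"
    unfolding set_integrable_def
  proof (rule Bochner_Integration.integrable_bound[OF int_g])
    show "AE t in lborel. norm (indicator {0<..1} t *\<^sub>R (1 / t :: real)) \<le> norm (?g t)"
    proof (rule AE_I2)
      fix t :: real
      show "norm (indicator {0<..1} t *\<^sub>R (1 / t :: real)) \<le> norm (?g t)"
      proof (cases "0 < t \<and> t \<le> 1")
        case True
        then have t: "t > 0" "t \<le> 1" by auto
        define \<Theta> where "\<Theta> = (\<Sum>\<^sub>\<infinity>k\<in>(int_lattice :: 'a set). exp (- 4 * pi\<^sup>2 * (norm k)\<^sup>2 * t))"
        \<comment> \<open>The term \<open>n = 0\<close> alone.\<close>
        have "1 \<le> (\<Sum>\<^sub>\<infinity>n\<in>(int_lattice :: 'a set). exp (- (norm (0 + n))\<^sup>2 / (4 * t)))"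
          using finite_sum_le_infsum[OF heat_transform(1)[OF t(1), of "0 :: 'a"], of "{0}"] by simp
        also have "\<dots> = (4 * pi * t) powr (s / 2) * \<Theta>"
        proof -
          have "(\<Sum>\<^sub>\<infinity>k\<in>(int_lattice :: 'a set). complex_of_real (exp (- 4 * pi\<^sup>2 * (norm k)\<^sup>2 * t))) = of_real \<Theta>"
            unfolding \<Theta>_def by (rule infsumI, rule has_sum_of_real, rule has_sum_infsum, rule heat_transform(2)[OF t(1)])
          then have "complex_of_real (\<Sum>\<^sub>\<infinity>n\<in>(int_lattice :: 'a set). exp (- (norm (0 + n))\<^sup>2 / (4 * t))) =
              of_real ((4 * pi * t) powr (s / 2) * \<Theta>)"
            using heat_transform(3)[OF t(1), of "0 :: 'a"] by (simp add: s_def)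
          then show ?thesis by (simp only: of_real_eq_iff)
        qed
        finally have 1: "1 \<le> (4 * pi * t) powr (s / 2) * \<Theta>" .
        have sumf: "(\<Sum>\<^sub>\<infinity>k\<in>int_lattice. ?f k t) = t powr (s / 2 - 1) * exp (- (\<kappa>\<^sup>2 * t)) * \<Theta>"
          unfolding eq \<Theta>_def infsum_cmult_right' using t by simp
        have "?g t = exp (\<kappa>\<^sup>2) * exp (- (\<kappa>\<^sup>2 * t)) * (((4 * pi * t) powr (s / 2) * \<Theta>) / t)"
        proof -
          have "(4 * pi * t) powr (s / 2) = (4 * pi) powr (s / 2) * t powr (s / 2)" using t by (simp add: powr_mult)
          moreover have "t powr (s / 2 - 1) = t powr (s / 2) / t" using t by (simp add: powr_diff)
          ultimately show ?thesis using sumf by (simp only:) (simp only: mult_ac times_divide_eq_right times_divide_eq_left)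
        qed
        moreover have "1 * (1 / t) \<le> exp (\<kappa>\<^sup>2) * exp (- (\<kappa>\<^sup>2 * t)) * (((4 * pi * t) powr (s / 2) * \<Theta>) / t)"
        proof (rule mult_mono)
          show "1 \<le> exp (\<kappa>\<^sup>2) * exp (- (\<kappa>\<^sup>2 * t))"
            using t by (simp add: exp_add[symmetric] mult_left_le)
          show "1 / t \<le> ((4 * pi * t) powr (s / 2) * \<Theta>) / t" using 1 t by (simp add: divide_right_mono)
        qed (use t in auto)
        ultimately have "1 / t \<le> ?g t" by (simp only: mult_1_left)
        also have "?g t \<le> norm (?g t)" unfolding real_norm_def by (rule abs_ge_self)
        finally have "1 / t \<le> norm (?g t)" .
        moreover have "norm (indicator {0<..1} t *\<^sub>R (1 / t :: real)) = 1 / t" using True by simp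
        ultimately show ?thesis by metis
      qed auto
    qed
  qed measurable
  then show False using not_integrable_inverse by blast
qed

text \<open>Since the weight is bounded below by \<kappa>, summability at a smaller exponent would
  imply it at the exponent d, which is excluded.\<close>

lemma weight_summable_iff:
  fixes \<kappa> s :: real
  assumes \<kappa>: "\<kappa> > 0"
  shows "(\<lambda>k::'a::euclidean_space. freq_weight \<kappa> k powr (- s)) summable_on int_lattice \<longleftrightarrow> s > real DIM('a)"
proof
  assume sm: "(\<lambda>k::'a. freq_weight \<kappa> k powr (- s)) summable_on int_lattice"
  show "s > real DIM('a)"
  proof (rule ccontr)
    assume "\<not> s > real DIM('a)"
    then have s: "s \<le> real DIM('a)" by simp
    have "(\<lambda>k::'a. \<kappa> powr (- (DIM('a) - s)) * freq_weight \<kappa> k powr (- s)) summable_on int_lattice"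
      by (intro summable_on_cmult_right sm)
    then have "(\<lambda>k::'a. freq_weight \<kappa> k powr (- real DIM('a))) summable_on int_lattice"
    proof (rule summable_on_comparison_test)
      fix k :: 'a
      have "freq_weight \<kappa> k powr (- real DIM('a)) = freq_weight \<kappa> k powr (- (DIM('a) - s)) * freq_weight \<kappa> k powr (- s)"
        by (simp add: powr_add[symmetric])
      also have "\<dots> \<le> \<kappa> powr (- (DIM('a) - s)) * freq_weight \<kappa> k powr (- s)"
        by (intro mult_right_mono powr_mono2') (use s \<kappa> freq_weight_ge[OF \<kappa>] in auto)
      finally show "freq_weight \<kappa> k powr (- real DIM('a)) \<le> \<kappa> powr (- (DIM('a) - s)) * freq_weight \<kappa> k powr (- s)" .
    qed simp
    then show False using not_weight_summable_DIM[OF \<kappa>, where 'a = 'a] by blast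
  qed
qed (rule weight_summable[OF \<kappa>])

section \<open>The Whittle--Matern covariance\<close>

text \<open>The Matern function as a mixture of Gaussians in \<open>r\<close>. Unlike the Bessel
  form it has no singular case at \<open>r = 0\<close>.\<close>

definition matern_integrand :: "real \<Rightarrow> real \<Rightarrow> real \<Rightarrow> real \<Rightarrow> real" where
  "matern_integrand \<nu> \<kappa> r t = indicator {0<..} t * (t powr (\<nu> - 1) * exp (- (\<kappa>\<^sup>2 * t) - r\<^sup>2 / (4 * t)))"

definition matern_integral :: "real \<Rightarrow> real \<Rightarrow> real \<Rightarrow> real" where
  "matern_integral \<nu> \<kappa> r = (\<integral>t. matern_integrand \<nu> \<kappa> r t \<partial>lborel)"

lemma matern_integrand_borel [measurable]: "matern_integrand \<nu> \<kappa> r \<in> borel_measurable borel"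
  unfolding matern_integrand_def by measurable

lemma matern_integrand_nonneg: "matern_integrand \<nu> \<kappa> r t \<ge> 0"
  by (simp add: matern_integrand_def)

text \<open>A majorant uniform in \<open>r\<close>; it gives both integrability and continuity at
  distance 0.\<close>

lemma matern_integrand_le: "matern_integrand \<nu> \<kappa> r t \<le> matern_integrand \<nu> \<kappa> 0 t"
  by (auto simp: matern_integrand_def indicator_def)

lemma matern_integrand_0:
  assumes "\<nu> > 0" "\<kappa> > 0"
  shows "has_bochner_integral lborel (matern_integrand \<nu> \<kappa> 0) (Gamma \<nu> * (\<kappa>\<^sup>2) powr (- \<nu>))"
  using gamma_kernel[of \<nu> "\<kappa>\<^sup>2"] assms by (simp add: matern_integrand_def[abs_def])

lemma matern_integrand_integrable:
  assumes "\<nu> > 0" "\<kappa> > 0"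
  shows "integrable lborel (matern_integrand \<nu> \<kappa> r)"
proof (rule Bochner_Integration.integrable_bound)
  show "integrable lborel (matern_integrand \<nu> \<kappa> 0)"
    using matern_integrand_0[OF assms] by (simp add: has_bochner_integral_iff)
qed (use matern_integrand_le matern_integrand_nonneg in auto)

lemma matern_integral_scale:
  assumes "\<nu> > 0" "\<kappa> > 0"
  shows "matern_integral \<nu> \<kappa> r = \<kappa> powr (- 2 * \<nu>) * matern_integral \<nu> 1 (\<kappa> * r)"
proof -
  have "matern_integral \<nu> 1 (\<kappa> * r) = \<bar>\<kappa>\<^sup>2\<bar> *\<^sub>R (\<integral>t. matern_integrand \<nu> 1 (\<kappa> * r) (0 + \<kappa>\<^sup>2 * t) \<partial>lborel)"
    unfolding matern_integral_def by (rule lborel_integral_real_affine) (use assms in simp)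
  also have "(\<lambda>t. matern_integrand \<nu> 1 (\<kappa> * r) (0 + \<kappa>\<^sup>2 * t)) = (\<lambda>t. (\<kappa>\<^sup>2) powr (\<nu> - 1) * matern_integrand \<nu> \<kappa> r t)"
  proof
    fix t
    show "matern_integrand \<nu> 1 (\<kappa> * r) (0 + \<kappa>\<^sup>2 * t) = (\<kappa>\<^sup>2) powr (\<nu> - 1) * matern_integrand \<nu> \<kappa> r t"
    proof (cases "t > 0")
      case True
      have "(\<kappa> * r)\<^sup>2 / (4 * (\<kappa>\<^sup>2 * t)) = r\<^sup>2 / (4 * t)" using assms by (simp add: power_mult_distrib)
      then show ?thesis using True assms by (simp add: matern_integrand_def powr_mult)
    qed (use assms in \<open>simp add: matern_integrand_def zero_less_mult_iff\<close>)
  qed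
  also have "\<bar>\<kappa>\<^sup>2\<bar> *\<^sub>R (\<integral>t. (\<kappa>\<^sup>2) powr (\<nu> - 1) * matern_integrand \<nu> \<kappa> r t \<partial>lborel) = (\<kappa>\<^sup>2) powr \<nu> * matern_integral \<nu> \<kappa> r"
    using assms by (simp add: matern_integral_def powr_diff)
  also have "(\<kappa>\<^sup>2) powr \<nu> = \<kappa> powr (2 * \<nu>)" using powr_powr[of \<kappa> 2 \<nu>] assms by simp
  finally show ?thesis using assms by (simp add: powr_minus)
qed

text \<open>The substitution gives an integral over the whole line with exp(\<nu> s); folding it at
  the origin gives the half-line integral with cosh(\<nu> s) that defines
  \<open>bessel_K\<close>.\<close>

lemma bessel_K_matern:
  assumes \<nu>: "\<nu> > 0" and z: "z > 0"
  shows "z powr \<nu> * bessel_K \<nu> z = 2 powr (\<nu> - 1) * matern_integral \<nu> 1 z"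
proof -
  let ?F = "\<lambda>t. t powr (\<nu> - 1) * exp (- t - z\<^sup>2 / (4 * t))"
  let ?g = "\<lambda>s. z / 2 * exp s"
  define \<phi> where "\<phi> s = exp (\<nu> * s - z * cosh s)" for s :: real
  define H where "H = matern_integral \<nu> 1 z"
  have intF: "set_integrable lborel {0<..} ?F"
    using matern_integrand_integrable[OF \<nu>, of 1 z] by (simp add: set_integrable_def matern_integrand_def[abs_def])
  \<comment> \<open>The change of variables theorem speaks of absolute integrability with respect to
    the completed measure.\<close>
  then have "set_integrable lebesgue {0<..} ?F"
    unfolding set_integrable_def by (subst integrable_completion) auto
  moreover have "integral {0<..} ?F = H"
    using set_borel_integral_eq_integral(2)[OF intF]
    by (simp add: H_def matern_integral_def set_lebesgue_integral_def matern_integrand_def[abs_def])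
  moreover have img: "?g ` UNIV = {0<..}"
  proof safe
    fix t :: real assume "t > 0"
    then have "t = ?g (ln (2 * t / z))" using z by simp
    then show "t \<in> range ?g" by blast
  qed (use z in simp)
  ultimately have "?F absolutely_integrable_on ?g ` UNIV \<and> integral (?g ` UNIV) ?F = H" by simp
  then have "(\<lambda>s. \<bar>?g s\<bar> * ?F (?g s)) absolutely_integrable_on UNIV \<and> integral UNIV (\<lambda>s. \<bar>?g s\<bar> * ?F (?g s)) = H"
    by (subst has_absolute_integral_change_of_variables_1'[where g = ?g])
      (use z in \<open>auto simp: inj_def intro!: derivative_eq_intros\<close>)
  moreover have "(\<lambda>s. \<bar>?g s\<bar> * ?F (?g s)) = (\<lambda>s. (z / 2) powr \<nu> * \<phi> s)"
  proof
    fix s :: real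
    have 1: "?g s * ?g s powr (\<nu> - 1) = (z / 2) powr \<nu> * exp (\<nu> * s)"
    proof -
      have "?g s * ?g s powr (\<nu> - 1) = ?g s powr \<nu>" using z by (simp add: powr_diff)
      also have "\<dots> = (z / 2) powr \<nu> * exp s powr \<nu>" using z by (intro powr_mult)
      finally show ?thesis by (simp add: powr_def mult.commute)
    qed
    have "z\<^sup>2 / (4 * ?g s) = z / 2 * exp (- s)" using z by (simp add: exp_minus power2_eq_square field_simps)
    \<comment> \<open>With t = (z/2) exp(s) the two terms t and z^2/(4t) add up to z
      cosh(s).\<close>
    then have "- ?g s - z\<^sup>2 / (4 * ?g s) = - (z * cosh s)"
      by (simp add: cosh_field_def algebra_simps)
    then have "\<bar>?g s\<bar> * ?F (?g s) = (?g s * ?g s powr (\<nu> - 1)) * exp (- (z * cosh s))" using z by simp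
    also have "\<dots> = (z / 2) powr \<nu> * \<phi> s"
      unfolding 1 \<phi>_def by (simp add: exp_add[symmetric] exp_diff exp_minus field_simps)
    finally show "\<bar>?g s\<bar> * ?F (?g s) = (z / 2) powr \<nu> * \<phi> s" .
  qed
  ultimately have "(\<lambda>s. (z / 2) powr \<nu> * \<phi> s) absolutely_integrable_on UNIV \<and>
    integral UNIV (\<lambda>s. (z / 2) powr \<nu> * \<phi> s) = H" by (simp only:)
  note \<phi> = conjunct1[OF this] conjunct2[OF this]
  have [measurable]: "\<phi> \<in> borel_measurable borel"
    unfolding \<phi>_def by (intro continuous_borel continuous_intros)
  have i1: "integrable lborel (\<lambda>s. (z / 2) powr \<nu> * \<phi> s)"
    using \<phi>(1) integrable_completion[of "\<lambda>s. (z / 2) powr \<nu> * \<phi> s" lborel] by (simp add: set_integrable_def)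
  then have i\<phi>: "integrable lborel \<phi>" using z by simp
  have "(\<integral>s. (z / 2) powr \<nu> * \<phi> s \<partial>lborel) = H"
    using integral_unique[OF has_integral_integral_lborel[OF i1]] \<phi>(2) by (simp only:)
  then have H: "H = (z / 2) powr \<nu> * (\<integral>s. \<phi> s \<partial>lborel)" by simp
  \<comment> \<open>The even part of \<open>\<phi>\<close>, with the same integral; being even, it
    integrates to twice its half-line integral.\<close>
  define \<psi> where "\<psi> s = exp (- z * cosh s) * cosh (\<nu> * s)" for s :: real
  have \<psi>: "\<psi> s = (\<phi> s + \<phi> (- s)) / 2" for s
    by (simp add: \<psi>_def \<phi>_def cosh_field_def[of "\<nu> * s"] exp_diff exp_minus field_simps)
  have hb: "has_bochner_integral lborel \<phi> (\<integral>s. \<phi> s \<partial>lborel)" using i\<phi> by (rule has_bochner_integral_integrable)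
  have "has_bochner_integral lborel (\<lambda>s. \<phi> (0 + -1 * s)) ((\<integral>s. \<phi> s \<partial>lborel) /\<^sub>R \<bar>-1\<bar>)"
    using hb by (subst (asm) lborel_has_bochner_integral_real_affine_iff[where c = "-1" and t = 0]) auto
  then have "has_bochner_integral lborel (\<lambda>s. (\<phi> s + \<phi> (- s)) / 2) (((\<integral>s. \<phi> s \<partial>lborel) + (\<integral>s. \<phi> s \<partial>lborel)) / 2)"
    by (intro has_bochner_integral_divide has_bochner_integral_add hb) simp
  then have h\<psi>: "has_bochner_integral lborel \<psi> (\<integral>s. \<phi> s \<partial>lborel)" unfolding \<psi>[symmetric] by simp
  have "integrable lborel (\<lambda>s. indicator {0..} s *\<^sub>R \<psi> s)"
    using h\<psi> by (intro integrable_mult_indicator) (auto simp: has_bochner_integral_iff)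
  then have "has_bochner_integral lborel \<psi> (2 *\<^sub>R (\<integral>s. indicator {0..} s *\<^sub>R \<psi> s \<partial>lborel))"
    by (intro has_bochner_integral_even_function has_bochner_integral_integrable) (simp_all add: \<psi>_def)
  then have "(\<integral>s. \<phi> s \<partial>lborel) = 2 * bessel_K \<nu> z"
    using has_bochner_integral_eq[OF h\<psi>] by (simp add: bessel_K_def set_lebesgue_integral_def \<psi>_def)
  then have "H = (z / 2) powr \<nu> * (2 * bessel_K \<nu> z)" using H by simp
  also have "\<dots> = 2 powr (1 - \<nu>) * (z powr \<nu> * bessel_K \<nu> z)" using z by (simp add: powr_divide powr_diff)
  finally have "H = 2 powr (1 - \<nu>) * (z powr \<nu> * bessel_K \<nu> z)" .
  moreover have "2 powr (\<nu> - 1) * 2 powr (1 - \<nu>) = (1::real)" by (simp add: powr_add[symmetric])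
  ultimately show ?thesis unfolding H_def[symmetric] by (metis mult.assoc mult_1)
qed

text \<open>Supplies the limit that defines the profile at 0, by domination with the integrand at
  \<open>r = 0\<close>.\<close>

lemma matern_integral_tendsto:
  assumes \<nu>: "\<nu> > 0"
  shows "((\<lambda>r. matern_integral \<nu> 1 r) \<longlongrightarrow> matern_integral \<nu> 1 0) (at_right 0)"
  unfolding tendsto_at_iff_sequentially
proof (intro allI impI)
  fix X :: "nat \<Rightarrow> real" assume X: "\<forall>i. X i \<in> {0<..} - {0}" "X \<longlonglongrightarrow> 0"
  have "(\<lambda>i. matern_integral \<nu> 1 (X i)) \<longlonglongrightarrow> matern_integral \<nu> 1 0"
    unfolding matern_integral_def
  proof (rule integral_dominated_convergence[where w = "matern_integrand \<nu> 1 0"])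
    show "integrable lborel (matern_integrand \<nu> 1 0)" using \<nu> by (simp add: matern_integrand_integrable)
    show "AE t in lborel. (\<lambda>i. matern_integrand \<nu> 1 (X i) t) \<longlonglongrightarrow> matern_integrand \<nu> 1 0 t"
    proof (rule AE_I2)
      fix t :: real
      show "(\<lambda>i. matern_integrand \<nu> 1 (X i) t) \<longlonglongrightarrow> matern_integrand \<nu> 1 0 t"
      proof (cases "t > 0")
        case True
        then show ?thesis unfolding matern_integrand_def by (intro tendsto_intros X) auto
      qed (simp add: matern_integrand_def)
    qed
  qed (use matern_integrand_le matern_integrand_nonneg in auto)
  then show "((\<lambda>r. matern_integral \<nu> 1 r) \<circ> X) \<longlonglongrightarrow> matern_integral \<nu> 1 0" by (simp add: o_def)
qed

text \<open>One formula including \<open>z = 0\<close>, which is needed because the periodised sum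
  meets distance 0 when x - y is a lattice vector.\<close>

lemma matern_profile_eq:
  assumes \<nu>: "\<nu> > 0" and z: "z \<ge> 0"
  shows "matern_profile \<nu> z = 2 powr (\<nu> - 1) * matern_integral \<nu> 1 z"
proof (cases "z = 0")
  case True
  have "((\<lambda>r. 2 powr (\<nu> - 1) * matern_integral \<nu> 1 r) \<longlongrightarrow> 2 powr (\<nu> - 1) * matern_integral \<nu> 1 0) (at_right 0)"
    by (intro tendsto_mult tendsto_const matern_integral_tendsto \<nu>)
  then have "((\<lambda>r. r powr \<nu> * bessel_K \<nu> r) \<longlongrightarrow> 2 powr (\<nu> - 1) * matern_integral \<nu> 1 0) (at_right 0)"
    by (rule Lim_transform_eventually) (auto simp: bessel_K_matern[OF \<nu>] eventually_at_right_less intro!: eventually_at_rightI[of 0 1])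
  then have "Lim (at_right 0) (\<lambda>r. r powr \<nu> * bessel_K \<nu> r) = 2 powr (\<nu> - 1) * matern_integral \<nu> 1 0"
    by (intro tendsto_Lim) auto
  then show ?thesis using True by (simp add: matern_profile_def)
next
  case False
  then show ?thesis using z bessel_K_matern[OF \<nu>, of z] by (simp add: matern_profile_def)
qed

lemma matern_profile_scaled:
  assumes "\<nu> > 0" "\<kappa> > 0" "r \<ge> 0"
  shows "matern_profile \<nu> (\<kappa> * r) = 2 powr (\<nu> - 1) * \<kappa> powr (2 * \<nu>) * matern_integral \<nu> \<kappa> r"
proof -
  have "\<kappa> powr (2 * \<nu>) * matern_integral \<nu> \<kappa> r = \<kappa> powr (2 * \<nu>) * \<kappa> powr (- 2 * \<nu>) * matern_integral \<nu> 1 (\<kappa> * r)"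
    by (subst matern_integral_scale) (use assms in simp_all)
  also have "\<kappa> powr (2 * \<nu>) * \<kappa> powr (- 2 * \<nu>) = 1" using assms by (simp add: powr_add[symmetric])
  finally have "\<kappa> powr (2 * \<nu>) * matern_integral \<nu> \<kappa> r = matern_integral \<nu> 1 (\<kappa> * r)" by simp
  then show ?thesis using assms by (simp add: matern_profile_eq)
qed

text \<open>The heat kernel identity is integrated against t^(s/2 - 1) exp(-\<kappa>^2 t) with s =
  2\<nu> + d; the prefactor t^(-d/2) lowers the exponent to \<nu> - 1, that of the Matern integral.
  Positivity of \<nu> puts s above the summability threshold, which justifies the interchange on the
  frequency side.\<close>

lemma matern_poisson:
  fixes x :: "'a::euclidean_space" and \<nu> \<kappa> :: real
  assumes \<nu>: "\<nu> > 0" and \<kappa>: "\<kappa> > 0"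
  shows "(\<lambda>n. matern_integral \<nu> \<kappa> (norm (x + n))) summable_on int_lattice"
    and "((\<lambda>k. of_real (freq_weight \<kappa> k powr (- (2 * \<nu> + DIM('a)))) * character k x) has_sum
      of_real ((4 * pi) powr (- (DIM('a) / 2)) / Gamma (\<nu> + DIM('a) / 2) *
        (\<Sum>\<^sub>\<infinity>n\<in>int_lattice. matern_integral \<nu> \<kappa> (norm (x + n))))) int_lattice"
proof -
  define d where "d = real DIM('a)"
  define s where "s = 2 * \<nu> + d"
  have s: "s > 0" "s > real DIM('a)" using \<nu> by (auto simp: s_def d_def)
  define A where "A = (4 * pi) powr (- (d / 2))"
  have A: "A > 0" by (simp add: A_def)
  let ?w = "\<lambda>k t. indicator {0<..} t * (t powr (s / 2 - 1) * exp (- ((freq_weight \<kappa> k)\<^sup>2 * t)))"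
  define f where "f k t = complex_of_real (?w k t) * character k x" for k t
  have hw: "has_bochner_integral lborel (?w k) (Gamma (s / 2) * freq_weight \<kappa> k powr (- s))" for k :: 'a
    by (rule weight_powr_integral[OF \<kappa> s(1)])
  have nf: "norm (f k t) = ?w k t" for k t by (simp add: f_def norm_mult abs_mult)
  have hf: "has_bochner_integral lborel (f k) (of_real (Gamma (s / 2) * freq_weight \<kappa> k powr (- s)) * character k x)" for k
    unfolding f_def using has_bochner_integral_mult_left[OF has_bochner_integral_of_real[OF hw]] by blast
  have pt: "(\<lambda>k. norm (f k t)) summable_on int_lattice" for t
  proof (cases "t > 0")
    case True
    have "?w k t = (t powr (s / 2 - 1) * exp (- (\<kappa>\<^sup>2 * t))) * exp (- 4 * pi\<^sup>2 * (norm k)\<^sup>2 * t)" for k :: 'a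
      using True by (simp only: exp_freq_weight) simp
    then show ?thesis unfolding nf by (simp only:) (intro summable_on_cmult_right heat_transform(2) True)
  qed (simp add: f_def)
  define Q where "Q t = (\<Sum>\<^sub>\<infinity>n\<in>(int_lattice :: 'a set). matern_integrand \<nu> \<kappa> (norm (x + n)) t)" for t
  have gQ: "((\<lambda>n. matern_integrand \<nu> \<kappa> (norm (x + n)) t) has_sum Q t) int_lattice" for t
  proof (cases "t > 0")
    case True
    have "matern_integrand \<nu> \<kappa> (norm (x + n)) t = (t powr (\<nu> - 1) * exp (- (\<kappa>\<^sup>2 * t))) * exp (- (norm (x + n))\<^sup>2 / (4 * t))" for n
      using True by (simp add: matern_integrand_def mult.assoc exp_add[symmetric])
    then have "(\<lambda>n. matern_integrand \<nu> \<kappa> (norm (x + n)) t) summable_on int_lattice"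
      by (simp only:) (intro summable_on_cmult_right heat_transform(1) True)
    then show ?thesis unfolding Q_def by (rule has_sum_infsum)
  qed (simp add: matern_integrand_def Q_def)
  have sumf: "(\<Sum>\<^sub>\<infinity>k\<in>int_lattice. f k t) = of_real (A * Q t)" for t
  proof (cases "t > 0")
    case True
    let ?c = "t powr (s / 2 - 1) * exp (- (\<kappa>\<^sup>2 * t))"
    have "f k t = of_real ?c * (of_real (exp (- 4 * pi\<^sup>2 * (norm k)\<^sup>2 * t)) * character k x)" for k
      unfolding f_def exp_freq_weight using True by (simp add: mult.assoc)
    then have "(\<Sum>\<^sub>\<infinity>k\<in>int_lattice. f k t) = of_real ?c * (\<Sum>\<^sub>\<infinity>k\<in>int_lattice. of_real (exp (- 4 * pi\<^sup>2 * (norm k)\<^sup>2 * t)) * character k x)"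
      by (simp only: infsum_cmult_right')
    also have "(\<Sum>\<^sub>\<infinity>k\<in>int_lattice. of_real (exp (- 4 * pi\<^sup>2 * (norm k)\<^sup>2 * t)) * character k x) =
        of_real ((4 * pi * t) powr (- (d / 2)) * (\<Sum>\<^sub>\<infinity>n\<in>int_lattice. exp (- (norm (x + n))\<^sup>2 / (4 * t))))"
      unfolding of_real_mult heat_transform(3)[OF True] d_def mult.assoc[symmetric] of_real_mult[symmetric] powr_add[symmetric]
      using True by simp
    also have "of_real ?c * complex_of_real ((4 * pi * t) powr (- (d / 2)) * (\<Sum>\<^sub>\<infinity>n\<in>int_lattice. exp (- (norm (x + n))\<^sup>2 / (4 * t)))) =
        of_real (?c * (4 * pi * t) powr (- (d / 2)) * (\<Sum>\<^sub>\<infinity>n\<in>int_lattice. exp (- (norm (x + n))\<^sup>2 / (4 * t))))"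
      by (simp only: of_real_mult mult.assoc)
    also have "?c * (4 * pi * t) powr (- (d / 2)) = A * (t powr (\<nu> - 1) * exp (- (\<kappa>\<^sup>2 * t)))"
    proof -
      have e1: "(4 * pi * t) powr (- (d / 2)) = A * t powr (- (d / 2))" using True by (simp add: A_def powr_mult)
      have e2: "t powr (s / 2 - 1) * t powr (- (d / 2)) = t powr (\<nu> - 1)"
        unfolding powr_add[symmetric]
        by (rule arg_cong[of _ _ "(powr) t"]) (simp add: s_def add_divide_distrib)
      show ?thesis unfolding e1 e2[symmetric] by (simp only: mult_ac)
    qed
    also have "A * (t powr (\<nu> - 1) * exp (- (\<kappa>\<^sup>2 * t))) * (\<Sum>\<^sub>\<infinity>n\<in>int_lattice. exp (- (norm (x + n))\<^sup>2 / (4 * t))) = A * Q t"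
      unfolding mult.assoc Q_def infsum_cmult_right'[symmetric]
      by (intro arg_cong[of _ _ "(*) A"] infsum_cong)
        (use True in \<open>simp add: matern_integrand_def mult.assoc exp_add[symmetric]\<close>)
    finally show ?thesis .
  qed (simp add: f_def Q_def matern_integrand_def)
  have sm: "(\<lambda>k. \<integral>t. norm (f k t) \<partial>lborel) summable_on int_lattice"
    unfolding nf has_bochner_integral_integral_eq[OF hw]
    by (intro summable_on_cmult_right weight_summable \<kappa> s)
  have int_f: "integrable lborel (f k)" for k using hf has_bochner_integral_iff by blast
  note sf = has_sum_integral[OF countable_int_lattice infinite_int_lattice int_f pt sm, unfolded sumf]
  \<comment> \<open>Integrability of the spatial sum is read off from the frequency side, where it
    is already known. As the spatial terms are nonnegative, it then bounds their partial sums and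
    justifies the second interchange.\<close>
  have "integrable lborel (\<lambda>t. A * Q t)" using integrable_Re[OF sf(2)] by simp
  then have iQ: "integrable lborel Q" using A by simp
  have ig: "integrable lborel (matern_integrand \<nu> \<kappa> (norm (x + n)))" for n
    by (rule matern_integrand_integrable[OF \<nu> \<kappa>])
  have ng: "norm (matern_integrand \<nu> \<kappa> r t) = matern_integrand \<nu> \<kappa> r t" for r t
    using matern_integrand_nonneg by simp
  have smg: "(\<lambda>n. matern_integral \<nu> \<kappa> (norm (x + n))) summable_on int_lattice"
  proof (rule summable_on_finite_sums_bound)
    fix F :: "'a set" assume F: "finite F" "F \<subseteq> int_lattice"
    have "(\<Sum>n\<in>F. matern_integral \<nu> \<kappa> (norm (x + n))) = (\<integral>t. (\<Sum>n\<in>F. matern_integrand \<nu> \<kappa> (norm (x + n)) t) \<partial>lborel)"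
      unfolding matern_integral_def using ig by (subst Bochner_Integration.integral_sum) auto
    also have "\<dots> \<le> (\<integral>t. Q t \<partial>lborel)"
    proof (rule integral_mono)
      show "(\<Sum>n\<in>F. matern_integrand \<nu> \<kappa> (norm (x + n)) t) \<le> Q t" for t
        by (rule has_sum_mono_neutral[OF has_sum_finite[OF F(1)] gQ]) (use F matern_integrand_nonneg in auto)
    qed (use ig iQ in auto)
    finally show "(\<Sum>n\<in>F. matern_integral \<nu> \<kappa> (norm (x + n))) \<le> (\<integral>t. Q t \<partial>lborel)" .
  qed (auto simp: matern_integral_def matern_integrand_nonneg)
  then show "(\<lambda>n. matern_integral \<nu> \<kappa> (norm (x + n))) summable_on int_lattice" .
  have "((\<lambda>n. \<integral>t. matern_integrand \<nu> \<kappa> (norm (x + n)) t \<partial>lborel) has_sum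
      (\<integral>t. (\<Sum>\<^sub>\<infinity>n\<in>int_lattice. matern_integrand \<nu> \<kappa> (norm (x + n)) t) \<partial>lborel)) int_lattice"
  proof (rule has_sum_integral(1))
    show "(\<lambda>n. norm (matern_integrand \<nu> \<kappa> (norm (x + n)) t)) summable_on int_lattice" for t
      unfolding ng using gQ has_sum_imp_summable by blast
    show "(\<lambda>n. \<integral>t. norm (matern_integrand \<nu> \<kappa> (norm (x + n)) t) \<partial>lborel) summable_on int_lattice"
      unfolding ng using smg by (simp only: matern_integral_def)
  qed (use ig in auto)
  then have Qint: "(\<Sum>\<^sub>\<infinity>n\<in>int_lattice. matern_integral \<nu> \<kappa> (norm (x + n))) = (\<integral>t. Q t \<partial>lborel)"
    unfolding Q_def[symmetric] matern_integral_def[symmetric] by (rule infsumI)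
  have G: "Gamma (s / 2) > 0" using s by (simp add: Gamma_real_pos)
  have "((\<lambda>k. of_real (Gamma (s / 2) * freq_weight \<kappa> k powr (- s)) * character k x) has_sum
      of_real (\<integral>t. A * Q t \<partial>lborel)) int_lattice"
    using sf(1) unfolding has_bochner_integral_integral_eq[OF hf] integral_complex_of_real .
  from has_sum_cmult_right[OF this, of "of_real (1 / Gamma (s / 2))"]
  have "((\<lambda>k. of_real (freq_weight \<kappa> k powr (- s)) * character k x) has_sum
      of_real (A / Gamma (s / 2) * (\<integral>t. Q t \<partial>lborel))) int_lattice"
    using G by (simp add: mult.assoc[symmetric])
  then show "((\<lambda>k. of_real (freq_weight \<kappa> k powr (- (2 * \<nu> + DIM('a)))) * character k x) has_sum
      of_real ((4 * pi) powr (- (DIM('a) / 2)) / Gamma (\<nu> + DIM('a) / 2) *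
        (\<Sum>\<^sub>\<infinity>n\<in>int_lattice. matern_integral \<nu> \<kappa> (norm (x + n))))) int_lattice"
    unfolding Qint by (simp add: A_def s_def d_def add_divide_distrib)
qed

section \<open>Fourier series of smooth functions\<close>

lemma summable_on_norm_compare:
  fixes f :: "'i \<Rightarrow> 'b::banach"
  assumes "g summable_on A" "\<And>i. i \<in> A \<Longrightarrow> norm (f i) \<le> g i"
  shows "(\<lambda>i. norm (f i)) summable_on A"
  by (rule summable_on_comparison_test[OF assms(1)]) (use assms(2) in auto)

lemma norm_infsum_le:
  fixes f :: "'i \<Rightarrow> 'b::banach"
  assumes "g summable_on A" "\<And>i. i \<in> A \<Longrightarrow> norm (f i) \<le> g i"
  shows "norm (infsum f A) \<le> infsum g A"
proof -
  note s = summable_on_norm_compare[OF assms]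
  have "norm (infsum f A) \<le> (\<Sum>\<^sub>\<infinity>i\<in>A. norm (f i))" by (rule norm_infsum_bound[OF s])
  also have "\<dots> \<le> infsum g A" by (rule infsum_mono[OF s assms])
  finally show ?thesis .
qed

lemma has_sum_minus:
  fixes f g :: "'i \<Rightarrow> 'b::real_normed_vector"
  assumes "(f has_sum a) A" "(g has_sum b) A"
  shows "((\<lambda>x. f x - g x) has_sum (a - b)) A"
proof -
  have "((\<lambda>x. - g x) has_sum - b) A" using assms(2) by (simp add: has_sum_uminus)
  from has_sum_add[OF assms(1) this] show ?thesis by simp
qed

text \<open>Decay faster than every power, measured by the weight rather than the norm so that the
  frequency 0 needs no exception.\<close>

definition rapid :: "real \<Rightarrow> ('a::euclidean_space \<Rightarrow> complex) \<Rightarrow> bool" where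
  "rapid \<kappa> a \<longleftrightarrow> (\<forall>s. \<exists>C. \<forall>k\<in>int_lattice. norm (a k) \<le> C * freq_weight \<kappa> k powr (- s))"

lemma rapidD:
  assumes "rapid \<kappa> a" "\<kappa> > 0"
  obtains C where "C \<ge> 0" "\<And>k. k \<in> int_lattice \<Longrightarrow> norm (a k) \<le> C * freq_weight \<kappa> k powr (- s)"
proof -
  obtain C where C: "\<And>k. k \<in> int_lattice \<Longrightarrow> norm (a k) \<le> C * freq_weight \<kappa> k powr (- s)"
    using assms unfolding rapid_def by blast
  have "norm (a k) \<le> \<bar>C\<bar> * freq_weight \<kappa> k powr (- s)" if "k \<in> int_lattice" for k
    by (rule order_trans[OF C[OF that]]) (auto intro!: mult_right_mono)
  then show ?thesis by (rule that[OF abs_ge_zero])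
qed

text \<open>Factors of polynomial growth are harmless; the instances are derivatives of characters
  and the symbol.\<close>

lemma rapid_mult:
  assumes a: "rapid \<kappa> a" and \<kappa>: "\<kappa> > 0"
    and w: "\<And>k. k \<in> int_lattice \<Longrightarrow> norm (w k) \<le> B * freq_weight \<kappa> k powr r"
  shows "rapid \<kappa> (\<lambda>k. w k * a k)"
  unfolding rapid_def
proof
  fix s
  obtain C where C: "C \<ge> 0" "\<And>k. k \<in> int_lattice \<Longrightarrow> norm (a k) \<le> C * freq_weight \<kappa> k powr (- (s + r))"
    using rapidD[OF a \<kappa>, of "s + r"] by blast
  show "\<exists>C. \<forall>k\<in>int_lattice. norm (w k * a k) \<le> C * freq_weight \<kappa> k powr (- s)"
  proof (intro exI ballI)
    fix k :: 'a assume k: "k \<in> int_lattice"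
    have "norm (w k * a k) \<le> (B * freq_weight \<kappa> k powr r) * (C * freq_weight \<kappa> k powr (- (s + r)))"
      unfolding norm_mult
      by (rule mult_mono[OF w[OF k] C(2)[OF k] order_trans[OF norm_ge_zero w[OF k]] norm_ge_zero])
    also have "\<dots> = (B * C) * freq_weight \<kappa> k powr (- s)"
    proof -
      have "freq_weight \<kappa> k powr r * freq_weight \<kappa> k powr (- (s + r)) = freq_weight \<kappa> k powr (- s)"
        using freq_weight_pos[OF \<kappa>, of k] by (simp add: powr_add[symmetric])
      then have "(B * C) * (freq_weight \<kappa> k powr r * freq_weight \<kappa> k powr (- (s + r))) = (B * C) * freq_weight \<kappa> k powr (- s)"
        by (simp only:)
      then show ?thesis by (simp only: mult_ac)
    qed
    finally show "norm (w k * a k) \<le> (B * C) * freq_weight \<kappa> k powr (- s)" .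
  qed
qed

lemma rapid_summable:
  fixes a :: "'a::euclidean_space \<Rightarrow> complex"
  assumes "rapid \<kappa> a" "\<kappa> > 0" shows "(\<lambda>k. norm (a k)) summable_on int_lattice"
proof -
  obtain C where C: "\<And>k. k \<in> int_lattice \<Longrightarrow> norm (a k) \<le> C * freq_weight \<kappa> k powr (- (real DIM('a) + 1))"
    using rapidD[OF assms, of "real DIM('a) + 1"] by blast
  have "(\<lambda>k::'a. C * freq_weight \<kappa> k powr (- (real DIM('a) + 1))) summable_on int_lattice"
    by (intro summable_on_cmult_right weight_summable assms(2)) simp
  then show ?thesis by (rule summable_on_norm_compare) (use C in auto)
qed

lemma inner_Basis_le_weight:
  assumes "b \<in> Basis"
  shows "\<bar>2 * pi * (k \<bullet> b)\<bar> \<le> freq_weight \<kappa> k"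
  unfolding freq_weight_def
proof (rule real_le_rsqrt)
  have "(2 * pi * (k \<bullet> b))\<^sup>2 = 4 * pi\<^sup>2 * \<bar>k \<bullet> b\<bar>\<^sup>2" by (simp add: power_mult_distrib)
  also have "\<dots> \<le> 4 * pi\<^sup>2 * (norm k)\<^sup>2"
    using Basis_le_norm[OF assms, of k] by (intro mult_left_mono power_mono) auto
  also have "\<dots> \<le> \<kappa>\<^sup>2 + 4 * pi\<^sup>2 * (norm k)\<^sup>2" by simp
  finally show "\<bar>2 * pi * (k \<bullet> b)\<bar>\<^sup>2 \<le> \<kappa>\<^sup>2 + 4 * pi\<^sup>2 * (norm k)\<^sup>2" by (simp only: power2_abs)
qed

definition deriv_factor :: "'a::euclidean_space \<Rightarrow> 'a \<Rightarrow> complex" where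
  "deriv_factor b k = 2 * of_real pi * \<i> * of_real (k \<bullet> b)"

lemma rapid_deriv:
  assumes "rapid \<kappa> a" "\<kappa> > 0" "b \<in> Basis"
  shows "rapid \<kappa> (\<lambda>k. deriv_factor b k * a k)"
proof (rule rapid_mult[OF assms(1,2)])
  show "norm (deriv_factor b k) \<le> 1 * freq_weight \<kappa> k powr 1" for k :: 'a
    using inner_Basis_le_weight[OF assms(3), of k \<kappa>] freq_weight_pos[OF assms(2), of k]
    by (simp add: deriv_factor_def norm_mult abs_mult)
qed

lemma has_sum_fourier_series:
  assumes "(\<lambda>k. norm (a k)) summable_on int_lattice"
  shows "((\<lambda>k. a k * character k x) has_sum fourier_series a x) int_lattice"
  unfolding fourier_series_def
  by (rule has_sum_infsum, rule abs_summable_summable) (simp add: norm_mult assms)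

text \<open>The second-order remainder of the exponential, uniform in \<open>x\<close>, with a
  majorant that remains summable against rapidly decaying coefficients.\<close>

lemma character_taylor:
  "norm (character k (x + t *\<^sub>R b) - character k x - t *\<^sub>R (deriv_factor b k * character k x)) \<le> t\<^sup>2 * (norm (deriv_factor b k))\<^sup>2"
proof -
  define \<theta> where "\<theta> = 2 * pi * (k \<bullet> b) * t"
  have 1: "character k (t *\<^sub>R b) = iexp \<theta>" by (simp add: character_def \<theta>_def mult_ac)
  have 2: "t *\<^sub>R deriv_factor b k = \<i> * \<theta>" by (simp add: deriv_factor_def \<theta>_def scaleR_conv_of_real)
  have "character k (x + t *\<^sub>R b) - character k x - t *\<^sub>R (deriv_factor b k * character k x) =
      character k x * (iexp \<theta> - 1 - \<i> * \<theta>)"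
    unfolding character_add 1 2[symmetric] by (simp add: algebra_simps)
  then have "norm (character k (x + t *\<^sub>R b) - character k x - t *\<^sub>R (deriv_factor b k * character k x)) = norm (iexp \<theta> - (\<Sum>j\<le>1. (\<i> * \<theta>) ^ j / fact j))"
    by (simp add: norm_mult diff_diff_eq)
  also have "\<dots> \<le> \<bar>\<theta>\<bar> ^ Suc 1 / fact (Suc 1)" by (rule iexp_approx1)
  also have "\<dots> \<le> \<bar>\<theta>\<bar>\<^sup>2" by (simp add: numeral_2_eq_2)
  also have "\<bar>\<theta>\<bar> = \<bar>t\<bar> * norm (deriv_factor b k)" by (simp add: \<theta>_def deriv_factor_def norm_mult abs_mult)
  finally show ?thesis by (simp add: power_mult_distrib)
qed

text \<open>Summing the Taylor remainders of the characters gives a total error of order t^2, with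
  constant the sum of the coefficients of the second derivative.\<close>

lemma dir_deriv_fourier_series:
  fixes a :: "'a::euclidean_space \<Rightarrow> complex"
  assumes a: "rapid \<kappa> a" and \<kappa>: "\<kappa> > 0" and b: "b \<in> Basis"
  shows "dir_deriv b (fourier_series a) (fourier_series (\<lambda>k. deriv_factor b k * a k))"
  unfolding dir_deriv_def
proof
  fix x :: 'a
  let ?w = "deriv_factor b"
  note s0 = rapid_summable[OF a \<kappa>]
  note s1 = rapid_summable[OF rapid_deriv[OF a \<kappa> b] \<kappa>]
  note s2 = rapid_summable[OF rapid_deriv[OF rapid_deriv[OF a \<kappa> b] \<kappa> b] \<kappa>]
  let ?S = "fourier_series a" and ?S' = "fourier_series (\<lambda>k. ?w k * a k)"
  define K where "K = (\<Sum>\<^sub>\<infinity>k\<in>int_lattice. norm (?w k * (?w k * a k)))"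
  have bound: "norm (?S (x + t *\<^sub>R b) - ?S x - t *\<^sub>R ?S' x) \<le> t\<^sup>2 * K" for t
  proof -
    have "((\<lambda>k. a k * character k (x + t *\<^sub>R b) - a k * character k x - t *\<^sub>R (?w k * a k * character k x)) has_sum
        (?S (x + t *\<^sub>R b) - ?S x - t *\<^sub>R ?S' x)) int_lattice"
      by (intro has_sum_minus has_sum_scaleR has_sum_fourier_series s0 s1)
    then have "?S (x + t *\<^sub>R b) - ?S x - t *\<^sub>R ?S' x =
        (\<Sum>\<^sub>\<infinity>k\<in>int_lattice. a k * character k (x + t *\<^sub>R b) - a k * character k x - t *\<^sub>R (?w k * a k * character k x))"
      by (rule infsumI[symmetric])
    also have "norm \<dots> \<le> (\<Sum>\<^sub>\<infinity>k\<in>int_lattice. t\<^sup>2 * norm (?w k * (?w k * a k)))"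
    proof (rule norm_infsum_le)
      show "(\<lambda>k. t\<^sup>2 * norm (?w k * (?w k * a k))) summable_on int_lattice" by (intro summable_on_cmult_right s2)
      fix k :: 'a
      have "a k * character k (x + t *\<^sub>R b) - a k * character k x - t *\<^sub>R (?w k * a k * character k x) =
          a k * (character k (x + t *\<^sub>R b) - character k x - t *\<^sub>R (?w k * character k x))"
        by (simp add: algebra_simps)
      also have "norm \<dots> \<le> norm (a k) * (t\<^sup>2 * (norm (?w k))\<^sup>2)"
        unfolding norm_mult by (intro mult_left_mono character_taylor) auto
      finally show "norm (a k * character k (x + t *\<^sub>R b) - a k * character k x - t *\<^sub>R (?w k * a k * character k x)) \<le>
          t\<^sup>2 * norm (?w k * (?w k * a k))" by (simp add: norm_mult power2_eq_square mult_ac)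
    qed
    also have "\<dots> = t\<^sup>2 * K" unfolding K_def by (rule infsum_cmult_right')
    finally show ?thesis .
  qed
  have "((\<lambda>t. norm (?S (x + t *\<^sub>R b) - ?S x - t *\<^sub>R ?S' x) / norm t) \<longlongrightarrow> 0) (at 0)"
  proof (rule tendsto_sandwich[where f = "\<lambda>_. 0" and h = "\<lambda>t. \<bar>t\<bar> * K"])
    show "\<forall>\<^sub>F t in at 0. norm (?S (x + t *\<^sub>R b) - ?S x - t *\<^sub>R ?S' x) / norm t \<le> \<bar>t\<bar> * K"
    proof (rule eventually_at_topological[THEN iffD2], intro exI[of _ UNIV] conjI ballI impI)
      fix t :: real assume "t \<noteq> 0"
      then show "norm (?S (x + t *\<^sub>R b) - ?S x - t *\<^sub>R ?S' x) / norm t \<le> \<bar>t\<bar> * K"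
        using divide_right_mono[OF bound[of t], of "\<bar>t\<bar>"] by (simp add: power2_eq_square abs_mult_self_eq[of t, symmetric] del: abs_mult_self_eq)
    qed auto
    show "((\<lambda>t::real. \<bar>t\<bar> * K) \<longlongrightarrow> 0) (at 0)"
      by (intro tendsto_mult_left_zero tendsto_rabs_zero tendsto_ident_at)
  qed auto
  then show "((\<lambda>t. ?S (x + t *\<^sub>R b)) has_vector_derivative ?S' x) (at 0)"
    by (simp add: has_vector_derivative_def has_derivative_at bounded_linear_scaleR_left)
qed

lemma fourier_series_smooth:
  assumes "rapid \<kappa> a" and \<kappa>: "\<kappa> > 0"
  shows "fourier_series a \<in> torus_smooth"
proof -
  have "Ck n (fourier_series a)" for n
    using assms(1)
  proof (induction n arbitrary: a)
    case 0
    then show ?case by (simp add: fourier_series_periodic fourier_series_continuous rapid_summable[OF _ \<kappa>])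
  next
    case (Suc n)
    show ?case
      by (rule Ck_SucI[OF _ _ dir_deriv_fourier_series[OF Suc.prems \<kappa>]])
        (use Suc in \<open>auto simp: fourier_series_periodic fourier_series_continuous rapid_summable[OF _ \<kappa>]
          intro: rapid_deriv[OF _ \<kappa>]\<close>)
  qed
  then show ?thesis by (simp add: torus_smooth_iff)
qed

text \<open>With order function 0 the exponential is 1 for every \<open>c\<close>, so ordinary
  Fourier coefficients inherit all estimates for \<open>osc_coeff\<close>.\<close>

lemma fourier_coeff_osc: "fourier_coeff f k = osc_coeff (\<lambda>_. 0) c k f"
  by (simp add: fourier_coeff_alt osc_coeff_def)

lemma osc_coeff_rapid:
  fixes g :: "'a::euclidean_space \<Rightarrow> complex"
  assumes g: "g \<in> torus_smooth" and \<kappa>: "\<kappa> > 0" and \<phi>: "\<phi> \<in> torus_smooth"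
  shows "rapid \<kappa> (\<lambda>k. osc_coeff g (ln (freq_weight \<kappa> k)) k \<phi>)"
  unfolding rapid_def
proof
  fix s
  obtain N C where C0: "C \<ge> 0" and C: "\<And>\<phi> P (k::'a) K. \<phi> \<in> torus_smooth \<Longrightarrow> deriv_bound N P \<phi> \<Longrightarrow> K \<in> int_lattice \<Longrightarrow>
      (\<And>b. b \<in> Basis \<Longrightarrow> \<exists>b'\<in>Basis. \<bar>k \<bullet> b\<bar> = \<bar>K \<bullet> b'\<bar>) \<Longrightarrow>
      norm (osc_coeff g (ln (freq_weight \<kappa> k)) K \<phi>) \<le> C * P * freq_weight \<kappa> k powr (- s)"
    by (rule osc_coeff_decay[OF g \<kappa>, of s, where 'a = 'a]) blast
  obtain P where P: "deriv_bound N P \<phi>" using deriv_bound_exists \<phi> torus_smooth_iff by blast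
  show "\<exists>C. \<forall>k\<in>int_lattice. norm (osc_coeff g (ln (freq_weight \<kappa> k)) k \<phi>) \<le> C * freq_weight \<kappa> k powr (- s)"
  proof (intro exI ballI)
    fix k :: 'a assume "k \<in> int_lattice"
    then show "norm (osc_coeff g (ln (freq_weight \<kappa> k)) k \<phi>) \<le> (C * P) * freq_weight \<kappa> k powr (- s)"
      by (intro C \<phi> P) auto
  qed
qed

lemma fourier_coeff_rapid:
  assumes "f \<in> torus_smooth" "\<kappa> > 0"
  shows "rapid \<kappa> (fourier_coeff f)"
  using osc_coeff_rapid[OF torus_smooth_const[of 0] assms(2,1)] by (simp add: fourier_coeff_osc[symmetric])

lemma smooth_has_sum:
  assumes "f \<in> torus_smooth"
  shows "((\<lambda>k. fourier_coeff f k * character k x) has_sum f x) int_lattice"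
proof -
  have s: "(\<lambda>k. norm (fourier_coeff f k)) summable_on int_lattice"
    by (rule rapid_summable[OF fourier_coeff_rapid[OF assms, of 1]]) auto
  show ?thesis
    unfolding fourier_inversion[OF torus_smoothD(1,2)[OF assms] s, of x] by (rule has_sum_fourier_series[OF s])
qed

lemma fourier_coeff_partial:
  assumes f: "f \<in> torus_smooth" and "b \<in> Basis" "k \<in> int_lattice"
  shows "fourier_coeff (partial_deriv b f) k = deriv_factor b k * fourier_coeff f k"
proof -
  have "deriv_factor b k * osc_coeff (\<lambda>_. 0) 0 k f =
      osc_coeff (\<lambda>_. 0) 0 k (\<lambda>x. partial_deriv b f x + (- of_real 0 * partial_deriv b (\<lambda>_. 0) x) * f x)"
    unfolding deriv_factor_def
    by (rule osc_coeff_by_parts) (use assms in \<open>auto simp: torus_smooth_iff Ck_const simp del: Ck.simps\<close>)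
  then show ?thesis by (simp add: fourier_coeff_osc[of _ _ 0])
qed

text \<open>At order 0 the error is at most the tail of the absolutely convergent coefficient sum.
  For higher orders, differentiating a partial sum gives the partial sum of the derivative, since
  the derivative multiplies coefficients by \<open>deriv_factor\<close>.\<close>

lemma fourier_partial_sums_converge:
  fixes f :: "'a::euclidean_space \<Rightarrow> complex"
  assumes "f \<in> torus_smooth" "e > 0"
  shows "\<forall>\<^sub>F A in finite_subsets_at_top int_lattice.
    deriv_bound n e (\<lambda>x. (\<Sum>k\<in>A. fourier_coeff f k * character k x) - f x)"
  using assms(1)
proof (induction n arbitrary: f)
  case (0 f)
  define a where "a = fourier_coeff f"
  have s: "(\<lambda>k. norm (a k)) summable_on int_lattice"
    unfolding a_def by (rule rapid_summable[OF fourier_coeff_rapid[OF 0, of 1]]) auto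
  define T where "T = (\<Sum>\<^sub>\<infinity>k\<in>int_lattice. norm (a k))"
  have "((\<lambda>k. norm (a k)) has_sum T) int_lattice" unfolding T_def by (rule has_sum_infsum[OF s])
  then have "\<forall>\<^sub>F A in finite_subsets_at_top int_lattice. dist (\<Sum>k\<in>A. norm (a k)) T < e"
    unfolding has_sum_def using tendstoD assms(2) by blast
  moreover have "\<forall>\<^sub>F A in finite_subsets_at_top (int_lattice :: 'a set). finite A \<and> A \<subseteq> int_lattice"
    by (rule eventually_finite_subsets_at_top_weakI) auto
  ultimately show ?case
  proof eventually_elim
    case (elim A)
    have "norm ((\<Sum>k\<in>A. a k * character k x) - f x) \<le> e" for x
    proof -
      have fs: "(\<lambda>k. a k * character k x) summable_on int_lattice" "f x = (\<Sum>\<^sub>\<infinity>k\<in>int_lattice. a k * character k x)"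
        using smooth_has_sum[OF 0, of x] by (auto simp: a_def has_sum_imp_summable infsumI)
      have "(\<Sum>\<^sub>\<infinity>k\<in>int_lattice - A. a k * character k x) = f x - (\<Sum>k\<in>A. a k * character k x)"
        using infsum_Diff[OF fs(1), of A] elim fs(2) by simp
      then have "norm ((\<Sum>k\<in>A. a k * character k x) - f x) = norm (\<Sum>\<^sub>\<infinity>k\<in>int_lattice - A. a k * character k x)"
        by (simp add: norm_minus_commute)
      also have "\<dots> \<le> (\<Sum>\<^sub>\<infinity>k\<in>int_lattice - A. norm (a k))"
        by (rule norm_infsum_le) (auto intro: summable_on_subset_banach[OF s] simp: norm_mult)
      also have "\<dots> = T - (\<Sum>k\<in>A. norm (a k))"
        using infsum_Diff[OF s, of A] elim by (simp add: T_def)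
      also have "\<dots> \<le> e" using elim by (auto simp: dist_real_def)
      finally show ?thesis .
    qed
    then show ?case by (simp add: a_def)
  qed
next
  case (Suc n f)
  have "\<forall>\<^sub>F A in finite_subsets_at_top int_lattice. \<forall>b\<in>Basis.
      deriv_bound n e (\<lambda>x. (\<Sum>k\<in>A. fourier_coeff (partial_deriv b f) k * character k x) - partial_deriv b f x)"
    by (intro eventually_ball_finite finite_Basis ballI Suc.IH torus_smoothD(4)[OF Suc.prems])
  moreover have "\<forall>\<^sub>F A in finite_subsets_at_top int_lattice.
      deriv_bound n e (\<lambda>x. (\<Sum>k\<in>A. fourier_coeff f k * character k x) - f x)"
    by (rule Suc.IH[OF Suc.prems])
  moreover have "\<forall>\<^sub>F A in finite_subsets_at_top (int_lattice :: 'a set). finite A \<and> A \<subseteq> int_lattice"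
    by (rule eventually_finite_subsets_at_top_weakI) auto
  ultimately show ?case
  proof eventually_elim
    case (elim A)
    have "partial_deriv b (\<lambda>x. (\<Sum>k\<in>A. fourier_coeff f k * character k x) - f x) =
        (\<lambda>x. (\<Sum>k\<in>A. fourier_coeff (partial_deriv b f) k * character k x) - partial_deriv b f x)" if b: "b \<in> Basis" for b
    proof (rule dir_deriv_partial)
      have "dir_deriv b (\<lambda>x. \<Sum>k\<in>A. fourier_coeff f k * character k x)
          (\<lambda>x. \<Sum>k\<in>A. fourier_coeff f k * (deriv_factor b k * character k x))"
        unfolding dir_deriv_def deriv_factor_def
        by (intro allI has_vector_derivative_sum has_vector_derivative_mult_right
            dir_deriv_character[unfolded dir_deriv_def, rule_format])
      moreover have "fourier_coeff f k * (deriv_factor b k * character k x) = fourier_coeff (partial_deriv b f) k * character k x"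
        if "k \<in> A" for k x
      proof -
        have "k \<in> int_lattice" using that elim by blast
        then show ?thesis using fourier_coeff_partial[OF Suc.prems b] by (simp add: mult_ac)
      qed
      ultimately have "dir_deriv b (\<lambda>x. \<Sum>k\<in>A. fourier_coeff f k * character k x)
          (\<lambda>x. \<Sum>k\<in>A. fourier_coeff (partial_deriv b f) k * character k x)"
        by simp
      moreover have "dir_deriv b f (partial_deriv b f)" by (rule torus_smoothD(3)[OF Suc.prems b])
      ultimately show "dir_deriv b (\<lambda>x. (\<Sum>k\<in>A. fourier_coeff f k * character k x) - f x)
          (\<lambda>x. (\<Sum>k\<in>A. fourier_coeff (partial_deriv b f) k * character k x) - partial_deriv b f x)"
        unfolding dir_deriv_def by (auto intro!: has_vector_derivative_diff)
    qed
    then show ?case using elim deriv_bound_norm by auto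
  qed
qed

section \<open>The adjoint operator\<close>

lemma torus_integral_cnj:
  assumes "continuous_on UNIV f"
  shows "torus_integral (\<lambda>x. cnj (f x)) = cnj (torus_integral f)"
proof -
  have [measurable]: "f \<in> borel_measurable borel" using assms by (rule continuous_borel)
  have "(\<lambda>x. cnj (f x)) \<in> borel_measurable borel" by (intro continuous_borel continuous_intros assms)
  then show ?thesis by (simp add: torus_integral_eq)
qed

lemma mem_unit_cbox: "x \<in> cbox 0 One \<longleftrightarrow> (\<forall>b\<in>Basis. 0 \<le> x \<bullet> b \<and> x \<bullet> b \<le> 1)"
  by (simp add: mem_box)

lemma torus_integral_prod:
  fixes f :: "'a::euclidean_space \<Rightarrow> complex" and g :: "'b::euclidean_space \<Rightarrow> complex"
  assumes f: "continuous_on UNIV f" and g: "continuous_on UNIV g"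
  shows "torus_integral (\<lambda>z. f (fst z) * g (snd z)) = torus_integral f * torus_integral g"
proof -
  define F where "F x = indicator (cbox 0 One) x *\<^sub>R f x" for x
  define G where "G y = indicator (cbox 0 One) y *\<^sub>R g y" for y
  have iF: "integrable lborel F" and iG: "integrable lborel G"
    unfolding F_def G_def
    by (intro borel_integrable_compact compact_cbox continuous_on_subset[OF f] continuous_on_subset[OF g] subset_UNIV)+
  have [measurable]: "F \<in> borel_measurable borel" "G \<in> borel_measurable borel" using iF iG by auto
  have ind: "indicator (cbox 0 One) z = (indicator (cbox 0 One) (fst z) * indicator (cbox 0 One) (snd z) :: real)" for z :: "'a \<times> 'b"
  proof -
    have "(\<forall>b\<in>Basis. 0 \<le> z \<bullet> b \<and> z \<bullet> b \<le> 1) \<longleftrightarrow>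
        (\<forall>b\<in>Basis. 0 \<le> fst z \<bullet> b \<and> fst z \<bullet> b \<le> 1) \<and> (\<forall>b\<in>Basis. 0 \<le> snd z \<bullet> b \<and> snd z \<bullet> b \<le> 1)"
      by (cases z) (simp add: Basis_prod_def ball_Un)
    then have "z \<in> cbox 0 One \<longleftrightarrow> fst z \<in> cbox 0 One \<and> snd z \<in> cbox 0 One"
      unfolding mem_unit_cbox .
    then show ?thesis by (simp add: indicator_def)
  qed
  have i: "integrable (lborel \<Otimes>\<^sub>M lborel) (\<lambda>z. F (fst z) * G (snd z))"
  proof (rule lborel_pair.Fubini_integrable)
    have "integrable lborel (\<lambda>x. norm (F x) * (\<integral>y. norm (G y) \<partial>lborel))" using iF by simp
    then show "integrable lborel (\<lambda>x. \<integral>y. norm (F (fst (x, y)) * G (snd (x, y))) \<partial>lborel)" by (simp add: norm_mult)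
    show "AE x in lborel. integrable lborel (\<lambda>y. F (fst (x, y)) * G (snd (x, y)))" using iG by simp
  qed measurable
  have "torus_integral (\<lambda>z. f (fst z) * g (snd z)) = (\<integral>z. F (fst z) * G (snd z) \<partial>lborel)"
    unfolding torus_integral_def set_lebesgue_integral_def ind F_def G_def
    by (intro Bochner_Integration.integral_cong) (auto simp: scaleR_conv_of_real)
  also have "\<dots> = (\<integral>z. F (fst z) * G (snd z) \<partial>(lborel \<Otimes>\<^sub>M lborel))" by (simp only: lborel_prod)
  also have "\<dots> = (\<integral>x. (\<integral>y. F x * G y \<partial>lborel) \<partial>lborel)"
    using lborel_pair.integral_fst'[OF i] by simp
  also have "\<dots> = (\<integral>x. F x \<partial>lborel) * (\<integral>y. G y \<partial>lborel)" by simp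
  finally show ?thesis by (simp add: torus_integral_def set_lebesgue_integral_def F_def G_def)
qed

lemma matern_symbol_exp:
  assumes "\<kappa> > 0"
  shows "matern_symbol \<kappa> m x k = exp (- (of_real (ln (freq_weight \<kappa> k)) * of_real (m x)))"
proof -
  have "freq_weight \<kappa> k powr (- m x) = exp (- (ln (freq_weight \<kappa> k) * m x))"
    using freq_weight_pos[OF assms, of k] by (simp add: powr_def mult.commute)
  then show ?thesis by (simp add: matern_symbol_def exp_of_real[symmetric])
qed

text \<open>The Fourier coefficients that the adjoint must have: testing \<open>Op\<close> on the
  character of \<open>k\<close> pairs \<open>\<phi>\<close> with symbol times character, and the
  symbol is real.\<close>

definition adj_coeff :: "real \<Rightarrow> ('a::euclidean_space \<Rightarrow> real) \<Rightarrow> ('a \<Rightarrow> complex) \<Rightarrow> 'a \<Rightarrow> complex" where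
  "adj_coeff \<kappa> m \<phi> k = torus_integral (\<lambda>x. matern_symbol \<kappa> m x k * \<phi> x * cnj (character k x))"

definition matern_adjoint :: "real \<Rightarrow> ('a::euclidean_space \<Rightarrow> real) \<Rightarrow> ('a \<Rightarrow> complex) \<Rightarrow> 'a \<Rightarrow> complex" where
  "matern_adjoint \<kappa> m \<phi> = fourier_series (adj_coeff \<kappa> m \<phi>)"

lemma exp_abs_ln_weight_le:
  assumes \<kappa>: "\<kappa> > 0" and G: "G \<ge> 0"
  shows "exp (\<bar>ln (freq_weight \<kappa> k)\<bar> * G) \<le> (max 1 (1 / \<kappa>\<^sup>2)) powr G * freq_weight \<kappa> k powr G"
proof -
  have "exp (\<bar>ln (freq_weight \<kappa> k)\<bar> * G) = exp \<bar>ln (freq_weight \<kappa> k)\<bar> powr G" by (simp add: powr_def mult.commute)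
  also have "\<dots> \<le> (max 1 (1 / \<kappa>\<^sup>2) * freq_weight \<kappa> k) powr G"
    using exp_abs_ln_le[OF \<kappa> freq_weight_ge[OF \<kappa>], of k] G by (intro powr_mono2) auto
  also have "\<dots> = (max 1 (1 / \<kappa>\<^sup>2)) powr G * freq_weight \<kappa> k powr G"
    using freq_weight_pos[OF \<kappa>, of k] by (intro powr_mult)
  finally show ?thesis .
qed

locale matern_order =
  fixes \<kappa> :: real and m :: "'a::euclidean_space \<Rightarrow> real"
  assumes \<kappa>: "\<kappa> > 0" and m: "m \<in> torus_smooth"
begin

abbreviation "weight \<equiv> freq_weight \<kappa>"

definition order_fun :: "'a \<Rightarrow> complex" where "order_fun x = of_real (m x)"

lemma order_fun_smooth: "order_fun \<in> torus_smooth"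
  unfolding order_fun_def[abs_def] by (rule torus_smooth_of_real[OF m])

lemma symbol_eq: "matern_symbol \<kappa> m x k = exp (- (of_real (ln (weight k)) * order_fun x))"
  unfolding order_fun_def by (rule matern_symbol_exp[OF \<kappa>])

lemma symbol_periodic: "periodic (\<lambda>x. matern_symbol \<kappa> m x k)"
  using torus_smoothD(1)[OF m] by (simp add: periodic_def matern_symbol_def)

lemma symbol_continuous: "continuous_on UNIV (\<lambda>x. matern_symbol \<kappa> m x k)"
  unfolding symbol_eq using torus_smoothD(2)[OF order_fun_smooth] by (intro continuous_intros)

text \<open>For negative orders the symbol grows, but only polynomially, which rapidly decaying
  Fourier coefficients absorb.\<close>

lemma symbol_bound:
  obtains B G where "\<And>x k. norm (matern_symbol \<kappa> m x k) \<le> B * weight k powr G"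
proof -
  obtain G where G: "G \<ge> 0" "\<And>x. norm (order_fun x) \<le> G"
    using periodic_bounded[OF torus_smoothD(1,2)[OF order_fun_smooth]] by blast
  have "norm (matern_symbol \<kappa> m x k) \<le> (max 1 (1 / \<kappa>\<^sup>2)) powr G * weight k powr G" for x k
    unfolding symbol_eq by (rule order_trans[OF norm_exp_le[OF G(2)] exp_abs_ln_weight_le[OF \<kappa> G(1)]])
  then show ?thesis by (rule that)
qed

lemma adj_coeff_osc: "adj_coeff \<kappa> m \<phi> k = osc_coeff order_fun (ln (weight k)) k \<phi>"
  by (simp add: adj_coeff_def osc_coeff_def symbol_eq)

lemma adj_coeff_rapid: "\<phi> \<in> torus_smooth \<Longrightarrow> rapid \<kappa> (adj_coeff \<kappa> m \<phi>)"
  unfolding adj_coeff_osc[abs_def] by (rule osc_coeff_rapid[OF order_fun_smooth \<kappa>])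

lemma adj_coeff_summable: "\<phi> \<in> torus_smooth \<Longrightarrow> (\<lambda>k. norm (adj_coeff \<kappa> m \<phi> k)) summable_on int_lattice"
  by (rule rapid_summable[OF adj_coeff_rapid \<kappa>])

lemma adj_smooth: "\<phi> \<in> torus_smooth \<Longrightarrow> matern_adjoint \<kappa> m \<phi> \<in> torus_smooth"
  unfolding matern_adjoint_def by (rule fourier_series_smooth[OF adj_coeff_rapid \<kappa>])

lemma adj_fourier_coeff:
  "\<phi> \<in> torus_smooth \<Longrightarrow> k \<in> int_lattice \<Longrightarrow> fourier_coeff (matern_adjoint \<kappa> m \<phi>) k = adj_coeff \<kappa> m \<phi> k"
  unfolding matern_adjoint_def by (rule fourier_coeff_series[OF adj_coeff_summable])

lemma adj_coeff_lincomb: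
  assumes "\<phi> \<in> torus_smooth" "\<psi> \<in> torus_smooth" "k \<in> int_lattice"
  shows "adj_coeff \<kappa> m (\<lambda>x. a * \<phi> x + b * \<psi> x) k = a * adj_coeff \<kappa> m \<phi> k + b * adj_coeff \<kappa> m \<psi> k"
proof -
  note c = torus_smoothD(2)[OF assms(1)] torus_smoothD(2)[OF assms(2)] symbol_continuous
  note p = torus_smoothD(1)[OF assms(1)] torus_smoothD(1)[OF assms(2)] symbol_periodic periodic_character[OF assms(3)]
  have "adj_coeff \<kappa> m (\<lambda>x. a * \<phi> x + b * \<psi> x) k =
      torus_integral (\<lambda>x. a * (matern_symbol \<kappa> m x k * \<phi> x * cnj (character k x)) + b * (matern_symbol \<kappa> m x k * \<psi> x * cnj (character k x)))"
    by (simp add: adj_coeff_def algebra_simps)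
  also have "\<dots> = torus_integral (\<lambda>x. a * (matern_symbol \<kappa> m x k * \<phi> x * cnj (character k x))) +
      torus_integral (\<lambda>x. b * (matern_symbol \<kappa> m x k * \<psi> x * cnj (character k x)))"
    using p by (intro torus_integral_add continuous_intros c) (simp_all add: periodic_def)
  finally show ?thesis
    unfolding adj_coeff_def by (subst (asm) (1 2) torus_integral_cmult) (intro continuous_intros c)+
qed

lemma adj_lincomb:
  assumes "\<phi> \<in> torus_smooth" "\<psi> \<in> torus_smooth"
  shows "matern_adjoint \<kappa> m (\<lambda>x. a * \<phi> x + b * \<psi> x) = (\<lambda>x. a * matern_adjoint \<kappa> m \<phi> x + b * matern_adjoint \<kappa> m \<psi> x)"
proof
  fix x
  have "((\<lambda>k. a * (adj_coeff \<kappa> m \<phi> k * character k x) + b * (adj_coeff \<kappa> m \<psi> k * character k x)) has_sum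
      (a * matern_adjoint \<kappa> m \<phi> x + b * matern_adjoint \<kappa> m \<psi> x)) int_lattice"
    unfolding matern_adjoint_def
    by (intro has_sum_add has_sum_cmult_right has_sum_fourier_series adj_coeff_summable assms)
  moreover have "(\<Sum>\<^sub>\<infinity>k\<in>int_lattice. a * (adj_coeff \<kappa> m \<phi> k * character k x) + b * (adj_coeff \<kappa> m \<psi> k * character k x)) =
      matern_adjoint \<kappa> m (\<lambda>x. a * \<phi> x + b * \<psi> x) x"
    unfolding matern_adjoint_def fourier_series_def
    by (intro infsum_cong) (simp add: adj_coeff_lincomb[OF assms] algebra_simps)
  ultimately show "matern_adjoint \<kappa> m (\<lambda>x. a * \<phi> x + b * \<psi> x) x = a * matern_adjoint \<kappa> m \<phi> x + b * matern_adjoint \<kappa> m \<psi> x"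
    by (simp only: infsumI)
qed

text \<open>Control of the supremum by finitely many derivatives of the test function; since white
  noise sees only the L2 norm, this is enough for continuity of the field.\<close>

lemma adj_bound:
  obtains N C where "C \<ge> 0" "\<And>\<phi> P x. \<phi> \<in> torus_smooth \<Longrightarrow> deriv_bound N P \<phi> \<Longrightarrow> norm (matern_adjoint \<kappa> m \<phi> x) \<le> C * P"
proof -
  define s where "s = real DIM('a) + 1"
  obtain N C where C: "C \<ge> 0" "\<And>\<phi> P (k::'a) K. \<phi> \<in> torus_smooth \<Longrightarrow> deriv_bound N P \<phi> \<Longrightarrow> K \<in> int_lattice \<Longrightarrow>
      (\<And>b. b \<in> Basis \<Longrightarrow> \<exists>b'\<in>Basis. \<bar>k \<bullet> b\<bar> = \<bar>K \<bullet> b'\<bar>) \<Longrightarrow>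
      norm (osc_coeff order_fun (ln (freq_weight \<kappa> k)) K \<phi>) \<le> C * P * freq_weight \<kappa> k powr (- s)"
    by (rule osc_coeff_decay[OF order_fun_smooth \<kappa>, of s, where 'a = 'a]) blast
  have sw: "(\<lambda>k::'a. weight k powr (- s)) summable_on int_lattice" by (rule weight_summable[OF \<kappa>]) (simp add: s_def)
  define S where "S = (\<Sum>\<^sub>\<infinity>k\<in>(int_lattice::'a set). weight k powr (- s))"
  have S: "S \<ge> 0" unfolding S_def by (intro infsum_nonneg) simp
  show ?thesis
  proof
    fix \<phi> :: "'a \<Rightarrow> complex" and P :: real and x :: 'a
    assume \<phi>: "\<phi> \<in> torus_smooth" "deriv_bound N P \<phi>"
    have "norm (matern_adjoint \<kappa> m \<phi> x) \<le> (\<Sum>\<^sub>\<infinity>k\<in>(int_lattice::'a set). C * P * weight k powr (- s))"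
      unfolding matern_adjoint_def fourier_series_def
    proof (rule norm_infsum_le)
      fix k :: 'a assume "k \<in> int_lattice"
      then have "norm (osc_coeff order_fun (ln (weight k)) k \<phi>) \<le> C * P * weight k powr (- s)" by (intro C(2) \<phi>) auto
      then show "norm (adj_coeff \<kappa> m \<phi> k * character k x) \<le> C * P * weight k powr (- s)"
        by (simp add: norm_mult adj_coeff_osc)
    qed (intro summable_on_cmult_right sw)
    also have "\<dots> = C * P * S" unfolding S_def by (rule infsum_cmult_right')
    finally show "norm (matern_adjoint \<kappa> m \<phi> x) \<le> (C * S) * P" by (simp only: mult_ac)
  qed (use C(1) S in simp)
qed

text \<open>The symbol is real and even in the frequency, so conjugating a coefficient reflects its
  frequency, and the series is its own conjugate.\<close>

lemma adj_real:
  assumes \<phi>: "\<phi> \<in> torus_smooth" "\<And>x. \<phi> x \<in> \<real>"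
  shows "matern_adjoint \<kappa> m \<phi> x \<in> \<real>"
proof -
  have cr: "cnj (\<phi> x) = \<phi> x" for x using \<phi>(2)[of x] by (simp add: Reals_cnj_iff)
  have cs: "cnj (matern_symbol \<kappa> m x k) = matern_symbol \<kappa> m x (- k)" for x k by (simp add: matern_symbol_def)
  have "cnj (adj_coeff \<kappa> m \<phi> k) = adj_coeff \<kappa> m \<phi> (- k)" for k
    unfolding adj_coeff_def
    by (subst torus_integral_cnj[symmetric])
      (auto intro!: continuous_intros symbol_continuous torus_smoothD(2)[OF \<phi>(1)] simp: cr cs character_minus_left)
  note cc = this
  have hs: "((\<lambda>k. adj_coeff \<kappa> m \<phi> k * character k x) has_sum matern_adjoint \<kappa> m \<phi> x) int_lattice"
    unfolding matern_adjoint_def by (rule has_sum_fourier_series[OF adj_coeff_summable[OF \<phi>(1)]])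
  have "((\<lambda>k. cnj (adj_coeff \<kappa> m \<phi> k * character k x)) has_sum cnj (matern_adjoint \<kappa> m \<phi> x)) int_lattice"
    using has_sum_bounded_linear[OF bounded_linear_cnj hs] .
  then have "((\<lambda>k. adj_coeff \<kappa> m \<phi> (- k) * character (- k) x) has_sum cnj (matern_adjoint \<kappa> m \<phi> x)) int_lattice"
    by (simp add: cc character_minus_left)
  moreover have "bij_betw uminus (int_lattice :: 'a set) int_lattice"
    by (rule bij_betw_byWitness[where f' = uminus]) auto
  ultimately have "((\<lambda>k. adj_coeff \<kappa> m \<phi> k * character k x) has_sum cnj (matern_adjoint \<kappa> m \<phi> x)) int_lattice"
    using has_sum_reindex_bij_betw[of uminus int_lattice int_lattice "\<lambda>k. adj_coeff \<kappa> m \<phi> k * character k x"] by blast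
  then have "cnj (matern_adjoint \<kappa> m \<phi> x) = matern_adjoint \<kappa> m \<phi> x" using has_sum_unique hs by blast
  then show ?thesis by (simp add: Reals_cnj_iff)
qed

text \<open>A Parseval identity, obtained by integrating the series of the adjoint termwise against
  the conjugate of \<open>f\<close> and then conjugating.\<close>

lemma adj_inner:
  assumes f: "f \<in> torus_smooth" and \<phi>: "\<phi> \<in> torus_smooth"
  shows "((\<lambda>k. fourier_coeff f k * cnj (adj_coeff \<kappa> m \<phi> k)) has_sum torus_inner f (matern_adjoint \<kappa> m \<phi>)) int_lattice"
proof -
  note fc = torus_smoothD(1,2)[OF f]
  have "((\<lambda>k. adj_coeff \<kappa> m \<phi> k * torus_integral (\<lambda>x. character k x * cnj (f x))) has_sum
      torus_integral (\<lambda>x. matern_adjoint \<kappa> m \<phi> x * cnj (f x))) int_lattice"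
    unfolding matern_adjoint_def
    by (rule fourier_series_integral[OF adj_coeff_summable[OF \<phi>]]) (use fc in \<open>auto simp: periodic_def intro!: continuous_intros\<close>)
  then have "((\<lambda>k. cnj (adj_coeff \<kappa> m \<phi> k * torus_integral (\<lambda>x. character k x * cnj (f x)))) has_sum
      cnj (torus_integral (\<lambda>x. matern_adjoint \<kappa> m \<phi> x * cnj (f x)))) int_lattice"
    by (rule has_sum_bounded_linear[OF bounded_linear_cnj])
  moreover have "cnj (torus_integral (\<lambda>x. matern_adjoint \<kappa> m \<phi> x * cnj (f x))) = torus_inner f (matern_adjoint \<kappa> m \<phi>)"
    unfolding torus_inner_def
    by (subst torus_integral_cnj[symmetric])
      (auto intro!: continuous_intros fc torus_smoothD(2)[OF adj_smooth[OF \<phi>]] simp: mult.commute)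
  moreover have "cnj (torus_integral (\<lambda>x. character k x * cnj (f x))) = fourier_coeff f k" for k
    unfolding fourier_coeff_alt
    by (subst torus_integral_cnj[symmetric]) (auto intro!: continuous_intros fc simp: mult.commute)
  ultimately show ?thesis by (simp add: mult.commute)
qed

text \<open>Both sides equal the same sum over frequencies. On the operator side the interchange is
  dominated by the polynomial symbol bound times the rapid coefficients of \<open>f\<close>.\<close>

lemma Op_inner:
  assumes f: "f \<in> torus_smooth" and \<phi>: "\<phi> \<in> torus_smooth"
  shows "torus_inner (Op (matern_symbol \<kappa> m) f) \<phi> = torus_inner f (matern_adjoint \<kappa> m \<phi>)"
proof -
  note cont = torus_smoothD(2)[OF \<phi>] symbol_continuous
  obtain P where P: "P \<ge> 0" "\<And>x. norm (\<phi> x) \<le> P" using periodic_bounded[OF torus_smoothD(1,2)[OF \<phi>]] by blast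
  obtain B G where B: "\<And>x k. norm (matern_symbol \<kappa> m x k) \<le> B * weight k powr G" by (rule symbol_bound) blast
  have "rapid \<kappa> (\<lambda>k. of_real (B * weight k powr G) * fourier_coeff f k)"
    by (rule rapid_mult[OF fourier_coeff_rapid[OF f \<kappa>] \<kappa>, of _ "\<bar>B\<bar>" G]) (simp add: norm_mult)
  then have "(\<lambda>k. norm (of_real (B * weight k powr G) * fourier_coeff f k) * P) summable_on int_lattice"
    by (intro summable_on_cmult_left rapid_summable[OF _ \<kappa>])
  note sm = this
  let ?t = "\<lambda>k x. matern_symbol \<kappa> m x k * fourier_coeff f k * character k x * cnj (\<phi> x)"
  have "((\<lambda>k. torus_integral (?t k)) has_sum torus_integral (\<lambda>x. \<Sum>\<^sub>\<infinity>k\<in>int_lattice. ?t k x)) int_lattice"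
  proof (rule torus_integral_infsum[OF _ _ _ _ sm])
    fix k x
    have "norm (?t k x) \<le> \<bar>B * weight k powr G\<bar> * norm (fourier_coeff f k) * 1 * P"
      unfolding norm_mult complex_mod_cnj norm_character
      using B[of x k] P by (intro mult_mono) auto
    then show "norm (?t k x) \<le> norm (of_real (B * weight k powr G) * fourier_coeff f k) * P"
      by (simp only: norm_mult norm_of_real mult_1_right)
    show "?t k \<in> borel_measurable borel" by (intro continuous_borel continuous_intros cont)
  qed auto
  moreover have "(\<Sum>\<^sub>\<infinity>k\<in>int_lattice. ?t k x) = Op (matern_symbol \<kappa> m) f x * cnj (\<phi> x)" for x
    unfolding Op_def by (rule infsum_cmult_left')
  moreover have "torus_integral (?t k) = fourier_coeff f k * cnj (adj_coeff \<kappa> m \<phi> k)" for k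
  proof -
    have "cnj (adj_coeff \<kappa> m \<phi> k) = torus_integral (\<lambda>x. cnj (matern_symbol \<kappa> m x k * \<phi> x * cnj (character k x)))"
      unfolding adj_coeff_def by (rule torus_integral_cnj[symmetric]) (intro continuous_intros cont)
    also have "fourier_coeff f k * \<dots> = torus_integral (\<lambda>x. fourier_coeff f k * cnj (matern_symbol \<kappa> m x k * \<phi> x * cnj (character k x)))"
      by (rule torus_integral_cmult[symmetric]) (intro continuous_intros cont)
    also have "\<dots> = torus_integral (?t k)" by (simp add: matern_symbol_def mult_ac)
    finally show ?thesis by simp
  qed
  ultimately have "((\<lambda>k. fourier_coeff f k * cnj (adj_coeff \<kappa> m \<phi> k)) has_sum torus_inner (Op (matern_symbol \<kappa> m) f) \<phi>) int_lattice"
    by (simp add: torus_inner_def)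
  then show ?thesis using adj_inner[OF f \<phi>] has_sum_unique by blast
qed

text \<open>The definite description needs uniqueness as well: the difference \<open>h\<close> of
  two candidates is itself an admissible test function, and testing with it gives squared L2 norm
  0.\<close>

lemma L2_adjoint_eq:
  assumes \<phi>: "\<phi> \<in> torus_smooth"
  shows "L2_adjoint (Op (matern_symbol \<kappa> m)) \<phi> = matern_adjoint \<kappa> m \<phi>"
  unfolding L2_adjoint_def
proof (rule the_equality)
  show "matern_adjoint \<kappa> m \<phi> \<in> torus_smooth \<and> (\<forall>f\<in>torus_smooth. torus_inner (Op (matern_symbol \<kappa> m) f) \<phi> = torus_inner f (matern_adjoint \<kappa> m \<phi>))"
    using adj_smooth Op_inner \<phi> by blast
  fix \<psi> assume *: "\<psi> \<in> torus_smooth \<and> (\<forall>f\<in>torus_smooth. torus_inner (Op (matern_symbol \<kappa> m) f) \<phi> = torus_inner f \<psi>)"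
  define h where "h x = \<psi> x - matern_adjoint \<kappa> m \<phi> x" for x
  have h: "h \<in> torus_smooth" unfolding h_def using * adj_smooth[OF \<phi>] by (intro torus_smooth_diff) auto
  note hc = torus_smoothD(1,2)[OF h] torus_smoothD(1,2)[OF adj_smooth[OF \<phi>]]
  have "torus_inner h \<psi> = torus_inner h (matern_adjoint \<kappa> m \<phi>)" using * h Op_inner[OF h \<phi>] by metis
  moreover have "torus_inner h \<psi> = torus_integral (\<lambda>x. h x * cnj (h x) + h x * cnj (matern_adjoint \<kappa> m \<phi> x))"
    by (simp add: torus_inner_def h_def algebra_simps)
  moreover have "\<dots> = torus_integral (\<lambda>x. h x * cnj (h x)) + torus_inner h (matern_adjoint \<kappa> m \<phi>)"
    unfolding torus_inner_def using hc by (intro torus_integral_add) (auto simp: periodic_def intro!: continuous_intros)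
  ultimately have "torus_integral (\<lambda>x. h x * cnj (h x)) = 0" by simp
  then have "torus_integral (\<lambda>x. of_real ((norm (h x))\<^sup>2)) = 0" by (simp only: complex_norm_square)
  then have "(norm (h x))\<^sup>2 = 0" for x
    by (rule torus_integral_nonneg_zero[rotated 3]) (use hc in \<open>auto simp: periodic_def intro!: continuous_intros\<close>)
  then show "\<psi> = matern_adjoint \<kappa> m \<phi>" by (auto simp: h_def fun_eq_iff)
qed

end

section \<open>The covariance kernel\<close>

lemma smooth_nhdD:
  assumes "g \<in> smooth_nhd N \<delta> f"
  shows "g \<in> torus_smooth" "deriv_bound N \<delta> (\<lambda>z. g z - f z)"
  using assms by (auto simp: smooth_nhd_def deriv_bound_iff less_imp_le)

lemma character_Pair: "character (p, q) z = character p (fst z) * character q (snd z)"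
  by (simp add: character_def inner_prod_def distrib_left exp_add)

lemma distribution_zero:
  assumes "distribution_on_torus C" shows "C (\<lambda>x. 0) = 0"
proof -
  show ?thesis
    using assms[unfolded distribution_on_torus_def, THEN conjunct1, rule_format,
        OF torus_smooth_const[of 0] torus_smooth_const[of 0], of 0 0] by simp
qed

lemma distribution_sum:
  assumes C: "distribution_on_torus C" and A: "finite A" "\<And>k. k \<in> A \<Longrightarrow> f k \<in> torus_smooth"
  shows "C (\<lambda>x. \<Sum>k\<in>A. a k * f k x) = (\<Sum>k\<in>A. a k * C (f k))"
  using A
proof (induction rule: finite_induct)
  case empty
  then show ?case by (simp add: distribution_zero[OF C])
next
  case (insert j A)
  have lin: "C (\<lambda>x. a * f x + b * g x) = a * C f + b * C g" if "f \<in> torus_smooth" "g \<in> torus_smooth" for a b f g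
    using C that unfolding distribution_on_torus_def by blast
  have "(\<lambda>x. \<Sum>k\<in>A. a k * f k x) \<in> torus_smooth"
    using insert by (intro torus_smooth_sum torus_smooth_mult torus_smooth_const) auto
  then have "C (\<lambda>x. a j * f j x + 1 * (\<Sum>k\<in>A. a k * f k x)) = a j * C (f j) + 1 * C (\<lambda>x. \<Sum>k\<in>A. a k * f k x)"
    using insert by (intro lin) auto
  then show ?case using insert by simp
qed

text \<open>Characters of the product torus are tensors, and the Fourier series of a smooth function
  converges in the Frechet topology.\<close>

lemma distribution_tensor_unique:
  fixes C1 C2 :: "('a::euclidean_space \<times> 'a \<Rightarrow> complex) \<Rightarrow> complex"
  assumes C: "distribution_on_torus C1" "distribution_on_torus C2"
    and eq: "\<And>\<phi> \<psi>. \<phi> \<in> torus_smooth \<Longrightarrow> \<psi> \<in> torus_smooth \<Longrightarrow> C1 (tensor_cnj \<phi> \<psi>) = C2 (tensor_cnj \<phi> \<psi>)"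
    and F: "F \<in> torus_smooth"
  shows "C1 F = C2 F"
proof -
  have ch: "C1 (character k) = C2 (character k)" if k: "k \<in> int_lattice" for k :: "'a \<times> 'a"
  proof -
    obtain p q where pq: "k = (p, q)" "p \<in> int_lattice" "q \<in> int_lattice" using k by (cases k) auto
    \<comment> \<open>The tensor conjugates its second factor, hence the sign of
      \<open>q\<close>.\<close>
    have "character k = tensor_cnj (character p) (character (- q))"
      by (auto simp: pq tensor_cnj_def fun_eq_iff character_Pair character_minus_left)
    then show ?thesis using eq[of "character p" "character (- q)"] pq by (simp add: torus_smooth_character)
  qed
  define S where "S A x = (\<Sum>k\<in>A. fourier_coeff F k * character k x)" for A x
  have S: "S A \<in> torus_smooth" if "A \<subseteq> int_lattice" for A
    unfolding S_def using that
    by (intro torus_smooth_sum torus_smooth_mult torus_smooth_const torus_smooth_character) auto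
  have CS: "C1 (S A) = C2 (S A)" if "finite A" "A \<subseteq> int_lattice" for A
  proof -
    have "C' (S A) = (\<Sum>k\<in>A. fourier_coeff F k * C' (character k))" if "distribution_on_torus C'" for C'
      unfolding S_def
    proof (rule distribution_sum[OF that \<open>finite A\<close>, of character "fourier_coeff F"])
      show "character k \<in> torus_smooth" if "k \<in> A" for k
        using that \<open>A \<subseteq> int_lattice\<close> by (intro torus_smooth_character) blast
    qed
    note * = this[OF C(1)] this[OF C(2)]
    show ?thesis
      unfolding *
    proof (intro sum.cong refl)
      fix k assume "k \<in> A"
      then have "k \<in> int_lattice" using \<open>A \<subseteq> int_lattice\<close> by blast
      then show "fourier_coeff F k * C1 (character k) = fourier_coeff F k * C2 (character k)" by (simp only: ch)
    qed
  qed
  have "norm (C1 F - C2 F) \<le> e" if "e > 0" for e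
  proof -
    note cont = distribution_on_torus_def[THEN iffD1, THEN conjunct2, rule_format, OF _ F half_gt_zero[OF that]]
    obtain N1 d1 where 1: "d1 > 0" "\<And>g. g \<in> smooth_nhd N1 d1 F \<Longrightarrow> norm (C1 g - C1 F) < e / 2"
      using cont[OF C(1)] by blast
    obtain N2 d2 where 2: "d2 > 0" "\<And>g. g \<in> smooth_nhd N2 d2 F \<Longrightarrow> norm (C2 g - C2 F) < e / 2"
      using cont[OF C(2)] by blast
    \<comment> \<open>Half the smaller radius, because \<open>deriv_bound\<close> is a weak
      inequality and \<open>smooth_nhd\<close> a strict one.\<close>
    define N d where "N = max N1 N2" and "d = min d1 d2 / 2"
    have d: "d > 0" "d < d1" "d < d2" using 1(1) 2(1) by (auto simp: d_def min_def)
    have "\<forall>\<^sub>F A in finite_subsets_at_top int_lattice. deriv_bound N d (\<lambda>x. S A x - F x)"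
      unfolding S_def by (rule fourier_partial_sums_converge[OF F d(1)])
    then obtain A0 where "finite A0 \<and> A0 \<subseteq> int_lattice \<and>
        (\<forall>A. finite A \<and> A0 \<subseteq> A \<and> A \<subseteq> int_lattice \<longrightarrow> deriv_bound N d (\<lambda>x. S A x - F x))"
      unfolding eventually_finite_subsets_at_top ..
    note * = this
    note A0 = *[THEN conjunct1] *[THEN conjunct2, THEN conjunct1]
    have A: "deriv_bound N d (\<lambda>x. S A0 x - F x)"
      by (rule *[THEN conjunct2, THEN conjunct2, rule_format]) (use A0 in simp)
    have "norm (iter_partial bs (\<lambda>x. S A0 x - F x) x) \<le> d" if "bs \<in> lists Basis" "length bs \<le> N" for bs x
      by (rule A[unfolded deriv_bound_iff, rule_format, OF that])
    note bd = this
    have "norm (iter_partial bs (\<lambda>x. S A0 x - F x) x) < d1" if "bs \<in> lists Basis" "length bs \<le> N1" for bs x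
    proof -
      have "length bs \<le> N" using that(2) by (simp add: N_def)
      then have "norm (iter_partial bs (\<lambda>x. S A0 x - F x) x) \<le> d" by (rule bd[OF that(1)])
      then show ?thesis using d by linarith
    qed
    then have s1: "S A0 \<in> smooth_nhd N1 d1 F" unfolding smooth_nhd_def using S[OF A0(2)] by blast
    have "norm (iter_partial bs (\<lambda>x. S A0 x - F x) x) < d2" if "bs \<in> lists Basis" "length bs \<le> N2" for bs x
    proof -
      have "length bs \<le> N" using that(2) by (simp add: N_def)
      then have "norm (iter_partial bs (\<lambda>x. S A0 x - F x) x) \<le> d" by (rule bd[OF that(1)])
      then show ?thesis using d by linarith
    qed
    then have s2: "S A0 \<in> smooth_nhd N2 d2 F" unfolding smooth_nhd_def using S[OF A0(2)] by blast
    note 1(2)[OF s1] 2(2)[OF s2]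
    moreover have "C1 F - C2 F = (C2 (S A0) - C2 F) - (C1 (S A0) - C1 F)" using CS[OF A0(1,2)] by simp
    ultimately show ?thesis using norm_triangle_ineq4[of "C2 (S A0) - C2 F" "C1 (S A0) - C1 F"] by simp
  qed
  then have "norm (C1 F - C2 F) \<le> 0" by (rule field_le_epsilon) simp
  then show ?thesis by simp
qed

context matern_order
begin

definition pair_order :: "'a \<times> 'a \<Rightarrow> complex" where "pair_order z = order_fun (fst z) + order_fun (snd z)"

lemma pair_order_smooth: "pair_order \<in> torus_smooth"
  unfolding pair_order_def[abs_def] by (intro torus_smooth_add torus_smooth_fst torus_smooth_snd order_fun_smooth)

text \<open>Puts the kernel term into the shape of \<open>osc_coeff\<close> on the product torus:
  the conjugate character at \<open>(- k, k)\<close> is the character of \<open>k\<close> at x -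
  y.\<close>

lemma matern_term_eq:
  "matern_term \<kappa> m k z = exp (- (of_real (ln (weight k)) * pair_order z)) * cnj (character (- k, k) z)"
proof -
  have "weight k powr (- (m (fst z) + m (snd z))) = exp (- (ln (weight k) * (m (fst z) + m (snd z))))"
    using freq_weight_pos[OF \<kappa>, of k] by (simp add: powr_def algebra_simps)
  moreover have "cnj (character (- k, k) z) = character k (fst z - snd z)"
    by (simp add: character_Pair character_minus_left character_minus[symmetric] character_add[symmetric])
  ultimately show ?thesis
    by (simp add: matern_term_def case_prod_beta pair_order_def order_fun_def exp_of_real[symmetric])
qed

lemma norm_matern_term: "norm (matern_term \<kappa> m k z) = weight k powr (- (m (fst z) + m (snd z)))"
  by (simp add: matern_term_def case_prod_beta norm_mult)

text \<open>For complex series unordered summability is absolute, and the modulus of a term is a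
  power of the weight. On the diagonal the exponent is twice \<open>m x\<close>, which gives the
  threshold d/2.\<close>

lemma matern_term_summable_iff:
  "(\<lambda>k. matern_term \<kappa> m k z) summable_on int_lattice \<longleftrightarrow> m (fst z) + m (snd z) > real DIM('a)"
  unfolding summable_on_iff_abs_summable_on_complex norm_matern_term by (rule weight_summable_iff[OF \<kappa>])

lemma matern_term_continuous: "continuous_on UNIV (matern_term \<kappa> m k)"
  unfolding matern_term_eq[abs_def] by (intro continuous_intros torus_smoothD(2)[OF pair_order_smooth])

definition kernel_coeff :: "('a \<times> 'a \<Rightarrow> complex) \<Rightarrow> 'a \<Rightarrow> complex" where
  "kernel_coeff F k = torus_integral (\<lambda>z. matern_term \<kappa> m k z * F z)"

lemma kernel_coeff_osc: "kernel_coeff F k = osc_coeff pair_order (ln (weight k)) (- k, k) F"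
  by (simp add: kernel_coeff_def osc_coeff_def matern_term_eq mult_ac)

lemma kernel_coeff_decay:
  obtains N C where "C \<ge> 0" "\<And>F P k. F \<in> torus_smooth \<Longrightarrow> deriv_bound N P F \<Longrightarrow> k \<in> int_lattice \<Longrightarrow>
    norm (kernel_coeff F k) \<le> C * P * weight k powr (- (real DIM('a) + 1))"
proof -
  obtain N C where C: "C \<ge> 0" "\<And>F P (k::'a) K. F \<in> torus_smooth \<Longrightarrow> deriv_bound N P F \<Longrightarrow> K \<in> int_lattice \<Longrightarrow>
      (\<And>b. b \<in> Basis \<Longrightarrow> \<exists>b'\<in>Basis. \<bar>k \<bullet> b\<bar> = \<bar>K \<bullet> b'\<bar>) \<Longrightarrow>
      norm (osc_coeff pair_order (ln (freq_weight \<kappa> k)) K F) \<le> C * P * freq_weight \<kappa> k powr (- (real DIM('a) + 1))"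
    by (rule osc_coeff_decay[OF pair_order_smooth \<kappa>, of "real DIM('a) + 1", where 'a = 'a]) blast
  show ?thesis
  proof (rule that[OF C(1)])
    fix F :: "'a \<times> 'a \<Rightarrow> complex" and P :: real and k :: 'a
    assume *: "F \<in> torus_smooth" "deriv_bound N P F" "k \<in> int_lattice"
    show "norm (kernel_coeff F k) \<le> C * P * weight k powr (- (real DIM('a) + 1))"
      unfolding kernel_coeff_osc
    proof (rule C(2)[OF *(1,2)])
      \<comment> \<open>The first component of \<open>(- k, k)\<close> already contains every
        coordinate of \<open>k\<close> up to sign.\<close>
      show "\<exists>b'\<in>Basis. \<bar>k \<bullet> b\<bar> = \<bar>(- k, k) \<bullet> b'\<bar>" if "b \<in> Basis" for b
        using that by (intro bexI[of _ "(b, 0)"]) (auto simp: Basis_prod_def)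
    qed (use * in simp)
  qed
qed

definition matern_kernel :: "('a \<times> 'a \<Rightarrow> complex) \<Rightarrow> complex" where
  "matern_kernel F = (\<Sum>\<^sub>\<infinity>k\<in>int_lattice. kernel_coeff F k)"

lemma weight_sum: "(\<lambda>k::'a. weight k powr (- (real DIM('a) + 1))) summable_on int_lattice"
  by (rule weight_summable[OF \<kappa>]) simp

lemma kernel_bound:
  obtains N C where "C \<ge> 0" "\<And>F P. F \<in> torus_smooth \<Longrightarrow> deriv_bound N P F \<Longrightarrow> norm (matern_kernel F) \<le> C * P"
proof -
  obtain N C where C: "C \<ge> 0" "\<And>F P k. F \<in> torus_smooth \<Longrightarrow> deriv_bound N P F \<Longrightarrow> k \<in> int_lattice \<Longrightarrow>
    norm (kernel_coeff F k) \<le> C * P * weight k powr (- (real DIM('a) + 1))"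
    by (rule kernel_coeff_decay) blast
  define S where "S = (\<Sum>\<^sub>\<infinity>k\<in>(int_lattice::'a set). weight k powr (- (real DIM('a) + 1)))"
  have S: "S \<ge> 0" unfolding S_def by (intro infsum_nonneg) simp
  show ?thesis
  proof (rule that[of "C * S" N])
    fix F :: "'a \<times> 'a \<Rightarrow> complex" and P
    assume F: "F \<in> torus_smooth" "deriv_bound N P F"
    have "norm (matern_kernel F) \<le> (\<Sum>\<^sub>\<infinity>k\<in>(int_lattice::'a set). C * P * weight k powr (- (real DIM('a) + 1)))"
      unfolding matern_kernel_def
      by (rule norm_infsum_le) (intro summable_on_cmult_right weight_sum, rule C(2)[OF F])
    also have "\<dots> = C * P * S" unfolding S_def by (rule infsum_cmult_right')
    finally show "norm (matern_kernel F) \<le> (C * S) * P" by (simp only: mult_ac)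
  qed (use C(1) S in simp)
qed

lemma kernel_has_sum:
  assumes F: "F \<in> torus_smooth"
  shows "(kernel_coeff F has_sum matern_kernel F) int_lattice"
proof -
  obtain N C where C: "\<And>P k. F \<in> torus_smooth \<Longrightarrow> deriv_bound N P F \<Longrightarrow> k \<in> int_lattice \<Longrightarrow>
    norm (kernel_coeff F k) \<le> C * P * weight k powr (- (real DIM('a) + 1))"
    by (rule kernel_coeff_decay) blast
  obtain P where P: "deriv_bound N P F" using deriv_bound_exists F torus_smooth_iff by blast
  have "(\<lambda>k. norm (kernel_coeff F k)) summable_on int_lattice"
    by (rule summable_on_norm_compare[of "\<lambda>k. C * P * weight k powr (- (real DIM('a) + 1))"])
      (intro summable_on_cmult_right weight_sum, rule C[OF F P])
  then have "kernel_coeff F summable_on int_lattice" by (rule abs_summable_summable)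
  then show ?thesis unfolding matern_kernel_def by (rule has_sum_infsum)
qed

lemma kernel_linear:
  assumes F: "F \<in> torus_smooth" and G: "G \<in> torus_smooth"
  shows "matern_kernel (\<lambda>z. a * F z + b * G z) = a * matern_kernel F + b * matern_kernel G"
proof -
  note c = torus_smoothD(2)[OF F] torus_smoothD(2)[OF G] matern_term_continuous
  have kc: "kernel_coeff (\<lambda>z. a * F z + b * G z) k = a * kernel_coeff F k + b * kernel_coeff G k"
    if k: "k \<in> int_lattice" for k
  proof -
    have pt: "periodic (matern_term \<kappa> m k)"
      using torus_smoothD(1)[OF pair_order_smooth] periodic_character[of "(- k, k)"] k by (simp add: periodic_def matern_term_eq)
    note p = torus_smoothD(1)[OF F] torus_smoothD(1)[OF G] pt
    have "kernel_coeff (\<lambda>z. a * F z + b * G z) k =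
        torus_integral (\<lambda>z. a * (matern_term \<kappa> m k z * F z) + b * (matern_term \<kappa> m k z * G z))"
      by (simp add: kernel_coeff_def algebra_simps)
    also have "\<dots> = torus_integral (\<lambda>z. a * (matern_term \<kappa> m k z * F z)) + torus_integral (\<lambda>z. b * (matern_term \<kappa> m k z * G z))"
      using p by (intro torus_integral_add continuous_intros c) (simp_all add: periodic_def)
    finally show ?thesis
      unfolding kernel_coeff_def by (subst (asm) (1 2) torus_integral_cmult) (intro continuous_intros c)+
  qed
  have "((\<lambda>k. a * kernel_coeff F k + b * kernel_coeff G k) has_sum (a * matern_kernel F + b * matern_kernel G)) int_lattice"
    by (intro has_sum_add has_sum_cmult_right kernel_has_sum F G)
  moreover have "matern_kernel (\<lambda>z. a * F z + b * G z) = (\<Sum>\<^sub>\<infinity>k\<in>int_lattice. a * kernel_coeff F k + b * kernel_coeff G k)"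
    unfolding matern_kernel_def by (intro infsum_cong kc)
  ultimately show ?thesis by (simp only: infsumI)
qed

lemma kernel_distribution: "distribution_on_torus matern_kernel"
  unfolding distribution_on_torus_def
proof (intro conjI ballI allI impI)
  show "matern_kernel (\<lambda>x. a * f x + b * g x) = a * matern_kernel f + b * matern_kernel g"
    if "f \<in> torus_smooth" "g \<in> torus_smooth" for f g a b using that by (rule kernel_linear)
  fix f :: "'a \<times> 'a \<Rightarrow> complex" and e :: real assume f: "f \<in> torus_smooth" and e: "e > 0"
  obtain N C where C: "C \<ge> 0" "\<And>F P. F \<in> torus_smooth \<Longrightarrow> deriv_bound N P F \<Longrightarrow> norm (matern_kernel F) \<le> C * P"
    by (rule kernel_bound) blast
  have "norm (matern_kernel g - matern_kernel f) < e" if g: "g \<in> smooth_nhd N (e / (C + 1)) f" for g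
  proof -
    have "matern_kernel g - matern_kernel f = matern_kernel (\<lambda>z. g z - f z)"
      using kernel_linear[OF smooth_nhdD(1)[OF g] f, of 1 "-1"] by simp
    also have "norm \<dots> \<le> C * (e / (C + 1))"
      by (rule C(2)[OF torus_smooth_diff[OF smooth_nhdD(1)[OF g] f] smooth_nhdD(2)[OF g]])
    also have "\<dots> < e" using C(1) e by (simp add: field_simps)
    finally show ?thesis .
  qed
  then show "\<exists>N. \<exists>\<delta>>0. \<forall>g\<in>smooth_nhd N \<delta> f. norm (matern_kernel g - matern_kernel f) < e"
    using C(1) e by (intro exI[of _ N] exI[of _ "e / (C + 1)"]) simp
qed

text \<open>Weight and character both factor into a function of x and one of y, so Fubini splits the
  integral. The frequency is \<open>- k\<close> because the kernel pairs \<open>\<phi>\<close> with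
  the character of \<open>k\<close> itself, not with its conjugate.\<close>

lemma kernel_coeff_tensor:
  assumes \<phi>: "\<phi> \<in> torus_smooth" and \<psi>: "\<psi> \<in> torus_smooth"
  shows "kernel_coeff (tensor_cnj \<phi> \<psi>) k = adj_coeff \<kappa> m \<phi> (- k) * cnj (adj_coeff \<kappa> m \<psi> (- k))"
proof -
  note cont = torus_smoothD(2)[OF \<phi>] torus_smoothD(2)[OF \<psi>] symbol_continuous
  let ?f = "\<lambda>x. matern_symbol \<kappa> m x (- k) * \<phi> x * cnj (character (- k) x)"
  let ?g = "\<lambda>x. matern_symbol \<kappa> m x (- k) * \<psi> x * cnj (character (- k) x)"
  have "matern_term \<kappa> m k z * tensor_cnj \<phi> \<psi> z = ?f (fst z) * cnj (?g (snd z))" for z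
  proof -
    have "character k (fst z - snd z) = cnj (character (- k) (fst z)) * character (- k) (snd z)"
      using character_add[of k "fst z" "- snd z"] by (simp add: character_minus character_minus_left)
    moreover have "weight k powr (- (m (fst z) + m (snd z))) = weight k powr (- m (fst z)) * weight k powr (- m (snd z))"
      using freq_weight_pos[OF \<kappa>, of k] by (simp add: powr_add[symmetric])
    ultimately show ?thesis
      by (simp add: matern_term_def tensor_cnj_def case_prod_beta matern_symbol_def mult_ac)
  qed
  then have "kernel_coeff (tensor_cnj \<phi> \<psi>) k = torus_integral (\<lambda>z. ?f (fst z) * cnj (?g (snd z)))"
    unfolding kernel_coeff_def by simp
  also have "\<dots> = torus_integral ?f * torus_integral (\<lambda>x. cnj (?g x))"
    by (rule torus_integral_prod) (intro continuous_intros cont)+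
  also have "torus_integral (\<lambda>x. cnj (?g x)) = cnj (torus_integral ?g)"
    by (rule torus_integral_cnj) (intro continuous_intros cont)
  finally show ?thesis by (simp only: adj_coeff_def)
qed

text \<open>Parseval for the adjoint of \<open>\<phi>\<close>, whose Fourier coefficients are known;
  the reflection of frequencies is a bijection of the lattice.\<close>

lemma kernel_tensor:
  assumes \<phi>: "\<phi> \<in> torus_smooth" and \<psi>: "\<psi> \<in> torus_smooth"
  shows "matern_kernel (tensor_cnj \<phi> \<psi>) = torus_inner (matern_adjoint \<kappa> m \<phi>) (matern_adjoint \<kappa> m \<psi>)"
proof -
  have "((\<lambda>k. fourier_coeff (matern_adjoint \<kappa> m \<phi>) k * cnj (adj_coeff \<kappa> m \<psi> k)) has_sum
      torus_inner (matern_adjoint \<kappa> m \<phi>) (matern_adjoint \<kappa> m \<psi>)) int_lattice"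
    by (rule adj_inner[OF adj_smooth[OF \<phi>] \<psi>])
  then have "((\<lambda>k. adj_coeff \<kappa> m \<phi> k * cnj (adj_coeff \<kappa> m \<psi> k)) has_sum
      torus_inner (matern_adjoint \<kappa> m \<phi>) (matern_adjoint \<kappa> m \<psi>)) int_lattice"
    by (rule has_sum_cong[THEN iffD1, rotated]) (simp add: adj_fourier_coeff[OF \<phi>])
  moreover have "bij_betw uminus (int_lattice :: 'a set) int_lattice"
    by (rule bij_betw_byWitness[where f' = uminus]) auto
  ultimately have "((\<lambda>k. adj_coeff \<kappa> m \<phi> (- k) * cnj (adj_coeff \<kappa> m \<psi> (- k))) has_sum
      torus_inner (matern_adjoint \<kappa> m \<phi>) (matern_adjoint \<kappa> m \<psi>)) int_lattice"
    using has_sum_reindex_bij_betw[of uminus int_lattice int_lattice "\<lambda>k. adj_coeff \<kappa> m \<phi> k * cnj (adj_coeff \<kappa> m \<psi> k)"] by blast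
  then show ?thesis unfolding matern_kernel_def kernel_coeff_tensor[OF \<phi> \<psi>] by (rule infsumI)
qed

text \<open>Modulo the lattice the closed support is compact, and the continuous periodic function
  m(x) + m(y) attains its minimum there. Strict inequality thus becomes a uniform gap, as needed for
  a summable majorant independent of the point.\<close>

lemma support_gap:
  assumes F: "F \<in> torus_smooth" and supp: "closure {z. F z \<noteq> 0} \<subseteq> {z. m (fst z) + m (snd z) > d}"
  obtains \<delta> where "\<delta> > 0" "\<And>z. F z \<noteq> 0 \<Longrightarrow> m (fst z) + m (snd z) \<ge> d + \<delta>"
proof -
  define h where "h z = m (fst z) + m (snd z)" for z
  have h: "h = (\<lambda>z. Re (pair_order z))" by (simp add: h_def pair_order_def order_fun_def fun_eq_iff)
  have hp: "periodic h" using torus_smoothD(1)[OF pair_order_smooth] by (simp add: periodic_def h)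
  have hc: "continuous_on UNIV h"
    unfolding h using torus_smoothD(2)[OF pair_order_smooth] by (intro continuous_intros)
  define K where "K = closure {z. F z \<noteq> 0} \<inter> cbox 0 One"
  have K: "compact K" unfolding K_def by (simp add: closed_Int_compact)
  have red: "z - lattice_floor z \<in> K" "h (z - lattice_floor z) = h z" if "F z \<noteq> 0" for z
  proof -
    have "F (z - lattice_floor z) = F z" by (rule periodic_eq[OF torus_smoothD(1)[OF F]]) (simp add: int_lattice_minus)
    moreover have "z - lattice_floor z \<in> cbox 0 One" using unit_cell_subset diff_lattice_floor_in_cell by blast
    ultimately show "z - lattice_floor z \<in> K" using that closure_subset unfolding K_def by fastforce
    show "h (z - lattice_floor z) = h z" by (rule periodic_eq[OF hp]) (simp add: int_lattice_minus)
  qed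
  show ?thesis
  proof (cases "K = {}")
    case True
    then show ?thesis using red(1) by (intro that[of 1]) auto
  next
    case False
    then obtain z0 where z0: "z0 \<in> K" "\<And>z. z \<in> K \<Longrightarrow> h z0 \<le> h z"
      using continuous_attains_inf[OF K False continuous_on_subset[OF hc subset_UNIV]] by blast
    show ?thesis
    proof (rule that[of "h z0 - d"])
      show "h z0 - d > 0" using z0(1) supp by (auto simp: K_def h_def)
      fix z assume Fz: "F z \<noteq> 0"
      have "h z0 \<le> h z" using z0(2)[OF red(1)[OF Fz]] unfolding red(2)[OF Fz] .
      then show "m (fst z) + m (snd z) \<ge> d + (h z0 - d)" by (simp add: h_def)
    qed
  qed
qed

text \<open>Summability at a point is the inequality m(x) + m(y) > d, so the support condition
  yields a gap \<delta>, and the weights to the power -(d + \<delta>) dominate the interchange of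
  sum and integral.\<close>

lemma kernel_pointwise:
  assumes F: "F \<in> torus_smooth"
    and supp: "closure {z. F z \<noteq> 0} \<subseteq> {z. (\<lambda>k. matern_term \<kappa> m k z) summable_on int_lattice}"
  shows "matern_kernel F = torus_integral (\<lambda>z. (\<Sum>\<^sub>\<infinity>k\<in>int_lattice. matern_term \<kappa> m k z) * F z)"
proof -
  define d where "d = real DIM('a)"
  obtain \<delta> where \<delta>: "\<delta> > 0" "\<And>z. F z \<noteq> 0 \<Longrightarrow> m (fst z) + m (snd z) \<ge> d + \<delta>"
    using supp unfolding matern_term_summable_iff d_def[symmetric] by (rule support_gap[OF F]) blast
  obtain P where P: "P \<ge> 0" "\<And>z. norm (F z) \<le> P" using periodic_bounded[OF torus_smoothD(1,2)[OF F]] by blast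
  obtain H where H: "H \<ge> 0" "\<And>z. norm (pair_order z) \<le> H" using periodic_bounded[OF torus_smoothD(1,2)[OF pair_order_smooth]] by blast
  \<comment> \<open>The weight may be below 1 when \<kappa> is, so the excess exponent over d +
    \<delta> can enlarge the term; the boundedness of m limits this to a fixed power of
    \<open>B\<close>.\<close>
  define B where "B = max 1 (1 / \<kappa>)"
  have B: "B \<ge> 1" "B \<ge> 1 / \<kappa>" by (simp_all add: B_def)
  define c where "c k = B powr (H + d + \<delta>) * weight k powr (- (d + \<delta>)) * P" for k :: 'a
  have bd: "norm (matern_term \<kappa> m k z * F z) \<le> c k" for k z
  proof (cases "F z = 0")
    case True
    then show ?thesis using P(1) by (simp add: c_def)
  next
    case False
    define r where "r = m (fst z) + m (snd z) - (d + \<delta>)"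
    have r0: "r \<ge> 0" using \<delta>(2)[OF False] by (simp add: r_def)
    have "pair_order z = of_real (m (fst z) + m (snd z))" by (simp add: pair_order_def order_fun_def)
    then have "\<bar>m (fst z) + m (snd z)\<bar> \<le> H" using H(2)[of z] by (simp only: norm_of_real)
    then have rH: "r \<le> H + d + \<delta>" using \<delta>(1) by (auto simp: r_def d_def)
    have "weight k powr (- r) \<le> \<kappa> powr (- r)"
      using r0 \<kappa> freq_weight_ge[OF \<kappa>] by (intro powr_mono2') auto
    also have "\<dots> = (1 / \<kappa>) powr r" using \<kappa> by (simp add: powr_divide powr_minus field_simps)
    also have "\<dots> \<le> B powr r" using r0 B \<kappa> by (intro powr_mono2) auto
    also have "\<dots> \<le> B powr (H + d + \<delta>)" using rH B by (intro powr_mono) auto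
    finally have wr: "weight k powr (- r) \<le> B powr (H + d + \<delta>)" .
    have "norm (matern_term \<kappa> m k z) = weight k powr (- r) * weight k powr (- (d + \<delta>))"
      unfolding norm_matern_term powr_add[symmetric] by (rule arg_cong[of _ _ "(powr) (weight k)"]) (simp add: r_def)
    also have "\<dots> \<le> B powr (H + d + \<delta>) * weight k powr (- (d + \<delta>))" using wr by (intro mult_right_mono) auto
    finally show ?thesis unfolding norm_mult c_def using P by (intro mult_mono) auto
  qed
  have cs: "c summable_on int_lattice"
    unfolding c_def using \<delta>(1)
    by (intro summable_on_cmult_left summable_on_cmult_right weight_summable \<kappa>) (simp add: d_def)
  have "((\<lambda>k. torus_integral (\<lambda>z. matern_term \<kappa> m k z * F z)) has_sum
      torus_integral (\<lambda>z. \<Sum>\<^sub>\<infinity>k\<in>int_lattice. matern_term \<kappa> m k z * F z)) int_lattice"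
    by (rule torus_integral_infsum[OF _ _ _ bd cs])
      (auto intro!: continuous_borel continuous_intros matern_term_continuous torus_smoothD(2)[OF F])
  moreover have "(\<Sum>\<^sub>\<infinity>k\<in>int_lattice. matern_term \<kappa> m k z * F z) = (\<Sum>\<^sub>\<infinity>k\<in>int_lattice. matern_term \<kappa> m k z) * F z" for z
    by (rule infsum_cmult_left')
  ultimately have "(kernel_coeff F has_sum torus_integral (\<lambda>z. (\<Sum>\<^sub>\<infinity>k\<in>int_lattice. matern_term \<kappa> m k z) * F z)) int_lattice"
    unfolding kernel_coeff_def[abs_def] by simp
  then show ?thesis using kernel_has_sum[OF F] has_sum_unique by blast
qed

end

section \<open>The variable-order Matern field\<close>

lemma white_noise_cov:
  assumes W: "white_noise M W" and f: "f \<in> torus_smooth" and g: "g \<in> torus_smooth"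
  shows "(LINT w|M. W f w * cnj (W g w)) = torus_inner f g"
  using W f g unfolding white_noise_def covariance_kernel_def by auto

lemma white_noise_norm:
  assumes W: "white_noise M W" and f: "f \<in> torus_smooth"
  shows "(LINT w|M. (norm (W f w))\<^sup>2) = Re (torus_inner f f)"
proof -
  have "complex_of_real (LINT w|M. (norm (W f w))\<^sup>2) = (LINT w|M. W f w * cnj (W f w))"
    unfolding integral_complex_of_real[symmetric] by (simp only: complex_norm_square)
  also have "\<dots> = torus_inner f f" by (rule white_noise_cov[OF W f f])
  finally show ?thesis by (metis Re_complex_of_real)
qed

context matern_order
begin

lemma Op_field_eq: "\<phi> \<in> torus_smooth \<Longrightarrow> Op_field (matern_symbol \<kappa> m) W \<phi> = W (matern_adjoint \<kappa> m \<phi>)"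
  by (simp add: Op_field_def L2_adjoint_eq)

text \<open>Continuity combines two facts: white noise maps the L2 norm isometrically to the second
  moment, and \<open>adj_bound\<close> controls the adjoint of a small test function uniformly.
  Linearity holds pointwise for the adjoint and almost surely for white noise.\<close>

lemma Op_field_gerf:
  assumes W: "white_noise M W"
  shows "gerf M (Op_field (matern_symbol \<kappa> m) W)"
proof -
  let ?T = "matern_adjoint \<kappa> m" and ?u = "Op_field (matern_symbol \<kappa> m) W"
  have gW: "gerf M W" using W by (simp add: white_noise_def)
  have sq: "square_integrable M (W f)" if "f \<in> torus_smooth" for f
    using gW that unfolding gerf_def by blast
  have lin: "AE w in M. W (\<lambda>x. a * f x + b * g x) w = a * W f w + b * W g w"
    if "f \<in> torus_smooth" "g \<in> torus_smooth" for f g a b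
    using gW that unfolding gerf_def by blast
  have ulin: "AE w in M. W (?T (\<lambda>x. a * f x + b * g x)) w = a * W (?T f) w + b * W (?T g) w"
    if fg: "f \<in> torus_smooth" "g \<in> torus_smooth" for f g a b
    unfolding adj_lincomb[OF fg] by (rule lin[OF adj_smooth[OF fg(1)] adj_smooth[OF fg(2)]])
  have cont: "\<exists>N. \<exists>\<delta>>0. \<forall>\<psi>\<in>smooth_nhd N \<delta> \<phi>. L2_dist M (?u \<psi>) (?u \<phi>) < e"
    if \<phi>: "\<phi> \<in> torus_smooth" and e: "e > 0" for \<phi> e
  proof -
    obtain N C where C: "C \<ge> 0" "\<And>\<phi> P x. \<phi> \<in> torus_smooth \<Longrightarrow> deriv_bound N P \<phi> \<Longrightarrow> norm (?T \<phi> x) \<le> C * P"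
      by (rule adj_bound) blast
    define \<delta> where "\<delta> = e / (C + 1)"
    have \<delta>: "\<delta> > 0" "C * \<delta> < e" using C(1) e by (auto simp: \<delta>_def field_simps)
    have "L2_dist M (?u \<psi>) (?u \<phi>) < e" if \<psi>: "\<psi> \<in> smooth_nhd N \<delta> \<phi>" for \<psi>
    proof -
      note \<psi>s = smooth_nhdD(1)[OF \<psi>]
      define h where "h = (\<lambda>x. \<psi> x - \<phi> x)"
      have h: "h \<in> torus_smooth" unfolding h_def by (rule torus_smooth_diff[OF \<psi>s \<phi>])
      have hb: "norm (?T h x) \<le> C * \<delta>" for x
        by (rule C(2)[OF h]) (unfold h_def, rule smooth_nhdD(2)[OF \<psi>])
      have hh: "(\<lambda>x. 1 * \<psi> x + (- 1) * \<phi> x) = h" by (simp add: h_def)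
      have mb: "W (?T f) \<in> borel_measurable M" if "f \<in> torus_smooth" for f
        using sq[OF adj_smooth[OF that]] by (simp add: square_integrable_def)
      note [measurable] = mb[OF \<psi>s] mb[OF \<phi>] mb[OF h]
      have "AE w in M. W (?T h) w = 1 * W (?T \<psi>) w + (- 1) * W (?T \<phi>) w"
        using ulin[OF \<psi>s \<phi>, of 1 "- 1"] unfolding hh .
      then have ae: "AE w in M. (norm (W (?T \<psi>) w - W (?T \<phi>) w))\<^sup>2 = (norm (W (?T h) w))\<^sup>2"
        by (rule eventually_mono) simp
      have "(LINT w|M. (norm (W (?T \<psi>) w - W (?T \<phi>) w))\<^sup>2) = (LINT w|M. (norm (W (?T h) w))\<^sup>2)"
        by (rule integral_cong_AE[OF _ _ ae]) measurable
      also have "\<dots> = Re (torus_inner (?T h) (?T h))" by (rule white_noise_norm[OF W adj_smooth[OF h]])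
      also have "\<dots> \<le> norm (torus_inner (?T h) (?T h))" by (rule complex_Re_le_cmod)
      also have "\<dots> \<le> (C * \<delta>) * (C * \<delta>)"
        unfolding torus_inner_def
      proof (rule norm_torus_integral_le)
        show "norm (?T h x * cnj (?T h x)) \<le> (C * \<delta>) * (C * \<delta>)" for x
          unfolding norm_mult complex_mod_cnj
          by (rule mult_mono[OF hb hb order_trans[OF norm_ge_zero hb] norm_ge_zero])
      qed (intro continuous_borel continuous_intros torus_smoothD(2)[OF adj_smooth[OF h]])
      finally have "L2_dist M (?u \<psi>) (?u \<phi>) \<le> sqrt ((C * \<delta>) * (C * \<delta>))"
        unfolding L2_dist_def Op_field_eq[OF \<psi>s] Op_field_eq[OF \<phi>] by (rule real_sqrt_le_mono)
      also have "\<dots> = C * \<delta>" using C(1) \<delta>(1) by simp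
      also have "\<dots> < e" by (rule \<delta>(2))
      finally show ?thesis .
    qed
    then show ?thesis using \<delta>(1) by blast
  qed
  have re: "AE w in M. W f w \<in> \<real>" if "f \<in> torus_smooth" "\<And>x. f x \<in> \<real>" for f
    using gW that unfolding gerf_def by blast
  have mean: "(LINT w|M. W f w) = 0" if "f \<in> torus_smooth" for f
    using gW that unfolding gerf_def by blast
  show ?thesis
    unfolding gerf_def
  proof (intro conjI ballI allI impI)
    fix \<phi> :: "'a \<Rightarrow> complex" assume \<phi>: "\<phi> \<in> torus_smooth"
    show "square_integrable M (?u \<phi>)" unfolding Op_field_eq[OF \<phi>] by (rule sq[OF adj_smooth[OF \<phi>]])
    show "(LINT w|M. ?u \<phi> w) = 0" unfolding Op_field_eq[OF \<phi>] by (rule mean[OF adj_smooth[OF \<phi>]])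
    show "AE w in M. ?u \<phi> w \<in> \<real>" if "\<forall>x. \<phi> x \<in> \<real>"
      unfolding Op_field_eq[OF \<phi>] by (rule re[OF adj_smooth[OF \<phi>] adj_real[OF \<phi>]]) (use that in blast)
    show "\<exists>N. \<exists>\<delta>>0. \<forall>\<psi>\<in>smooth_nhd N \<delta> \<phi>. L2_dist M (?u \<psi>) (?u \<phi>) < e" if "e > 0" for e
      by (rule cont[OF \<phi> that])
    fix \<psi> :: "'a \<Rightarrow> complex" and a b assume \<psi>: "\<psi> \<in> torus_smooth"
    show "AE w in M. ?u (\<lambda>x. a * \<phi> x + b * \<psi> x) w = a * ?u \<phi> w + b * ?u \<psi> w"
      unfolding Op_field_eq[OF \<phi>] Op_field_eq[OF \<psi>] Op_field_eq[OF torus_smooth_lincomb[OF \<phi> \<psi>]]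
      by (rule ulin[OF \<phi> \<psi>])
  qed
qed

lemma Op_field_cov:
  assumes W: "white_noise M W" and \<phi>: "\<phi> \<in> torus_smooth" and \<psi>: "\<psi> \<in> torus_smooth"
  shows "(LINT w|M. Op_field (matern_symbol \<kappa> m) W \<phi> w * cnj (Op_field (matern_symbol \<kappa> m) W \<psi> w)) =
    matern_kernel (tensor_cnj \<phi> \<psi>)"
  unfolding Op_field_eq[OF \<phi>] Op_field_eq[OF \<psi>] kernel_tensor[OF \<phi> \<psi>]
  by (rule white_noise_cov[OF W adj_smooth[OF \<phi>] adj_smooth[OF \<psi>]])

lemma Op_field_covariance_kernel:
  assumes "white_noise M W"
  shows "covariance_kernel M (Op_field (matern_symbol \<kappa> m) W) matern_kernel"
  unfolding covariance_kernel_def using kernel_distribution Op_field_cov[OF assms] by blast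

text \<open>The covariance prescribes only values on tensors, and a distribution is determined by
  these. Equality is claimed on smooth functions, where alone a distribution is constrained.\<close>

lemma covariance_kernel_unique:
  assumes W: "white_noise M W" and C: "covariance_kernel M (Op_field (matern_symbol \<kappa> m) W) C" and F: "F \<in> torus_smooth"
  shows "C F = matern_kernel F"
proof (rule distribution_tensor_unique[OF _ kernel_distribution _ F])
  show "distribution_on_torus C" using C by (simp add: covariance_kernel_def)
  show "C (tensor_cnj \<phi> \<psi>) = matern_kernel (tensor_cnj \<phi> \<psi>)" if "\<phi> \<in> torus_smooth" "\<psi> \<in> torus_smooth" for \<phi> \<psi>
    using C that Op_field_cov[OF W that] by (simp add: covariance_kernel_def)
qed

text \<open>The value on a conjugate square is the second moment of the field at that test
  function.\<close>

lemma covariance_kernel_psd: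
  assumes C: "covariance_kernel M (Op_field (matern_symbol \<kappa> m) W) C"
  shows "positive_semidefinite C"
  unfolding positive_semidefinite_def
proof
  fix \<phi> :: "'a \<Rightarrow> complex" assume \<phi>: "\<phi> \<in> torus_smooth"
  let ?X = "Op_field (matern_symbol \<kappa> m) W \<phi>"
  have "C (tensor_cnj \<phi> \<phi>) = (LINT w|M. ?X w * cnj (?X w))"
    using C \<phi> by (simp add: covariance_kernel_def)
  also have "\<dots> = of_real (LINT w|M. (norm (?X w))\<^sup>2)"
    unfolding integral_complex_of_real[symmetric] by (simp only: complex_norm_square)
  finally show "C (tensor_cnj \<phi> \<phi>) \<in> \<real>\<^sub>\<ge>\<^sub>0" by (simp add: nonneg_Reals_of_real_iff)
qed

text \<open>A constant order \<nu> + d/2 makes the weight exponent 2\<nu> + d, the one in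
  \<open>matern_poisson\<close>. Both kernels are multiples of the same lattice sum of Matern
  integrals: \<open>A\<close> is the Poisson constant, \<open>B\<close> comes from the normalisation
  of the covariance, and the factor sought is \<open>A / B\<close>.\<close>

lemma whittle_matern_sum:
  fixes \<nu> \<sigma> :: real
  assumes \<nu>: "\<nu> > 0" and \<sigma>: "\<sigma> > 0" and const: "\<And>x. m x = \<nu> + real DIM('a) / 2"
  shows "\<And>x y :: 'a. (\<lambda>n. matern_profile \<nu> (\<kappa> * norm (x - y + n))) summable_on int_lattice"
    and "\<exists>c>0. \<forall>x y. ((\<lambda>k. matern_term \<kappa> m k (x, y)) has_sum of_real (c * whittle_matern \<sigma> \<kappa> \<nu> x y)) int_lattice"
proof -
  let ?I = "\<lambda>z::'a. \<Sum>\<^sub>\<infinity>n\<in>int_lattice. matern_integral \<nu> \<kappa> (norm (z + n))"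
  have prof: "matern_profile \<nu> (\<kappa> * norm z) = (2 powr (\<nu> - 1) * \<kappa> powr (2 * \<nu>)) * matern_integral \<nu> \<kappa> (norm z)" for z :: 'a
    by (rule matern_profile_scaled[OF \<nu> \<kappa>]) simp
  show "(\<lambda>n. matern_profile \<nu> (\<kappa> * norm (x - y + n))) summable_on int_lattice" for x y :: 'a
    unfolding prof by (intro summable_on_cmult_right matern_poisson(1)[OF \<nu> \<kappa>])
  define A where "A = (4 * pi) powr (- (real DIM('a) / 2)) / Gamma (\<nu> + real DIM('a) / 2)"
  define B where "B = \<sigma>\<^sup>2 * (2 powr (1 - \<nu>) / Gamma \<nu>) * (2 powr (\<nu> - 1) * \<kappa> powr (2 * \<nu>))"
  have "Gamma \<nu> > 0" "Gamma (\<nu> + real DIM('a) / 2) > 0" using \<nu> by (auto intro!: Gamma_real_pos add_pos_nonneg)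
  then have A: "A > 0" and B: "B > 0" using \<sigma> \<kappa> by (simp_all add: A_def B_def)
  have wm: "whittle_matern \<sigma> \<kappa> \<nu> x y = B * ?I (x - y)" for x y :: 'a
    unfolding whittle_matern_def prof B_def infsum_cmult_right' by (simp only: mult.assoc)
  have "((\<lambda>k. matern_term \<kappa> m k (x, y)) has_sum of_real (A / B * whittle_matern \<sigma> \<kappa> \<nu> x y)) int_lattice" for x y
  proof -
    have "((\<lambda>k. of_real (weight k powr (- (2 * \<nu> + real DIM('a)))) * character k (x - y)) has_sum of_real (A * ?I (x - y))) int_lattice"
      unfolding A_def by (rule matern_poisson(2)[OF \<nu> \<kappa>])
    moreover have "A / B * whittle_matern \<sigma> \<kappa> \<nu> x y = A * ?I (x - y)" using B by (simp add: wm)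
    moreover have "matern_term \<kappa> m k (x, y) = of_real (weight k powr (- (2 * \<nu> + real DIM('a)))) * character k (x - y)" for k
      by (simp add: matern_term_def const)
    ultimately show ?thesis by (simp only:)
  qed
  then show "\<exists>c>0. \<forall>x y. ((\<lambda>k. matern_term \<kappa> m k (x, y)) has_sum of_real (c * whittle_matern \<sigma> \<kappa> \<nu> x y)) int_lattice"
    using A B by (intro exI[of _ "A / B"]) simp
qed

end

theorem proposition4p4:
  fixes M :: "'w measure"
    and W :: "(real ^ 'n \<Rightarrow> complex) \<Rightarrow> 'w \<Rightarrow> complex"
    and m :: "real ^ 'n \<Rightarrow> real"
    and \<kappa> \<sigma> :: real
  assumes "prob_space M"
    and "m \<in> torus_smooth"
    and "\<kappa> > 0"
    and "\<sigma> > 0"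
    and "white_noise M W"
  shows "let u = Op_field (matern_symbol \<kappa> m) W;
             S = (int_lattice :: (real ^ 'n) set)
         in
           gerf M u \<and>
           (\<exists>C. covariance_kernel M u C) \<and>
           (\<forall>C. covariance_kernel M u C \<longrightarrow>
             \<comment> \<open>the series for the kernel, in the sense of distributions\<close>
             (\<forall>F\<in>torus_smooth.
               ((\<lambda>k. torus_integral (\<lambda>z. matern_term \<kappa> m k z * F z)) has_sum C F) S) \<and>
             \<comment> \<open>and pointwise, on the set where it converges\<close>
             (\<forall>F\<in>torus_smooth.
               closure {z. F z \<noteq> 0} \<subseteq> {z. (\<lambda>k. matern_term \<kappa> m k z) summable_on S} \<longrightarrow>
               C F = torus_integral (\<lambda>z. (\<Sum>\<^sub>\<infinity>k\<in>S. matern_term \<kappa> m k z) * F z)) \<and>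
             positive_semidefinite C \<and>
             (\<forall>\<nu>>0. (\<forall>x. m x = \<nu> + real CARD('n) / 2) \<longrightarrow>
               (\<forall>x y. (\<lambda>n. matern_profile \<nu> (\<kappa> * norm (x - y + n))) summable_on S) \<and>
               (\<exists>c>0.
                 (\<forall>x y. ((\<lambda>k. matern_term \<kappa> m k (x, y)) has_sum
                           of_real (c * whittle_matern \<sigma> \<kappa> \<nu> x y)) S) \<and>
                 (\<forall>F\<in>torus_smooth.
                   C F = torus_integral
                     (\<lambda>(x, y). of_real (c * whittle_matern \<sigma> \<kappa> \<nu> x y) * F (x, y)))))) \<and>
           (\<forall>x. (\<lambda>k. matern_term \<kappa> m k (x, x)) summable_on S \<longleftrightarrow> m x > real CARD('n) / 2)"
proof -
  interpret matern_order \<kappa> m by unfold_locales fact+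
  note W = \<open>white_noise M W\<close>
  have dim: "real CARD('n) = real DIM(real ^ 'n)" by simp
  have diag: "(\<lambda>k. matern_term \<kappa> m k (x, x)) summable_on int_lattice \<longleftrightarrow> m x > real CARD('n) / 2" for x
    unfolding matern_term_summable_iff dim by auto
  show ?thesis
    unfolding Let_def
  proof (intro conjI allI impI ballI)
    show "gerf M (Op_field (matern_symbol \<kappa> m) W)" by (rule Op_field_gerf[OF W])
    show "\<exists>C. covariance_kernel M (Op_field (matern_symbol \<kappa> m) W) C"
      by (rule exI[where x = matern_kernel]) (rule Op_field_covariance_kernel[OF W])
    show "(\<lambda>k. matern_term \<kappa> m k (x, x)) summable_on int_lattice \<longleftrightarrow> m x > real CARD('n) / 2" for x by (rule diag)
  next
    fix C assume C: "covariance_kernel M (Op_field (matern_symbol \<kappa> m) W) C"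
    note CF = covariance_kernel_unique[OF W C]
    show "positive_semidefinite C" by (rule covariance_kernel_psd[OF C])
    have pw: "C F = torus_integral (\<lambda>z. (\<Sum>\<^sub>\<infinity>k\<in>int_lattice. matern_term \<kappa> m k z) * F z)"
      if "F \<in> torus_smooth" "closure {z. F z \<noteq> 0} \<subseteq> {z. (\<lambda>k. matern_term \<kappa> m k z) summable_on int_lattice}" for F
      unfolding CF[OF that(1)] by (rule kernel_pointwise[OF that])
    show "((\<lambda>k. torus_integral (\<lambda>z. matern_term \<kappa> m k z * F z)) has_sum C F) int_lattice"
      if F: "F \<in> torus_smooth" for F
      using kernel_has_sum[OF F] unfolding CF[OF F] kernel_coeff_def[abs_def] .
    show "C F = torus_integral (\<lambda>z. (\<Sum>\<^sub>\<infinity>k\<in>int_lattice. matern_term \<kappa> m k z) * F z)"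
      if "F \<in> torus_smooth" "closure {z. F z \<noteq> 0} \<subseteq> {z. (\<lambda>k. matern_term \<kappa> m k z) summable_on int_lattice}" for F
      by (rule pw[OF that])
    fix \<nu> :: real assume \<nu>: "\<nu> > 0" and const: "\<forall>x. m x = \<nu> + real CARD('n) / 2"
    have const': "m x = \<nu> + real DIM(real ^ 'n) / 2" for x using const by simp
    note wm = whittle_matern_sum[OF \<nu> \<open>\<sigma> > 0\<close> const']
    show "(\<lambda>n. matern_profile \<nu> (\<kappa> * norm (x - y + n))) summable_on int_lattice" for x y :: "real ^ 'n"
      by (rule wm(1))
    obtain c where c: "c > 0" "\<And>x y. ((\<lambda>k. matern_term \<kappa> m k (x, y)) has_sum of_real (c * whittle_matern \<sigma> \<kappa> \<nu> x y)) int_lattice"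
      using wm(2) by blast
    have "C F = torus_integral (\<lambda>(x, y). of_real (c * whittle_matern \<sigma> \<kappa> \<nu> x y) * F (x, y))"
      if F: "F \<in> torus_smooth" for F
    proof -
      \<comment> \<open>For constant order above d/2 the series converges at every point, so the
        pointwise formula covers every smooth \<open>F\<close>.\<close>
      have "(\<lambda>k. matern_term \<kappa> m k z) summable_on int_lattice" for z
        using has_sum_imp_summable[OF c(2)[of "fst z" "snd z"]] by simp
      then have "C F = torus_integral (\<lambda>z. (\<Sum>\<^sub>\<infinity>k\<in>int_lattice. matern_term \<kappa> m k z) * F z)"
        by (intro pw[OF F]) simp
      moreover have "(\<Sum>\<^sub>\<infinity>k\<in>int_lattice. matern_term \<kappa> m k z) * F z =
          (case z of (x, y) \<Rightarrow> of_real (c * whittle_matern \<sigma> \<kappa> \<nu> x y) * F (x, y))" for z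
        using infsumI[OF c(2)] by (cases z) simp
      ultimately show ?thesis by (simp only:)
    qed
    then show "\<exists>c>0. (\<forall>x y. ((\<lambda>k. matern_term \<kappa> m k (x, y)) has_sum of_real (c * whittle_matern \<sigma> \<kappa> \<nu> x y)) int_lattice) \<and>
        (\<forall>F\<in>torus_smooth. C F = torus_integral (\<lambda>(x, y). of_real (c * whittle_matern \<sigma> \<kappa> \<nu> x y) * F (x, y)))"
      using c by blast
  qed
qed

end
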